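(* Let $s_1 < s_2 < s_3 < \cdots$ be the squarefree positive integers listed in increasing order. For each integer $h \ge 1$ let \[ \alpha(h) = \lim_{x \to \infty} \frac{1}{x} \, \bigl|\{ k \ge 1 : s_{k+1} \le x,\ s_{k+1} - s_k = h \}\bigr|, \] and for real $\gamma \ge 0$ let $B(\gamma) = \sum_{h=1}^{\infty} h^{\gamma} \alpha(h)$. Then for every real $\gamma$ with $0 \le \gamma < 3.75$, \[ \sum_{\substack{k \ge 1\\ x/2 < s_{k+1} \le x}} (s_{k+1} - s_k)^{\gamma} \sim \frac{1}{2} B(\gamma)\, x \qquad (x \to \infty), \] that is, the ratio of the left-hand side to $\frac{1}{2}B(\gamma)x$ tends to $1$ as $x \to \infty$.
   Context: A positive integer is squarefree if it is not divisible by the square of any prime. The limit defining $\alpha(h)$ exists for every $h \ge 1$ (a result of Mirsky), and $\alpha(h)$ satisfies $\log \alpha(h) \le -\frac{5}{4} h \log\log h + O(h)$, so the series $B(\gamma)=\sum_{h\ge1} h^\gamma\alpha(h)$ converges for every $\gamma \ge 0$ and $B(\gamma) > 0$. The notation $f(x) \sim g(x)$ means $\lim_{x\to\infty} f(x)/g(x) = 1$. *)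

theory Defs
  imports
    "HOL-Analysis.Analysis"
    "HOL-Computational_Algebra.Computational_Algebra"
    "HOL-Library.Infinite_Set"
begin

text \<open>
  The sequence is indexed from 1; the value at index \<open>0\<close> is a dummy that is never used.
\<close>

definition sqf_seq :: "nat \<Rightarrow> nat" where
  "sqf_seq k = enumerate {n. n > 0 \<and> squarefree n} (k - 1)"

text \<open>The difference is taken in the reals to avoid truncated subtraction.\<close>

definition sqf_gap :: "nat \<Rightarrow> real" where
  "sqf_gap k = real (sqf_seq (k + 1)) - real (sqf_seq k)"

definition gap_density :: "nat \<Rightarrow> real" where
  "gap_density h =
     Lim at_top (\<lambda>x::real.
       1 / x * real (card {k. k \<ge> 1 \<and> real (sqf_seq (k + 1)) \<le> x \<and> sqf_gap k = real h}))"

text \<open>The summation index is shifted by one, so that the sum runs over \<open>h \<ge> 1\<close>.\<close>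

definition gap_moment :: "real \<Rightarrow> real" where
  "gap_moment \<gamma> = (\<Sum>h. real (Suc h) powr \<gamma> * gap_density (Suc h))"

lemma infinite_squarefree_nat: "infinite {n::nat. n > 0 \<and> squarefree n}"
proof -
  have "{p::nat. prime p} \<subseteq> {n. n > 0 \<and> squarefree n}"
    by (auto intro: squarefree_prime prime_gt_0_nat)
  then show ?thesis
    using primes_infinite infinite_super by blast
qed

lemma sqf_seq_less:
  assumes "1 \<le> j" "j < k"
  shows "sqf_seq j < sqf_seq k"
  unfolding sqf_seq_def
  by (rule enumerate_mono[OF _ infinite_squarefree_nat]) (use assms in simp)

lemma sqf_seq_image: "sqf_seq ` {1..} = {n. n > 0 \<and> squarefree n}"
proof -
  have "sqf_seq ` {1..} = range (enumerate {n::nat. n > 0 \<and> squarefree n})"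
  proof (intro equalityI subsetI)
    fix y assume "y \<in> range (enumerate {n::nat. n > 0 \<and> squarefree n})"
    then obtain m where "y = enumerate {n::nat. n > 0 \<and> squarefree n} m" by blast
    then have "y = sqf_seq (Suc m)" by (simp add: sqf_seq_def)
    then show "y \<in> sqf_seq ` {1..}" by force
  qed (auto simp: sqf_seq_def)
  then show ?thesis
    using range_enumerate[OF infinite_squarefree_nat] by simp
qed

lemma finite_sqf_seq_le: "finite {k. real (sqf_seq (k + 1)) \<le> x}"
proof (rule finite_subset)
  show "{k. real (sqf_seq (k + 1)) \<le> x} \<subseteq> {..nat \<lfloor>x\<rfloor>}"
  proof
    fix k assume k: "k \<in> {k. real (sqf_seq (k + 1)) \<le> x}"
    have "k \<le> sqf_seq (k + 1)"
      unfolding sqf_seq_def using le_enumerate[OF infinite_squarefree_nat, of k] by simp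
    with k have "real k \<le> x" by simp
    then show "k \<in> {..nat \<lfloor>x\<rfloor>}" by (simp add: le_nat_floor)
  qed
qed simp

end

theory Submission
  imports Defs "HOL-Real_Asymp.Real_Asymp"
begin

text \<open>
  The density of the gaps of a fixed length exists because the squarefree numbers are approximated by
  periodic sets, so the theorem follows once the long gaps are shown to contribute little: there are
  \<open>O(X H powr -3.76)\<close> disjoint intervals of length \<open>H\<close> below \<open>X\<close> that contain no squarefree number.

  At least \<open>3H/20\<close> of the integers of such an interval have the form \<open>p\<^sup>2 m\<close> with a prime \<open>p > H/10\<close>, and
  only few intervals need primes beyond \<open>H powr 2.8\<close>. So suppose that an interval has about \<open>H\<close> such
  primes between \<open>P\<close> and \<open>2P\<close>; the typical distance of neighbours is then \<open>D = P/H\<close>.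

  If \<open>P \<ge> H powr 1.39\<close>, count pairs \<open>u, u + a\<close> with \<open>u\<^sup>2 m - (u + a)\<^sup>2 n = r\<close> and \<open>\<bar>r\<bar> \<le> H\<close>. The identity
  \<open>u\<^sup>2 (2u + 3a) - (u + a)\<^sup>2 (2u - a) = a\<^sup>3\<close> gives \<open>a\<^sup>3 n = l u\<^sup>2 + (2u - a) r\<close> with the integer
  \<open>l = n (2u + 3a) - m (2u - a)\<close>, and modulo \<open>a\<^sup>3\<close> this has essentially one solution \<open>u\<close> for given \<open>l\<close>
  and \<open>r\<close>. Taking every other prime ensures \<open>l \<noteq> 0\<close>.

  If \<open>P \<le> H powr 1.39\<close>, count triples \<open>u - a, u, u + b\<close> with cofactors \<open>m\<^sub>0, m\<^sub>1, m\<^sub>2\<close>. With \<open>J = m\<^sub>0 - m\<^sub>1\<close> and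
  \<open>k = b (m\<^sub>0 - m\<^sub>1) - a (m\<^sub>1 - m\<^sub>2)\<close>, eliminating \<open>m\<^sub>1\<close> shows that \<open>k (6u + 8b + a)\<close> is very close to
  \<open>9 b (a + b) J\<close> as long as \<open>m\<^sub>1\<close> is at most \<open>H P\<^sup>2 / D\<^sup>4\<close>, so that \<open>u\<close> is restricted to few residue classes
  modulo \<open>9 b (a + b)\<close>. Larger \<open>m\<^sub>1\<close> are treated in windows of this length, because the difference of two
  solutions is again a solution.
\<close>

section \<open>Divisors, congruences and counting\<close>

text \<open>The exponents come from one balance. For intervals that use about H primes between P and
  2P, the pair count gives X H^(-4) + X H^(-1) P^(-2) and the triple count gives X H^(-4) + X P^3
  H^(-8), up to small powers of H. The two P-dependent terms agree at P = H^(7/5), where both equal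
  X H^(-3.8); the switch at H powr 1.39 lies just below that point. Primes beyond Z cost X / (H Z),
  so Z = H powr 2.8 is matched to the same exponent 3.8.

  Divisor functions, harmonic sums, the number of dyadic ranges and the enforced spacing of the
  roots are all paid for with powers of H powr 0.001. This slack leaves 3.76, and any exponent above
  3.75 makes the dyadic sum over gap lengths a convergent geometric series.

  The estimate assumes no relation between H and X. This uniformity lets one tail bound serve for
  gaps of every length up to X: a cutoff for the gap length can be fixed first, and only then does x
  tend to infinity. Convergence and positivity of the moment series come out on the way.\<close>

lemma card_divisors_prime_power_mult_le:
  fixes p m e :: nat
  assumes "prime p" "m > 0"
  shows "card {d. d dvd p ^ e * m} \<le> (e + 1) * card {d. d dvd m}"
proof -
  have fin: "finite ({..e} \<times> {d. d dvd m})"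
    using assms by auto
  have "{d. d dvd p ^ e * m} \<subseteq> (\<lambda>(i, d). p ^ i * d) ` ({..e} \<times> {d. d dvd m})"
  proof
    fix d assume "d \<in> {d. d dvd p ^ e * m}"
    then obtain b c where "d = b * c" "b dvd p ^ e" "c dvd m"
      using division_decomp[of d "p ^ e" m] by auto
    moreover then obtain i where "i \<le> e" "b = p ^ i"
      using divides_primepow_nat[OF assms(1)] by blast
    ultimately show "d \<in> (\<lambda>(i, d). p ^ i * d) ` ({..e} \<times> {d. d dvd m})"
      by force
  qed
  then have "card {d. d dvd p ^ e * m} \<le> card ({..e} \<times> {d. d dvd m})"
    using fin by (meson card_image_le card_mono finite_imageI le_trans)
  then show ?thesis by (simp add: card_cartesian_product)
qed

text \<open>The quotient of the divisor function by \<open>n powr \<epsilon>\<close> factors over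
  prime powers. A prime of size at least \<open>2 powr (1 / \<epsilon>)\<close> contributes a factor
  of at most 1, because \<open>e + 1 \<le> 2 ^ e\<close>; each of the boundedly many smaller primes
  contributes at most \<open>K\<close>. The induction strips one full prime power at a time.\<close>

lemma card_divisors_le_powr:
  fixes \<epsilon> :: real
  assumes "\<epsilon> > 0"
  obtains C where "C \<ge> 1" "\<And>n::nat. n > 0 \<Longrightarrow> real (card {d. d dvd n}) \<le> C * real n powr \<epsilon>"
proof -
  define B where "B = nat \<lceil>2 powr (1 / \<epsilon>)\<rceil>"
  \<comment> \<open>Chosen so that \<open>e + 1 \<le> K * (1 + e * \<epsilon> * ln 2)\<close>; the
    last factor is at most \<open>2 powr (e * \<epsilon>)\<close>.\<close>
  define K where "K = 1 + 1 / (\<epsilon> * ln 2)"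
  have K1: "K \<ge> 1" unfolding K_def using assms by simp
  have *: "real (card {d. d dvd n}) \<le> K ^ card {p. prime p \<and> p dvd n \<and> p < B} * real n powr \<epsilon>"
    if "n > 0" for n :: nat
    using that
  proof (induction n rule: less_induct)
    case (less n)
    show ?case
    proof (cases "n = 1")
      case True
      have "{d::nat. d dvd 1} = {1}" by auto
      then show ?thesis using True K1 by simp
    next
      case False
      then obtain p where p: "prime p" "p dvd n" using prime_factor_nat by blast
      define e where "e = multiplicity p n"
      obtain m where m: "n = p ^ e * m" "\<not> p dvd m"
        unfolding e_def using multiplicity_decompose'[of n p] less.prems p
        by (metis not_prime_unit not_gr0)
      have m0: "m > 0" using m less.prems by (cases m) auto
      have e1: "e > 0" using p m by (cases e) auto
      have p2: "p \<ge> 2" using p prime_ge_2_nat by blast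
      have "p ^ e \<ge> p ^ 1" using e1 p2 by (intro power_increasing) auto
      then have "p ^ e > 1" using p2 by simp
      then have mn: "m < n" using m m0 by simp
      let ?S = "\<lambda>n. {p. prime p \<and> p dvd n \<and> p < B}"
      have S: "?S n = (if p < B then insert p (?S m) else ?S m)"
      proof -
        have "r = p \<or> r dvd m" if "prime r" "r dvd n" for r
          using that m p by (metis prime_dvd_mult_iff prime_dvd_power primes_dvd_imp_eq)
        moreover have "r dvd n" if "r dvd m" for r using that m by simp
        ultimately show ?thesis using p by auto
      qed
      have finS: "finite (?S m)" by (rule finite_subset[of _ "{..<B}"]) auto
      have pS: "p \<notin> ?S m" using m by auto
      have key: "real e + 1 \<le> (if p < B then K else 1) * (real (p ^ e)) powr \<epsilon>"
      proof (cases "p < B")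
        case True
        have "1 + real e * \<epsilon> * ln 2 \<le> exp (real e * \<epsilon> * ln 2)" by (rule exp_ge_add_one_self)
        also have "\<dots> = 2 powr (real e * \<epsilon>)" by (simp add: powr_def)
        also have "\<dots> \<le> real p powr (real e * \<epsilon>)" using p2 assms by (intro powr_mono2) auto
        also have "\<dots> = (real (p ^ e)) powr \<epsilon>"
          using p2 by (simp add: powr_powr[symmetric] powr_realpow)
        finally have 1: "1 + real e * \<epsilon> * ln 2 \<le> (real (p ^ e)) powr \<epsilon>" .
        have "real e + 1 \<le> K * (1 + real e * \<epsilon> * ln 2)"
        proof -
          have "K * (1 + real e * \<epsilon> * ln 2) = 1 + real e * \<epsilon> * ln 2 + 1 / (\<epsilon> * ln 2) + real e"
            unfolding K_def using assms by (simp add: field_simps)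
          moreover have "real e * \<epsilon> * ln 2 \<ge> 0" "1 / (\<epsilon> * ln 2) \<ge> 0" using assms by auto
          ultimately show ?thesis by linarith
        qed
        also have "\<dots> \<le> K * (real (p ^ e)) powr \<epsilon>" using 1 K1 by (intro mult_left_mono) auto
        finally show ?thesis using True by simp
      next
        case False
        then have "2 powr (1 / \<epsilon>) \<le> real p" unfolding B_def by linarith
        then have "(2 powr (1 / \<epsilon>)) powr \<epsilon> \<le> real p powr \<epsilon>" using assms by (intro powr_mono2) auto
        then have 2: "2 \<le> real p powr \<epsilon>" using assms by (simp add: powr_powr)
        have "real e + 1 \<le> 2 ^ e" by (induction e) auto
        also have "\<dots> \<le> (real p powr \<epsilon>) ^ e" using 2 by (intro power_mono) auto
        also have "\<dots> = (real (p ^ e)) powr \<epsilon>"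
          using p2 by (simp add: powr_powr powr_realpow[symmetric] mult.commute)
        finally show ?thesis using False by simp
      qed
      have "real (card {d. d dvd n}) \<le> real ((e + 1) * card {d. d dvd m})"
        unfolding m(1) using card_divisors_prime_power_mult_le[OF p(1) m0] of_nat_mono by blast
      also have "\<dots> = (real e + 1) * real (card {d. d dvd m})"
        by (simp add: algebra_simps)
      also have "\<dots> \<le> ((if p < B then K else 1) * (real (p ^ e)) powr \<epsilon>) *
          (K ^ card (?S m) * real m powr \<epsilon>)"
        using key less.IH[OF mn m0] by (intro mult_mono) auto
      also have "\<dots> = K ^ card (?S n) * real n powr \<epsilon>"
      proof -
        have 1: "(if p < B then K else 1) * K ^ card (?S m) = K ^ card (?S n)"
          using S card_insert_disjoint[OF finS pS] by (cases "p < B") simp_all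
        have 2: "real n powr \<epsilon> = real (p ^ e) powr \<epsilon> * real m powr \<epsilon>"
          unfolding m(1) of_nat_mult by (rule powr_mult)
        have aux: "x * p * (y * m) = z * (p * m)" if "x * y = z" for x y z p m :: real
          unfolding that[symmetric] by (simp add: ac_simps)
        show ?thesis unfolding 2 by (rule aux[OF 1])
      qed
      finally show ?thesis .
    qed
  qed
  show ?thesis
  proof (rule that[of "K ^ B"])
    show "K ^ B \<ge> 1" using K1 by simp
    fix n :: nat assume n: "n > 0"
    have "card {p. prime p \<and> p dvd n \<and> p < B} \<le> card {..<B}" by (intro card_mono) auto
    then have "K ^ card {p. prime p \<and> p dvd n \<and> p < B} \<le> K ^ B"
      using K1 by (intro power_increasing) auto
    then show "real (card {d. d dvd n}) \<le> K ^ B * real n powr \<epsilon>"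
      using *[OF n] by (meson mult_right_mono order_trans powr_ge_zero)
  qed
qed

lemma card_multiples_initial_le:
  fixes X m :: nat
  assumes "m > 0"
  shows "m * card {N \<in> {1..X}. m dvd N} \<le> X"
proof -
  have "card {N \<in> {1..X}. m dvd N} \<le> card {1..X div m}"
  proof (rule card_inj_on_le)
    show "inj_on (\<lambda>k. k div m) {N \<in> {1..X}. m dvd N}"
      by (intro inj_onI) (metis (mono_tags, lifting) dvd_div_mult_self mem_Collect_eq)
    show "(\<lambda>k. k div m) ` {N \<in> {1..X}. m dvd N} \<subseteq> {1..X div m}"
      using assms by (auto simp: div_le_mono dvd_imp_le Suc_le_eq div_greater_zero_iff)
  qed simp
  then have "m * card {N \<in> {1..X}. m dvd N} \<le> m * (X div m)" by simp
  then show ?thesis by (meson le_trans times_div_less_eq_dividend)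
qed

text \<open>Bound each gcd by the sum of all common divisors. A divisor \<open>d\<close> of
  \<open>q\<close> then occurs for at most \<open>K / d\<close> values of \<open>k\<close> and
  contributes at most \<open>K\<close> in total.\<close>

lemma sum_gcd_le:
  fixes q K :: nat
  assumes "q > 0"
  shows "(\<Sum>k=1..K. gcd k q) \<le> K * card {d. d dvd q}"
proof -
  have fin: "finite {d. d dvd q}" using assms by simp
  have "(\<Sum>k=1..K. gcd k q) \<le> (\<Sum>k=1..K. \<Sum>d | d dvd q. if d dvd k then d else 0)"
  proof (intro sum_mono)
    fix k assume "k \<in> {1..K}"
    have "gcd k q = (\<Sum>d\<in>{gcd k q}. if d dvd k then d else 0)" by simp
    also have "\<dots> \<le> (\<Sum>d | d dvd q. if d dvd k then d else 0)"
      using fin by (intro sum_mono2) auto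
    finally show "gcd k q \<le> (\<Sum>d | d dvd q. if d dvd k then d else 0)" .
  qed
  also have "\<dots> = (\<Sum>d | d dvd q. \<Sum>k=1..K. if d dvd k then d else 0)"
    by (rule sum.swap)
  also have "\<dots> = (\<Sum>d | d dvd q. d * card {k \<in> {1..K}. d dvd k})"
  proof (rule sum.cong[OF refl])
    fix d
    have "(\<Sum>k=1..K. if d dvd k then d else 0) = (\<Sum>k\<in>{k \<in> {1..K}. d dvd k}. d)"
      by (rule sum.inter_filter[symmetric]) simp
    then show "(\<Sum>k=1..K. if d dvd k then d else 0) = d * card {k \<in> {1..K}. d dvd k}" by simp
  qed
  also have "\<dots> \<le> (\<Sum>d | d dvd q. K)"
    using assms by (intro sum_mono card_multiples_initial_le) (auto intro: Nat.gr0I)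
  finally show ?thesis by (simp add: mult.commute)
qed

lemma card_congruent_le:
  fixes A :: "int set" and m P :: int and N :: nat
  assumes "m > 0" "A \<subseteq> {P<..P + int N}" "\<And>u v. u \<in> A \<Longrightarrow> v \<in> A \<Longrightarrow> m dvd u - v"
  shows "real (card A) \<le> real N / real_of_int m + 1"
proof -
  have "card A \<le> card {0..int N div m}"
  proof (rule card_inj_on_le)
    show "inj_on (\<lambda>u. (u - P) div m) A"
    proof (rule inj_onI)
      fix u v assume uv: "u \<in> A" "v \<in> A" and eq: "(u - P) div m = (v - P) div m"
      have "m dvd (u - P) - (v - P)" using assms(3)[OF uv] by simp
      then have "(u - P) mod m = (v - P) mod m" by (simp add: mod_eq_dvd_iff)
      then have "u - P = v - P" using eq by (metis mult_div_mod_eq)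
      then show "u = v" by simp
    qed
    show "(\<lambda>u. (u - P) div m) ` A \<subseteq> {0..int N div m}"
      using assms(1,2) by (auto intro!: zdiv_mono1 simp: pos_imp_zdiv_nonneg_iff dest!: subsetD)
  qed simp
  also have "\<dots> = nat (int N div m + 1)" by simp
  finally have "real (card A) \<le> real_of_int (int N div m) + 1"
    using assms(1) pos_imp_zdiv_nonneg_iff[of m "int N"] by linarith
  also have "real_of_int (int N div m) \<le> real N / real_of_int m"
    using real_of_int_div4[of "int N" m] by simp
  finally show ?thesis by simp
qed

text \<open>Cancelling \<open>gcd c m\<close> leaves a congruence modulo
  \<open>m div gcd c m\<close>. The loss of the gcd is harmless on average over \<open>c\<close>, by
  \<open>sum_gcd_le\<close>.\<close>

lemma card_scaled_congruent_le:
  fixes A :: "int set" and m c P :: int and N :: nat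
  assumes "m > 0" "A \<subseteq> {P<..P + int N}" "\<And>u v. u \<in> A \<Longrightarrow> v \<in> A \<Longrightarrow> m dvd c * (u - v)"
  shows "real (card A) \<le> real N * real_of_int (gcd c m) / real_of_int m + 1"
proof -
  have g: "gcd c m > 0" using assms(1) by simp
  define m' where "m' = m div gcd c m"
  have m: "m = m' * gcd c m" unfolding m'_def by simp
  have m'0: "m' > 0" using m g assms(1) by (metis zero_less_mult_pos2)
  have "real (card A) \<le> real N / real_of_int m' + 1"
  proof (rule card_congruent_le[OF m'0 assms(2)])
    fix u v assume "u \<in> A" "v \<in> A"
    then have "m dvd c * (u - v)" by (rule assms(3))
    moreover obtain c' where c': "c = gcd c m * c'" using gcd_dvd1 by blast
    then have cg: "c div gcd c m = c'" using g by (metis less_irrefl nonzero_mult_div_cancel_left)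
    moreover have "c * (u - v) = (c' * (u - v)) * gcd c m"
      by (subst c') (simp add: ac_simps)
    ultimately have "m' * gcd c m dvd (c' * (u - v)) * gcd c m"
      using m by argo
    moreover have "gcd c m \<noteq> 0" using g by linarith
    ultimately have "m' dvd c' * (u - v)" by (metis dvd_times_right_cancel_iff mult.commute)
    then have "m' dvd c div gcd c m * (u - v)" unfolding cg .
    moreover have "coprime m' (c div gcd c m)"
      unfolding m'_def using assms(1) div_gcd_coprime[of c m] by (simp add: coprime_commute)
    ultimately show "m' dvd u - v" by (simp add: coprime_dvd_mult_right_iff)
  qed
  also have "real N / real_of_int m' = real N * real_of_int (gcd c m) / real_of_int m"
    by (subst (2) m) (use g in \<open>simp add: field_simps\<close>)
  finally show ?thesis .
qed

text \<open>Inside one window of length \<open>L\<close>, subtracting the least element of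
  \<open>A\<close> maps all other elements into \<open>Z\<close>. The initial window is treated
  without this shift, so that no additive 1 appears when \<open>M < L\<close>; summed over all
  parameters, such a term would be too expensive.\<close>

lemma card_le_windows:
  fixes A Z :: "nat set" and M L :: nat
  assumes "L > 0" "finite Z" "A \<subseteq> {1..M}" "\<And>x. x \<in> A \<Longrightarrow> x < L \<Longrightarrow> x \<in> Z"
    and "\<And>x y. x \<in> A \<Longrightarrow> y \<in> A \<Longrightarrow> x < y \<Longrightarrow> y - x < L \<Longrightarrow> y - x \<in> Z"
  shows "card A \<le> card Z + (M div L) * (1 + card Z)"
proof -
  have finA: "finite A" using assms(3) finite_subset by blast
  have sub: "A \<subseteq> (A \<inter> {..<L}) \<union> (\<Union>w\<in>{1..M div L}. {x\<in>A. x div L = w})"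
  proof
    fix x assume x: "x \<in> A"
    then have "x div L \<le> M div L" using assms(3) by (auto intro!: div_le_mono)
    then show "x \<in> (A \<inter> {..<L}) \<union> (\<Union>w\<in>{1..M div L}. {x\<in>A. x div L = w})"
      using x assms(1) by (cases "x < L") (auto simp: div_greater_zero_iff Suc_le_eq)
  qed
  have first: "card (A \<inter> {..<L}) \<le> card Z"
    using assms(2,4) by (intro card_mono) auto
  have win: "card {x\<in>A. x div L = w} \<le> 1 + card Z" for w
  proof (cases "{x\<in>A. x div L = w} = {}")
    case False
    define m where "m = Min {x\<in>A. x div L = w}"
    have m: "m \<in> {x\<in>A. x div L = w}" unfolding m_def using False finA by (intro Min_in) auto
    have mle: "m \<le> x" if "x \<in> A" "x div L = w" for x
      unfolding m_def using finA that by (intro Min_le) auto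
    have "{x\<in>A. x div L = w} \<subseteq> insert m ((+) m ` Z)"
    proof
      fix x assume x: "x \<in> {x\<in>A. x div L = w}"
      show "x \<in> insert m ((+) m ` Z)"
      proof (cases "x = m")
        case False
        then have "m < x" using mle[of x] x by auto
        moreover have "x - m < L"
        proof -
          have "x = L * w + x mod L" "m = L * w + m mod L"
            using x m mult_div_mod_eq[of L x] mult_div_mod_eq[of L m] by auto
          moreover have "x mod L < L" using assms(1) by simp
          ultimately show ?thesis by linarith
        qed
        ultimately have "x - m \<in> Z" using assms(5)[of m x] m x by auto
        then show ?thesis using \<open>m < x\<close> by (auto simp: image_iff intro!: bexI[of _ "x - m"])
      qed simp
    qed
    then have "card {x\<in>A. x div L = w} \<le> card (insert m ((+) m ` Z))"
      using assms(2) by (intro card_mono) auto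
    also have "\<dots> \<le> Suc (card ((+) m ` Z))"
      using assms(2) by (simp add: card_insert_if)
    also have "\<dots> \<le> 1 + card Z" using card_image_le[OF assms(2), of "(+) m"] by simp
    finally show ?thesis .
  next
    case True
    show ?thesis unfolding True by simp
  qed
  have "card A \<le> card ((A \<inter> {..<L}) \<union> (\<Union>w\<in>{1..M div L}. {x\<in>A. x div L = w}))"
    using finA by (intro card_mono sub) auto
  also have "\<dots> \<le> card (A \<inter> {..<L}) + card (\<Union>w\<in>{1..M div L}. {x\<in>A. x div L = w})"
    by (rule card_Un_le)
  also have "card (\<Union>w\<in>{1..M div L}. {x\<in>A. x div L = w}) \<le> (\<Sum>w\<in>{1..M div L}. card {x\<in>A. x div L = w})"
    by (rule card_UN_le) simp
  also have "\<dots> \<le> (\<Sum>w\<in>{1..M div L}. 1 + card Z)" by (intro sum_mono win)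
  finally show ?thesis using first by simp
qed

text \<open>The gaps \<open>x\<^sub>i\<^sub>+\<^sub>2 - x\<^sub>i\<close> telescope to at most twice the length of the interval.\<close>

lemma consecutive_triples:
  fixes S :: "nat set" and P D :: nat
  assumes "finite S" "S \<subseteq> {P<..2 * P}" "D > 0"
  obtains T where "T \<subseteq> S \<times> S \<times> S" "inj_on fst T" "real (card T) \<ge> real (card S) - 2 - 2 * real P / real D"
    "\<And>x y z. (x, y, z) \<in> T \<Longrightarrow> x < y \<and> y < z \<and> z - x \<le> D"
proof -
  define xs where "xs = sorted_list_of_set S"
  define n where "n = card S"
  have xs: "set xs = S" "sorted_wrt (<) xs" "length xs = n" "distinct xs"
    unfolding xs_def n_def using assms(1) by auto
  have mono: "xs ! i < xs ! j" if "i < j" "j < n" for i j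
    using xs that by (auto simp: sorted_wrt_iff_nth_less)
  have mem: "xs ! i \<in> S" if "i < n" for i using xs that nth_mem by blast
  define Bad where "Bad = {i. i + 2 < n \<and> xs ! (i + 2) - xs ! i > D}"
  define Good where "Good = {i. i + 2 < n \<and> xs ! (i + 2) - xs ! i \<le> D}"
  define f where "f = (\<lambda>i. (xs ! i, xs ! (i + 1), xs ! (i + 2)))"
  have finB: "finite Bad" "finite Good" by (auto simp: Bad_def Good_def intro: finite_subset[of _ "{..<n}"])
  have tele: "(\<Sum>i<m. real (xs ! (i + 2)) - real (xs ! i)) =
      real (xs ! (m + 1)) + real (xs ! m) - real (xs ! 0) - real (xs ! 1)" for m
    by (induction m) auto
  have badcard: "real D * real (card Bad) \<le> 2 * real P"
  proof (cases "n < 2")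
    case True
    then have "Bad = {}" unfolding Bad_def by auto
    then show ?thesis by simp
  next
    case False
    have "real D * real (card Bad) = (\<Sum>i\<in>Bad. real D)" by simp
    also have "\<dots> \<le> (\<Sum>i\<in>Bad. real (xs ! (i + 2)) - real (xs ! i))"
      by (intro sum_mono) (auto simp: Bad_def)
    also have "\<dots> \<le> (\<Sum>i<n - 2. real (xs ! (i + 2)) - real (xs ! i))"
    proof (intro sum_mono2)
      show "Bad \<subseteq> {..<n - 2}" by (auto simp: Bad_def)
      fix i assume "i \<in> {..<n - 2} - Bad"
      then have "xs ! i < xs ! (i + 2)" by (intro mono) auto
      then show "0 \<le> real (xs ! (i + 2)) - real (xs ! i)" by simp
    qed simp
    also have "\<dots> = real (xs ! (n - 2 + 1)) + real (xs ! (n - 2)) - real (xs ! 0) - real (xs ! 1)"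
      by (rule tele)
    also have "\<dots> \<le> 2 * real P"
    proof -
      have "xs ! (n - 2 + 1) \<in> S" "xs ! (n - 2) \<in> S" "xs ! 0 \<in> S" "xs ! 1 \<in> S"
        using False by (auto intro!: mem)
      then have "xs ! (n - 2 + 1) \<le> 2 * P" "xs ! (n - 2) \<le> 2 * P" "xs ! 0 > P" "xs ! 1 > P"
        using assms(2) by (meson greaterThanAtMost_iff subsetD)+
      then show ?thesis by linarith
    qed
    finally show ?thesis .
  qed
  show ?thesis
  proof (rule that[of "f ` Good"])
    show "f ` Good \<subseteq> S \<times> S \<times> S" by (auto simp: f_def Good_def intro!: mem)
    show "inj_on fst (f ` Good)"
    proof (rule inj_onI)
      fix p q assume "p \<in> f ` Good" "q \<in> f ` Good" and e: "fst p = fst q"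
      then obtain i k where ik: "i \<in> Good" "k \<in> Good" "p = f i" "q = f k" by blast
      then have "xs ! i = xs ! k" using e by (simp add: f_def)
      then have "i = k" using xs ik by (simp add: Good_def nth_eq_iff_index_eq)
      then show "p = q" using ik by simp
    qed
    have "inj_on f Good"
    proof (rule inj_onI)
      fix i j assume ij: "i \<in> Good" "j \<in> Good" "f i = f j"
      then have "xs ! i = xs ! j" by (simp add: f_def)
      then show "i = j" using xs ij by (simp add: Good_def nth_eq_iff_index_eq)
    qed
    then have cg: "card (f ` Good) = card Good" by (rule card_image)
    have "{..<n - 2} \<subseteq> Good \<union> Bad" by (auto simp: Good_def Bad_def)
    then have "n - 2 \<le> card (Good \<union> Bad)"
      using finB by (metis card_lessThan card_mono finite_UnI)
    also have "\<dots> \<le> card Good + card Bad" by (rule card_Un_le)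
    finally have "real n - 2 \<le> real (card Good) + real (card Bad)" by linarith
    moreover have "real (card Bad) \<le> 2 * real P / real D"
      using badcard assms(3) by (simp add: field_simps)
    ultimately show "real (card (f ` Good)) \<ge> real (card S) - 2 - 2 * real P / real D"
      unfolding cg n_def by linarith
    fix x y z assume "(x, y, z) \<in> f ` Good"
    then show "x < y \<and> y < z \<and> z - x \<le> D"
      by (auto simp: f_def Good_def intro!: mono)
  qed
qed

section \<open>Triples of nearby multiples of squares\<close>

text \<open>The first identity says that \<open>2 * u * k\<close> is nearly
  \<open>3 * b * (a + b) * J\<close>. The second sharpens this by polynomial division in
  \<open>u\<close>: the quotient of \<open>9 * (2 * u - a) * (u + b)^2\<close> by \<open>R\<close>
  is exactly \<open>6 * u + 8 * b + a\<close>, with a remainder only linear in \<open>u\<close>. The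
  factor 9 makes the quotient integral. \<open>E\<close> collects everything that comes from the
  distances \<open>r\<close> and \<open>r'\<close>.\<close>

lemma close_squares_triple_identity:
  fixes u a b t0 t1 t2 :: int
  defines "r \<equiv> (u - a)\<^sup>2 * t0 - u\<^sup>2 * t1" and "r' \<equiv> u\<^sup>2 * t1 - (u + b)\<^sup>2 * t2"
    and "J \<equiv> t0 - t1" and "k \<equiv> b * (t0 - t1) - a * (t1 - t2)"
    and "R \<equiv> 3 * u\<^sup>2 - 2 * (a - b) * u - a * b"
  defines "E \<equiv> (2 * u - a) * (b * r - a * r') + b * (a + b) * r"
  shows "k * ((2 * u - a) * (u + b)\<^sup>2) = b * (a + b) * J * R + E"
    and "R * (k * (6 * u + 8 * b + a) - 9 * b * (a + b) * J) =
      9 * E - k * (2 * (a\<^sup>2 + a * b + b\<^sup>2) * u + a * b * (a - b))"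
    and "(u - a)\<^sup>2 * J = a * (2 * u - a) * t1 + r"
  unfolding assms by algebra+

text \<open>The lower bound \<open>j\<close> on both differences makes the main term
  \<open>b * (a + b) * J * R\<close> at least \<open>4 * j^2 * u^2\<close>, whereas \<open>E\<close>
  is at most \<open>5 * u * D * H\<close>. The condition
  \<open>5 * D * H \<le> j\<^sup>2 * u\<close> says that the main term wins, so that
  \<open>k\<close> is positive.\<close>

locale close_squares_triple =
  fixes u a b t0 t1 t2 j D H :: int
  assumes j: "1 \<le> j" "j \<le> a" "j \<le> b" and D: "a \<le> D" "b \<le> D" "20 * D \<le> u"
    and H: "0 \<le> H" "5 * D * H \<le> j\<^sup>2 * u" "10 * D * H \<le> u\<^sup>2"
    and t1: "t1 \<ge> 1"
    and r: "\<bar>(u - a)\<^sup>2 * t0 - u\<^sup>2 * t1\<bar> \<le> H" and r': "\<bar>u\<^sup>2 * t1 - (u + b)\<^sup>2 * t2\<bar> \<le> H"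
begin

definition "J = t0 - t1"
definition "k = b * (t0 - t1) - a * (t1 - t2)"
definition "R = 3 * u\<^sup>2 - 2 * (a - b) * u - a * b"
definition "E = (2 * u - a) * (b * ((u - a)\<^sup>2 * t0 - u\<^sup>2 * t1) - a * (u\<^sup>2 * t1 - (u + b)\<^sup>2 * t2))
    + b * (a + b) * ((u - a)\<^sup>2 * t0 - u\<^sup>2 * t1)"

lemma pos: "a > 0" "b > 0" "D > 0" "u > 0" "u \<ge> 20 * a" "u \<ge> 20 * b"
  using j D by auto

lemma R_bounds: "2 * u\<^sup>2 \<le> R" "5 * R \<le> 16 * u\<^sup>2"
proof -
  have 1: "20 * (a * u) \<le> u\<^sup>2" "20 * (b * u) \<le> u\<^sup>2"
    using pos mult_right_mono[of "20 * a" u u] mult_right_mono[of "20 * b" u u]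
    by (simp_all add: power2_eq_square)
  have 2: "20 * (a * b) \<le> a * u" using pos by (simp add: mult_left_mono)
  have 3: "0 \<le> a * b" "0 \<le> a * u" "0 \<le> b * u" using pos by auto
  have R: "R = 3 * u\<^sup>2 - 2 * (a * u) + 2 * (b * u) - a * b" unfolding R_def by algebra
  show "2 * u\<^sup>2 \<le> R" unfolding R using 1 2 3 by linarith
  have "5 * R = 15 * u\<^sup>2 - 10 * (a * u) + 10 * (b * u) - 5 * (a * b)" unfolding R by simp
  then show "5 * R \<le> 16 * u\<^sup>2" using 1 2 3 zero_le_power2[of u] by linarith
qed

lemma E_bound: "\<bar>E\<bar> \<le> 5 * (u * D * H)"
proof -
  define x where "x = (u - a)\<^sup>2 * t0 - u\<^sup>2 * t1"
  define y where "y = u\<^sup>2 * t1 - (u + b)\<^sup>2 * t2"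
  have xy: "\<bar>x\<bar> \<le> H" "\<bar>y\<bar> \<le> H" unfolding x_def y_def by (rule r r')+
  have bx: "\<bar>b * x\<bar> \<le> D * H" "\<bar>a * y\<bar> \<le> D * H"
    using xy pos D H mult_mono[of "\<bar>b\<bar>" D "\<bar>x\<bar>" H] mult_mono[of "\<bar>a\<bar>" D "\<bar>y\<bar>" H]
    by (simp_all add: abs_mult)
  have "\<bar>E\<bar> \<le> \<bar>(2 * u - a) * (b * x - a * y)\<bar> + \<bar>(a + b) * (b * x)\<bar>"
    unfolding E_def x_def[symmetric] y_def[symmetric]
    using abs_triangle_ineq[of "(2 * u - a) * (b * x - a * y)" "b * (a + b) * x"]
    by (simp add: ac_simps)
  also have "\<bar>(2 * u - a) * (b * x - a * y)\<bar> \<le> (2 * u) * (2 * (D * H))"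
    unfolding abs_mult[of "2 * u - a"] using bx pos by (intro mult_mono) auto
  also have "\<bar>(a + b) * (b * x)\<bar> \<le> u * (D * H)"
    unfolding abs_mult[of "a + b"] by (rule mult_mono) (use bx pos in auto)
  finally show ?thesis by (simp add: algebra_simps)
qed

lemma jDu: "5 * H \<le> j * u" 
proof -
  have "5 * H * D \<le> j * u * j" using H(2) by (simp add: power2_eq_square ac_simps)
  also have "\<dots> \<le> j * u * D" using j D pos by (intro mult_left_mono) auto
  finally show ?thesis using pos by simp
qed

lemma J_eq: "(u - a)\<^sup>2 * J = a * (2 * u - a) * t1 + ((u - a)\<^sup>2 * t0 - u\<^sup>2 * t1)"
  unfolding J_def by (rule close_squares_triple_identity)

lemma a_lower: "5 * H \<le> a * u" "9 * H < a * (2 * u - a) \<or> H = 0" "0 < a * (2 * u - a)"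
proof -
  show 1: "5 * H \<le> a * u" using jDu j pos mult_right_mono[of j a u] by linarith
  have "a * (19 * u) \<le> a * (10 * (2 * u - a))" using pos by (intro mult_left_mono) auto
  then have 2: "19 * (a * u) \<le> 10 * (a * (2 * u - a))" by (simp add: algebra_simps)
  show "9 * H < a * (2 * u - a) \<or> H = 0" using 1 2 H(1) by linarith
  show "0 < a * (2 * u - a)" using pos by simp
qed

lemma J_pos: "J \<ge> 1"
proof -
  have "a * (2 * u - a) * 1 \<le> a * (2 * u - a) * t1" using t1 a_lower(3) by (intro mult_left_mono) auto
  then have "(u - a)\<^sup>2 * J > 0" unfolding J_eq using a_lower r H(1) by linarith
  then show ?thesis using zero_less_mult_pos[of "(u - a)\<^sup>2" J] pos by simp
qed

lemma J_upper: "4 * (u\<^sup>2 * J) \<le> 5 * (2 * (D * u * t1) + H)"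
proof -
  have u: "19 * u \<le> 20 * (u - a)" using pos by simp
  have "(19 * u)\<^sup>2 \<le> (20 * (u - a))\<^sup>2" using u pos by (intro power_mono) auto
  then have "361 * u\<^sup>2 \<le> 400 * (u - a)\<^sup>2" unfolding power_mult_distrib by simp
  then have "4 * u\<^sup>2 \<le> 5 * (u - a)\<^sup>2" using zero_le_power2[of u] by linarith
  then have "4 * u\<^sup>2 * J \<le> 5 * (u - a)\<^sup>2 * J" using J_pos by (intro mult_right_mono) auto
  also have "\<dots> = 5 * (a * (2 * u - a) * t1 + ((u - a)\<^sup>2 * t0 - u\<^sup>2 * t1))"
    using J_eq by (simp add: algebra_simps)
  also have "\<dots> \<le> 5 * (2 * (D * u * t1) + H)"
  proof -
    have "a * (2 * u - a) \<le> D * (2 * u)" using pos D by (intro mult_mono) auto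
    then have "a * (2 * u - a) * t1 \<le> D * (2 * u) * t1" using t1 by (intro mult_right_mono) auto
    then show ?thesis using r by (simp add: algebra_simps)
  qed
  finally show ?thesis by (simp add: algebra_simps)
qed

lemma k_eq: "k * ((2 * u - a) * (u + b)\<^sup>2) = b * (a + b) * J * R + E"
  unfolding k_def J_def R_def E_def by (rule close_squares_triple_identity)

lemma Q_lower: "19 * (u * u\<^sup>2) \<le> 10 * ((2 * u - a) * (u + b)\<^sup>2)"
proof -
  have "(19 * u) * u\<^sup>2 \<le> (10 * (2 * u - a)) * (u + b)\<^sup>2"
  proof (rule mult_mono)
    show "19 * u \<le> 10 * (2 * u - a)" using pos by simp
    show "0 \<le> 10 * (2 * u - a)" using pos by simp
    show "u\<^sup>2 \<le> (u + b)\<^sup>2" using pos by (intro power_mono) auto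
  qed simp
  then show ?thesis by (simp only: ac_simps)
qed

lemma k_pos: "k \<ge> 1"
proof -
  have "j * (j + j) * 1 * (2 * u\<^sup>2) \<le> b * (a + b) * J * R"
    using j pos J_pos R_bounds by (intro mult_mono) auto
  then have 1: "4 * (j\<^sup>2 * u\<^sup>2) \<le> b * (a + b) * J * R" by (simp add: power2_eq_square)
  have "u * (5 * D * H) \<le> u * (j\<^sup>2 * u)" using H pos by (intro mult_left_mono) auto
  then have 2: "5 * (u * D * H) \<le> j\<^sup>2 * u\<^sup>2" by (simp add: power2_eq_square ac_simps)
  have "j\<^sup>2 * u\<^sup>2 > 0" using j pos by simp
  then have "k * ((2 * u - a) * (u + b)\<^sup>2) > 0" unfolding k_eq using 1 2 E_bound by linarith
  moreover have "(2 * u - a) * (u + b)\<^sup>2 > 0" using pos by simp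
  ultimately show ?thesis using zero_less_mult_pos2 by fastforce
qed

text \<open>To leading order \<open>J\<close> is \<open>2 * a * t1 / u\<close> and \<open>k\<close>
  is \<open>3 * b * (a + b) * J / (2 * u)\<close>, which gives the order
  \<open>D^3 * t1 / u^2\<close>. The remainder is absorbed into \<open>k\<close> itself, using
  \<open>k \<ge> 1\<close> and \<open>10 * D * H \<le> u\<^sup>2\<close>.\<close>

lemma k_upper: "k * u\<^sup>2 \<le> 18 * (D ^ 3 * t1)"
proof -
  have "19 * (u * u\<^sup>2) * k \<le> 10 * ((2 * u - a) * (u + b)\<^sup>2) * k"
    using Q_lower k_pos by (intro mult_right_mono) auto
  also have "\<dots> = 10 * (b * (a + b) * J * R + E)" using k_eq by (simp add: algebra_simps)
  finally have 1: "19 * (u * u\<^sup>2) * k \<le> 10 * (b * (a + b) * J * R) + 50 * (u * D * H)"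
    using E_bound unfolding distrib_left[of 10] by linarith
  have "b * (a + b) * J * (5 * R) \<le> D * (D + D) * J * (16 * u\<^sup>2)"
  proof (rule mult_mono)
    show "b * (a + b) * J \<le> D * (D + D) * J" using pos D J_pos by (intro mult_mono) auto
    show "0 \<le> D * (D + D) * J" using pos J_pos by simp
    show "0 \<le> 5 * R" using R_bounds(1) zero_le_power2[of u] by linarith
  qed (rule R_bounds)
  then have "10 * (b * (a + b) * J * R) \<le> 16 * D\<^sup>2 * (4 * (u\<^sup>2 * J))"
    by (simp add: power2_eq_square algebra_simps)
  also have "\<dots> \<le> 16 * D\<^sup>2 * (5 * (2 * (D * u * t1) + H))"
    using J_upper by (intro mult_left_mono) auto
  also have "\<dots> = 160 * (u * (D ^ 3 * t1)) + 80 * D\<^sup>2 * H"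
    by (simp add: power2_eq_square power3_eq_cube algebra_simps)
  also have "80 * D\<^sup>2 * H \<le> 4 * (u * D * H)"
  proof -
    have "4 * (20 * D) * (D * H) \<le> 4 * u * (D * H)" using pos D H by (intro mult_mono) auto
    then show ?thesis by (simp add: power2_eq_square ac_simps)
  qed
  finally have 2: "19 * (u * u\<^sup>2) * k \<le> 160 * (u * (D ^ 3 * t1)) + 54 * (u * D * H)"
    using 1 by linarith
  have "u * (10 * D * H) \<le> u * u\<^sup>2" using H pos by (intro mult_left_mono) auto
  also have "\<dots> \<le> u * u\<^sup>2 * k" using k_pos pos mult_left_mono[of 1 k "u * u\<^sup>2"] by simp
  finally have "10 * (u * D * H) \<le> u * u\<^sup>2 * k" by (simp add: ac_simps)
  moreover have "u * u\<^sup>2 * k = u * (u\<^sup>2 * k)" "19 * (u * u\<^sup>2) * k = 19 * (u * (u\<^sup>2 * k))"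
    by simp_all
  moreover have "0 \<le> u * (u\<^sup>2 * k)" using pos k_pos by simp
  ultimately have "10 * (u * (u\<^sup>2 * k)) \<le> 160 * (u * (D ^ 3 * t1))" using 2 by linarith
  then have "u * (u\<^sup>2 * k) \<le> u * (16 * (D ^ 3 * t1))" by linarith
  then have "u\<^sup>2 * k \<le> 16 * (D ^ 3 * t1)" using pos by simp
  moreover have "D ^ 3 * t1 \<ge> 0" using pos t1 by simp
  ultimately show ?thesis by (simp add: ac_simps)
qed

text \<open>The right side of the second identity has order \<open>u * D * H + k * D^2 * u\<close>,
  and \<open>R\<close> is at least \<open>2 * u^2\<close>. Keeping the factor \<open>u\<close> on
  the left avoids a division in the integers.\<close>

lemma near_multiple:
  "u * \<bar>k * (6 * u + 8 * b + a) - 9 * b * (a + b) * J\<bar> \<le> 23 * (D * H) + 4 * (k * D\<^sup>2)"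
proof -
  define s where "s = k * (6 * u + 8 * b + a) - 9 * b * (a + b) * J"
  have id: "R * s = 9 * E - k * (2 * (a\<^sup>2 + a * b + b\<^sup>2) * u + a * b * (a - b))"
    unfolding s_def k_def J_def R_def E_def by (rule close_squares_triple_identity)
  have "a\<^sup>2 \<le> D\<^sup>2" "b\<^sup>2 \<le> D\<^sup>2" "a * b \<le> D * D"
    using pos D by (auto intro!: power_mono mult_mono)
  then have "2 * (a\<^sup>2 + a * b + b\<^sup>2) * u \<le> 6 * D\<^sup>2 * u"
    using pos by (intro mult_right_mono) (auto simp: power2_eq_square)
  moreover have "\<bar>a * b * (a - b)\<bar> \<le> D * D * u"
    unfolding abs_mult using pos D by (intro mult_mono) auto
  moreover have "0 \<le> 2 * (a\<^sup>2 + a * b + b\<^sup>2) * u" using pos by simp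
  ultimately have "\<bar>2 * (a\<^sup>2 + a * b + b\<^sup>2) * u + a * b * (a - b)\<bar> \<le> 7 * D\<^sup>2 * u"
    by (simp add: power2_eq_square)
  then have "\<bar>k * (2 * (a\<^sup>2 + a * b + b\<^sup>2) * u + a * b * (a - b))\<bar> \<le> k * (7 * D\<^sup>2 * u)"
    unfolding abs_mult using k_pos by (auto intro!: mult_left_mono)
  then have 1: "\<bar>R * s\<bar> \<le> 45 * (u * D * H) + k * (7 * D\<^sup>2 * u)" unfolding id using E_bound by linarith
  have "2 * u\<^sup>2 * \<bar>s\<bar> \<le> \<bar>R\<bar> * \<bar>s\<bar>" using R_bounds by (intro mult_right_mono) auto
  then have "u * (2 * (u * \<bar>s\<bar>)) \<le> u * (45 * (D * H) + 7 * (k * D\<^sup>2))"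
    using 1 by (simp add: abs_mult power2_eq_square algebra_simps)
  then have "2 * (u * \<bar>s\<bar>) \<le> 45 * (D * H) + 7 * (k * D\<^sup>2)" using pos by simp
  moreover have "D * H \<ge> 0" "k * D\<^sup>2 \<ge> 0" using pos H k_pos by auto
  ultimately show ?thesis unfolding s_def by linarith
qed

end


text \<open>The outer cofactors range over all integers, so that a difference of two solutions,
  whose outer cofactors may be negative, is again a solution with tolerance
  \<open>2 * H\<close>.\<close>

definition triple_sols :: "int \<Rightarrow> int \<Rightarrow> int \<Rightarrow> int \<Rightarrow> nat set" where
  "triple_sols H u a b = {t. \<exists>t0 t2. \<bar>(u - a)\<^sup>2 * t0 - u\<^sup>2 * int t\<bar> \<le> H
      \<and> \<bar>u\<^sup>2 * int t - (u + b)\<^sup>2 * t2\<bar> \<le> H}"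

lemma triple_solsI:
  assumes "\<bar>(u - a)\<^sup>2 * t0 - u\<^sup>2 * int t\<bar> \<le> H" "\<bar>u\<^sup>2 * int t - (u + b)\<^sup>2 * t2\<bar> \<le> H"
  shows "t \<in> triple_sols H u a b"
  unfolding triple_sols_def using assms by blast

definition near_multiples :: "nat \<Rightarrow> nat \<Rightarrow> int \<Rightarrow> int \<Rightarrow> int \<Rightarrow> nat set" where
  "near_multiples K T u a b =
    {k\<in>{1..K}. \<exists>J. \<bar>int k * (6 * u + 8 * b + a) - 9 * b * (a + b) * J\<bar> \<le> int T}"

text \<open>The map from \<open>t\<close> to \<open>k\<close> is injective on the window: equal
  values of \<open>k\<close> force equal values of \<open>J\<close>, and \<open>J\<close> determines
  \<open>t\<close>. The condition \<open>int K * D \<le> H\<close> keeps the error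
  \<open>k * D^2\<close> below \<open>D * H\<close>. Since \<open>k\<close> grows linearly with
  \<open>t\<close>, this is what limits the length of the window.\<close>

lemma card_triple_sols_window:
  fixes u a b j D H P :: int and L K T :: nat
  assumes j: "1 \<le> j" "j \<le> a" "j \<le> b" and D: "a \<le> D" "b \<le> D" "20 * D \<le> P" "P < u"
    and H: "0 \<le> H" "10 * D * H \<le> j\<^sup>2 * P" "20 * D * H \<le> P\<^sup>2"
    and K: "\<And>k. k * P\<^sup>2 \<le> 18 * D ^ 3 * int L \<Longrightarrow> k \<le> int K" "int K * D \<le> H"
    and T: "50 * D * H \<le> int T * P"
  shows "card {t \<in> triple_sols (2 * H) u a b. 1 \<le> t \<and> t < L} \<le> card (near_multiples K T u a b)"
proof -
  have D0: "D > 0" using j D by simp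
  have P0: "P > 0" "u > 0" using D D0 by auto
  define Z where "Z = {t \<in> triple_sols (2 * H) u a b. 1 \<le> t \<and> t < L}"
  have "\<forall>t\<in>Z. \<exists>p. \<bar>(u - a)\<^sup>2 * fst p - u\<^sup>2 * int t\<bar> \<le> 2 * H
      \<and> \<bar>u\<^sup>2 * int t - (u + b)\<^sup>2 * snd p\<bar> \<le> 2 * H"
    unfolding Z_def triple_sols_def by auto
  then obtain p where p: "\<And>t. t \<in> Z \<Longrightarrow> \<bar>(u - a)\<^sup>2 * fst (p t) - u\<^sup>2 * int t\<bar> \<le> 2 * H"
      "\<And>t. t \<in> Z \<Longrightarrow> \<bar>u\<^sup>2 * int t - (u + b)\<^sup>2 * snd (p t)\<bar> \<le> 2 * H"
    using bchoice[of Z] by metis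
  have Pu: "P\<^sup>2 \<le> u\<^sup>2" using P0 D by (intro power_mono) auto
  have jPu: "j\<^sup>2 * P \<le> j\<^sup>2 * u" using D by (intro mult_left_mono) auto
  have loc: "close_squares_triple u a b (fst (p t)) (int t) (snd (p t)) j D (2 * H)" if "t \<in> Z" for t
  proof
    show "1 \<le> int t" using that by (simp add: Z_def)
    show "5 * D * (2 * H) \<le> j\<^sup>2 * u" using H jPu by linarith
    show "10 * D * (2 * H) \<le> u\<^sup>2" using H Pu by linarith
  qed (use j D H p[OF that] in auto)
  define k where "k t = close_squares_triple.k a b (fst (p t)) (int t) (snd (p t))" for t
  define J where "J t = close_squares_triple.J (fst (p t)) (int t)" for t
  define s where "s t = k t * (6 * u + 8 * b + a) - 9 * b * (a + b) * J t" for t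
  have k1: "k t \<ge> 1" if "t \<in> Z" for t
    unfolding k_def using close_squares_triple.k_pos[OF loc[OF that]] .
  have kK: "k t \<le> int K" if "t \<in> Z" for t
  proof (rule K(1))
    have "k t * P\<^sup>2 \<le> k t * u\<^sup>2" using Pu k1[OF that] by (intro mult_left_mono) auto
    also have "\<dots> \<le> 18 * (D ^ 3 * int t)"
      unfolding k_def using close_squares_triple.k_upper[OF loc[OF that]] .
    also have "\<dots> \<le> 18 * (D ^ 3 * int L)" using that D0 by (simp add: Z_def)
    finally show "k t * P\<^sup>2 \<le> 18 * D ^ 3 * int L" by simp
  qed
  have sb: "u * \<bar>s t\<bar> \<le> 50 * (D * H)" if "t \<in> Z" for t
  proof -
    have "u * \<bar>s t\<bar> \<le> 23 * (D * (2 * H)) + 4 * (k t * D\<^sup>2)"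
      unfolding s_def k_def J_def using close_squares_triple.near_multiple[OF loc[OF that]] .
    moreover have "k t * D\<^sup>2 \<le> D * H"
    proof -
      have "k t * D \<le> int K * D" using kK[OF that] D0 by (intro mult_right_mono) auto
      then have "k t * D \<le> H" using K(2) by linarith
      then have "D * (k t * D) \<le> D * H" using D0 by simp
      then show ?thesis by (simp add: power2_eq_square ac_simps)
    qed
    ultimately show ?thesis by linarith
  qed
  have sT: "\<bar>s t\<bar> \<le> int T" if "t \<in> Z" for t
  proof -
    have "u * \<bar>s t\<bar> \<le> int T * P" using sb[OF that] T by simp
    also have "\<dots> \<le> u * int T"
      using D mult_right_mono[of P u "int T"] by (simp add: mult.commute)
    finally show ?thesis using P0 by simp
  qed
  have "card Z \<le> card (near_multiples K T u a b)"
  proof (rule card_inj_on_le)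
    show "finite (near_multiples K T u a b)" unfolding near_multiples_def by simp
    show "(\<lambda>t. nat (k t)) ` Z \<subseteq> near_multiples K T u a b"
    proof (rule image_subsetI)
      fix t assume t: "t \<in> Z"
      then show "nat (k t) \<in> near_multiples K T u a b"
        using k1[OF t] kK[OF t] sT[OF t] unfolding near_multiples_def s_def
        by (auto intro!: exI[of _ "J t"])
    qed
    show "inj_on (\<lambda>t. nat (k t)) Z"
    proof (rule inj_onI)
      fix t t' assume t: "t \<in> Z" "t' \<in> Z" and "nat (k t) = nat (k t')"
      then have keq: "k t = k t'" using k1[OF t(1)] k1[OF t(2)] by simp
      \<comment> \<open>The modulus \<open>9 * b * (a + b)\<close> is at least
        \<open>18 * j^2\<close>, but two offsets \<open>s t\<close> and \<open>s t'\<close> differ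
        by at most \<open>100 * D * H / u\<close>, hence by at most \<open>10 * j^2\<close>. So the
        multiples they are close to must coincide.\<close>
      have q: "18 * j\<^sup>2 \<le> 9 * b * (a + b)"
      proof -
        have "j * (j + j) \<le> b * (a + b)" using j by (intro mult_mono) auto
        then show ?thesis by (simp add: power2_eq_square)
      qed
      have diff: "s t' - s t = 9 * b * (a + b) * (J t - J t')"
        unfolding s_def keq by (simp add: algebra_simps)
      have "J t = J t'"
      proof (rule ccontr)
        assume "J t \<noteq> J t'"
        then have "\<bar>J t - J t'\<bar> \<ge> 1" by simp
        then have "9 * b * (a + b) * 1 \<le> 9 * b * (a + b) * \<bar>J t - J t'\<bar>"
          using j by (intro mult_left_mono) auto
        also have "\<dots> = \<bar>s t' - s t\<bar>" unfolding diff using j by (simp add: abs_mult)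
        finally have "18 * j\<^sup>2 \<le> \<bar>s t' - s t\<bar>" using q by linarith
        then have "u * (18 * j\<^sup>2) \<le> u * \<bar>s t' - s t\<bar>" using P0 by (intro mult_left_mono) auto
        also have "\<dots> \<le> u * (\<bar>s t\<bar> + \<bar>s t'\<bar>)" using P0 by (intro mult_left_mono) auto
        also have "\<dots> \<le> 100 * (D * H)" using sb[OF t(1)] sb[OF t(2)] by (simp add: distrib_left)
        finally have "18 * (j\<^sup>2 * u) \<le> 10 * (j\<^sup>2 * u)" using H(2) jPu by (simp add: ac_simps)
        moreover have "j\<^sup>2 * u > 0" using j P0 by simp
        ultimately show False by linarith
      qed
      define r where "r t = (u - a)\<^sup>2 * fst (p t) - u\<^sup>2 * int t" for t
      have "(u - a)\<^sup>2 * J t = a * (2 * u - a) * int t + r t"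
        "(u - a)\<^sup>2 * J t' = a * (2 * u - a) * int t' + r t'"
        unfolding J_def r_def using close_squares_triple.J_eq[OF loc[OF t(1)]]
          close_squares_triple.J_eq[OF loc[OF t(2)]] by auto
      then have "a * (2 * u - a) * (int t - int t') = r t' - r t"
        using \<open>J t = J t'\<close> by (simp add: algebra_simps)
      moreover have "\<bar>r t' - r t\<bar> \<le> 4 * H" using p(1)[OF t(1)] p(1)[OF t(2)] unfolding r_def by linarith
      ultimately have le: "a * (2 * u - a) * \<bar>int t - int t'\<bar> \<le> 4 * H"
        using close_squares_triple.a_lower(3)[OF loc[OF t(1)]] by (metis abs_mult abs_of_pos)
      have "\<not> \<bar>int t - int t'\<bar> \<ge> 1"
      proof
        assume "\<bar>int t - int t'\<bar> \<ge> 1"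
        then have "a * (2 * u - a) * 1 \<le> a * (2 * u - a) * \<bar>int t - int t'\<bar>"
          using close_squares_triple.a_lower(3)[OF loc[OF t(1)]] by (intro mult_left_mono) auto
        then show False using le close_squares_triple.a_lower(2,3)[OF loc[OF t(1)]] H(1) by linarith
      qed
      then show "t = t'" by simp
    qed
  qed
  then show ?thesis unfolding Z_def .
qed

lemma card_triple_sols:
  fixes u a b j D H P :: int and L K T M :: nat
  assumes j: "1 \<le> j" "j \<le> a" "j \<le> b" and D: "a \<le> D" "b \<le> D" "20 * D \<le> P" "P < u"
    and H: "0 \<le> H" "10 * D * H \<le> j\<^sup>2 * P" "20 * D * H \<le> P\<^sup>2"
    and K: "\<And>k. k * P\<^sup>2 \<le> 18 * D ^ 3 * int L \<Longrightarrow> k \<le> int K" "int K * D \<le> H"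
    and T: "50 * D * H \<le> int T * P" and L: "L > 0"
  shows "card {t \<in> triple_sols H u a b. 1 \<le> t \<and> t \<le> M} \<le>
    card (near_multiples K T u a b) + (M div L) * (1 + card (near_multiples K T u a b))"
proof -
  define Z where "Z = {t \<in> triple_sols (2 * H) u a b. 1 \<le> t \<and> t < L}"
  define A where "A = {t \<in> triple_sols H u a b. 1 \<le> t \<and> t \<le> M}"
  have fin: "finite Z" unfolding Z_def by (rule finite_subset[of _ "{..<L}"]) auto
  have "card A \<le> card Z + (M div L) * (1 + card Z)"
  proof (rule card_le_windows[OF L fin])
    show "A \<subseteq> {1..M}" unfolding A_def by auto
    show "x \<in> Z" if x: "x \<in> A" "x < L" for x
    proof -
      obtain x0 x2 where "\<bar>(u - a)\<^sup>2 * x0 - u\<^sup>2 * int x\<bar> \<le> H" "\<bar>u\<^sup>2 * int x - (u + b)\<^sup>2 * x2\<bar> \<le> H"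
        using x(1) unfolding A_def triple_sols_def by auto
      then have "\<bar>(u - a)\<^sup>2 * x0 - u\<^sup>2 * int x\<bar> \<le> 2 * H" "\<bar>u\<^sup>2 * int x - (u + b)\<^sup>2 * x2\<bar> \<le> 2 * H"
        using H(1) by linarith+
      then have "x \<in> triple_sols (2 * H) u a b" by (rule triple_solsI)
      then show ?thesis using x unfolding A_def Z_def by simp
    qed
    show "y - x \<in> Z" if xy: "x \<in> A" "y \<in> A" "x < y" "y - x < L" for x y
    proof -
      obtain x0 x2 where x: "\<bar>(u - a)\<^sup>2 * x0 - u\<^sup>2 * int x\<bar> \<le> H" "\<bar>u\<^sup>2 * int x - (u + b)\<^sup>2 * x2\<bar> \<le> H"
        using xy(1) unfolding A_def triple_sols_def by auto
      obtain y0 y2 where y: "\<bar>(u - a)\<^sup>2 * y0 - u\<^sup>2 * int y\<bar> \<le> H" "\<bar>u\<^sup>2 * int y - (u + b)\<^sup>2 * y2\<bar> \<le> H"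
        using xy(2) unfolding A_def triple_sols_def by auto
      have "\<bar>(u - a)\<^sup>2 * (y0 - x0) - u\<^sup>2 * int (y - x)\<bar> \<le> 2 * H"
        using x(1) y(1) xy(3) by (simp add: of_nat_diff right_diff_distrib)
      moreover have "\<bar>u\<^sup>2 * int (y - x) - (u + b)\<^sup>2 * (y2 - x2)\<bar> \<le> 2 * H"
        using x(2) y(2) xy(3) by (simp add: of_nat_diff right_diff_distrib)
      ultimately have "y - x \<in> triple_sols (2 * H) u a b" by (rule triple_solsI)
      then show ?thesis using xy unfolding Z_def by simp
    qed
  qed
  also have "card Z \<le> card (near_multiples K T u a b)"
    unfolding Z_def by (rule card_triple_sols_window[OF j D H K T])
  finally show ?thesis unfolding A_def by (simp add: add_mono mult_le_mono2)
qed

section \<open>Averaging the near multiples over base points and differences\<close>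

lemma sum_card_swap:
  assumes "finite A" "finite B"
  shows "(\<Sum>x\<in>A. card {y\<in>B. Q x y}) = (\<Sum>y\<in>B. card {x\<in>A. Q x y})"
proof -
  have 1: "card {y\<in>B. Q x y} = (\<Sum>y\<in>B. if Q x y then 1 else 0)" for x
    using assms by (simp add: sum.If_cases Int_def)
  have 2: "card {x\<in>A. Q x y} = (\<Sum>x\<in>A. if Q x y then 1 else 0)" for y
    using assms by (simp add: sum.If_cases Int_def)
  show ?thesis unfolding 1 2 by (rule sum.swap)
qed

text \<open>With \<open>k\<close> and the offset \<open>s\<close> fixed, \<open>u\<close> solves a
  linear congruence with coefficient \<open>6 * k\<close> modulo \<open>q\<close>. Exchanging the
  sums over \<open>u\<close> and \<open>k\<close> turns the bound into a sum of gcds over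
  \<open>k\<close>, which costs only a divisor function of \<open>q\<close>.\<close>

lemma sum_card_near_multiples_fixed:
  fixes P K T a b :: nat
  assumes ab: "a > 0" "b > 0"
  defines "q \<equiv> 9 * b * (a + b)"
  shows "(\<Sum>u\<in>{P<..2*P}. real (card (near_multiples K T (int u) (int a) (int b))))
    \<le> real K * (6 * (2 * real T + 1) * real (card {d. d dvd q}) * (real P / real q + 1))"
proof -
  have q0: "q > 0" using ab by (simp add: q_def)
  let ?Q = "\<lambda>u k. \<exists>J. \<bar>int k * (6 * int u + 8 * int b + int a) - int q * J\<bar> \<le> int T"
  have inner: "real (card {u\<in>{P<..2*P}. ?Q u k}) \<le>
      (2 * real T + 1) * (real (gcd (6 * k) q) * (real P / real q + 1))" for k
  proof -
    let ?A = "\<lambda>s. {u\<in>{P<..2*P}. int q dvd int k * (6 * int u + 8 * int b + int a) - s}"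
    have "{u\<in>{P<..2*P}. ?Q u k} \<subseteq> (\<Union>s\<in>{-int T..int T}. ?A s)"
    proof
      fix u assume "u \<in> {u\<in>{P<..2*P}. ?Q u k}"
      then obtain J where u: "u \<in> {P<..2*P}"
        and J: "\<bar>int k * (6 * int u + 8 * int b + int a) - int q * J\<bar> \<le> int T" by auto
      define s where "s = int k * (6 * int u + 8 * int b + int a) - int q * J"
      have "int q dvd int k * (6 * int u + 8 * int b + int a) - s" unfolding s_def by simp
      then have "u \<in> ?A s" using u by simp
      moreover have "s \<in> {-int T..int T}" using J unfolding s_def by auto
      ultimately show "u \<in> (\<Union>s\<in>{-int T..int T}. ?A s)" by (rule UN_I[rotated])
    qed
    then have "card {u\<in>{P<..2*P}. ?Q u k} \<le> card (\<Union>s\<in>{-int T..int T}. ?A s)"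
      by (intro card_mono) auto
    also have "\<dots> \<le> (\<Sum>s\<in>{-int T..int T}. card (?A s))" by (rule card_UN_le) simp
    finally have 1: "real (card {u\<in>{P<..2*P}. ?Q u k}) \<le> (\<Sum>s\<in>{-int T..int T}. real (card (?A s)))"
      unfolding of_nat_sum[symmetric] by (rule of_nat_mono)
    have 2: "real (card (?A s)) \<le> real (gcd (6 * k) q) * (real P / real q + 1)" for s
    proof -
      have "card (?A s) = card (int ` ?A s)" by (simp add: card_image)
      also have "real (card (int ` ?A s)) \<le> real P * real_of_int (gcd (6 * int k) (int q)) / real_of_int (int q) + 1"
      proof (rule card_scaled_congruent_le)
        show "int q > 0" using q0 by simp
        show "int ` ?A s \<subseteq> {int P<..int P + int P}" by auto
        fix u v assume "u \<in> int ` ?A s" "v \<in> int ` ?A s"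
        then have "int q dvd int k * (6 * u + 8 * int b + int a) - s"
          "int q dvd int k * (6 * v + 8 * int b + int a) - s" by auto
        then have "int q dvd (int k * (6 * u + 8 * int b + int a) - s) - (int k * (6 * v + 8 * int b + int a) - s)"
          by (rule dvd_diff)
        then show "int q dvd 6 * int k * (u - v)" by (simp add: algebra_simps)
      qed
      also have "gcd (6 * int k) (int q) = int (gcd (6 * k) q)"
        by (metis gcd_int_int_eq of_nat_mult of_nat_numeral)
      also have "real P * real_of_int (int (gcd (6 * k) q)) / real_of_int (int q) + 1
          \<le> real (gcd (6 * k) q) * (real P / real q + 1)"
      proof -
        \<comment> \<open>As the gcd is at least 1, it can be pulled out of both terms; the sum over
          \<open>k\<close> then involves nothing but gcds.\<close>
        have "gcd (6 * k) q \<ge> 1" using q0 by (simp add: Suc_le_eq)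
        then have "1 \<le> real (gcd (6 * k) q)" by linarith
        then show ?thesis by (simp add: algebra_simps)
      qed
      finally show ?thesis .
    qed
    have "(\<Sum>s\<in>{-int T..int T}. real (card (?A s))) \<le>
        (\<Sum>s\<in>{-int T..int T}. real (gcd (6 * k) q) * (real P / real q + 1))"
      by (intro sum_mono 2)
    also have "\<dots> = (2 * real T + 1) * (real (gcd (6 * k) q) * (real P / real q + 1))"
      by (simp add: algebra_simps)
    finally show ?thesis using 1 by linarith
  qed
  have gcds: "(\<Sum>k\<in>{1..K}. real (gcd (6 * k) q)) \<le> 6 * (real K * real (card {d. d dvd q}))"
  proof -
    have "(\<Sum>k\<in>{1..K}. gcd (6 * k) q) \<le> (\<Sum>k\<in>{1..K}. 6 * gcd k q)"
    proof (intro sum_mono)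
      fix k
      have "gcd (6 * k) q dvd gcd (6 * k) (6 * q)" by (intro gcd_mono) auto
      also have "gcd (6 * k) (6 * q) = 6 * gcd k q" by (simp add: gcd_mult_distrib_nat)
      finally show "gcd (6 * k) q \<le> 6 * gcd k q" using q0 by (intro dvd_imp_le) auto
    qed
    also have "\<dots> \<le> 6 * (K * card {d. d dvd q})"
      unfolding sum_distrib_left[symmetric] using sum_gcd_le[OF q0, of K] by simp
    finally have "real (\<Sum>k\<in>{1..K}. gcd (6 * k) q) \<le> real (6 * (K * card {d. d dvd q}))"
      by (rule of_nat_mono)
    then show ?thesis by simp
  qed
  have "(\<Sum>u\<in>{P<..2*P}. card (near_multiples K T (int u) (int a) (int b)))
      = (\<Sum>u\<in>{P<..2*P}. card {k\<in>{1..K}. ?Q u k})"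
    unfolding near_multiples_def q_def by simp
  also have "\<dots> = (\<Sum>k\<in>{1..K}. card {u\<in>{P<..2*P}. ?Q u k})"
    by (rule sum_card_swap) auto
  finally have "(\<Sum>u\<in>{P<..2*P}. real (card (near_multiples K T (int u) (int a) (int b))))
      = (\<Sum>k\<in>{1..K}. real (card {u\<in>{P<..2*P}. ?Q u k}))"
    unfolding of_nat_sum[symmetric] by (rule arg_cong)
  also have "\<dots> \<le> (\<Sum>k\<in>{1..K}. (2 * real T + 1) * (real (gcd (6 * k) q) * (real P / real q + 1)))"
    by (intro sum_mono inner)
  also have "\<dots> = (2 * real T + 1) * (real P / real q + 1) * (\<Sum>k\<in>{1..K}. real (gcd (6 * k) q))"
    by (simp add: sum_distrib_left sum_distrib_right ac_simps)
  also have "\<dots> \<le> (2 * real T + 1) * (real P / real q + 1) * (6 * (real K * real (card {d. d dvd q})))"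
    by (intro mult_left_mono gcds) auto
  finally show ?thesis by (simp only: ac_simps)
qed

lemma sum_card_near_multiples:
  fixes P D K T :: nat and \<tau> \<eta> :: real
  assumes D: "D > 0" and \<tau>: "\<And>q. 0 < q \<Longrightarrow> q \<le> 18 * D\<^sup>2 \<Longrightarrow> real (card {d. d dvd q}) \<le> \<tau>"
    and \<eta>: "(\<Sum>i=1..D. 1 / real i) \<le> \<eta>"
  shows "(\<Sum>u\<in>{P<..2*P}. \<Sum>a\<in>{1..D}. \<Sum>b\<in>{1..D}. real (card (near_multiples K T (int u) (int a) (int b))))
    \<le> real K * (6 * (2 * real T + 1) * \<tau> * (real P * \<eta>\<^sup>2 + real D ^ 2))"
proof -
  let ?N = "\<lambda>u a b. real (card (near_multiples K T (int u) (int a) (int b)))"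
  have \<tau>0: "\<tau> \<ge> 0" using D by (intro order_trans[OF of_nat_0_le_iff \<tau>[of 1]]) auto
  have \<eta>0: "0 \<le> (\<Sum>i=1..D. 1 / real i)" by (intro sum_nonneg) auto
  have "(\<Sum>u\<in>{P<..2*P}. \<Sum>a\<in>{1..D}. \<Sum>b\<in>{1..D}. ?N u a b)
      = (\<Sum>a\<in>{1..D}. \<Sum>u\<in>{P<..2*P}. \<Sum>b\<in>{1..D}. ?N u a b)"
    by (rule sum.swap)
  also have "\<dots> = (\<Sum>a\<in>{1..D}. \<Sum>b\<in>{1..D}. \<Sum>u\<in>{P<..2*P}. ?N u a b)"
    by (intro sum.cong[OF refl] sum.swap)
  also have "\<dots> \<le> (\<Sum>a\<in>{1..D}. \<Sum>b\<in>{1..D}. real K * (6 * (2 * real T + 1) * \<tau>) *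
      (real P * (1 / real a * (1 / real b)) + 1))"
  proof (intro sum_mono)
    fix a b assume ab: "a \<in> {1..D}" "b \<in> {1..D}"
    define q where "q = 9 * b * (a + b)"
    have "b * (a + b) \<le> D * (2 * D)" using ab by (intro mult_mono) auto
    then have q: "0 < q" "q \<le> 18 * D\<^sup>2" using ab by (auto simp: q_def power2_eq_square)
    \<comment> \<open>Replacing \<open>q\<close> by \<open>a * b\<close> separates the variables:
      the double sum becomes the square of a harmonic sum, whence
      \<open>\<eta>\<^sup>2\<close>.\<close>
    have "a * b \<le> q" unfolding q_def by (simp add: algebra_simps)
    then have "real a * real b \<le> real q" by (metis of_nat_mono of_nat_mult)
    then have "1 / real q \<le> 1 / (real a * real b)" using ab by (intro frac_le) auto
    then have Pq: "real P / real q \<le> real P * (1 / real a * (1 / real b))"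
      using mult_left_mono[of "1 / real q" "1 / (real a * real b)" "real P"] by simp
    have "(\<Sum>u\<in>{P<..2*P}. ?N u a b)
        \<le> real K * (6 * (2 * real T + 1) * real (card {d. d dvd q}) * (real P / real q + 1))"
      unfolding q_def using ab by (intro sum_card_near_multiples_fixed) auto
    also have "\<dots> \<le> real K * (6 * (2 * real T + 1) * \<tau> * (real P * (1 / real a * (1 / real b)) + 1))"
    proof -
      have "6 * (2 * real T + 1) * real (card {d. d dvd q}) \<le> 6 * (2 * real T + 1) * \<tau>"
        using \<tau>[OF q] by (intro mult_left_mono) auto
      then have "6 * (2 * real T + 1) * real (card {d. d dvd q}) * (real P / real q + 1)
          \<le> 6 * (2 * real T + 1) * \<tau> * (real P * (1 / real a * (1 / real b)) + 1)"
        by (rule mult_mono) (use Pq \<tau>0 in auto)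
      then show ?thesis by (rule mult_left_mono) simp
    qed
    finally show "(\<Sum>u\<in>{P<..2*P}. ?N u a b) \<le>
       real K * (6 * (2 * real T + 1) * \<tau>) * (real P * (1 / real a * (1 / real b)) + 1)"
      by (simp only: mult.assoc)
  qed
  also have "\<dots> = real K * (6 * (2 * real T + 1) * \<tau>) *
      (\<Sum>a\<in>{1..D}. \<Sum>b\<in>{1..D}. real P * (1 / real a * (1 / real b)) + 1)"
    by (simp only: sum_distrib_left)
  also have "(\<Sum>a\<in>{1..D}. \<Sum>b\<in>{1..D}. real P * (1 / real a * (1 / real b)) + 1)
      = real P * (\<Sum>i=1..D. 1 / real i)\<^sup>2 + real D ^ 2"
  proof -
    have "(\<Sum>a\<in>{1..D}. \<Sum>b\<in>{1..D}. 1 / real a * (1 / real b)) = (\<Sum>i=1..D. 1 / real i)\<^sup>2"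
      unfolding power2_eq_square by (rule sum_product[symmetric])
    then show ?thesis
      by (simp only: sum.distrib sum_distrib_left[symmetric]) (simp add: power2_eq_square)
  qed
  also have "real K * (6 * (2 * real T + 1) * \<tau>) * (real P * (\<Sum>i=1..D. 1 / real i)\<^sup>2 + real D ^ 2)
      \<le> real K * (6 * (2 * real T + 1) * \<tau>) * (real P * \<eta>\<^sup>2 + real D ^ 2)"
  proof (rule mult_left_mono)
    have "(\<Sum>i=1..D. 1 / real i)\<^sup>2 \<le> \<eta>\<^sup>2" using \<eta> \<eta>0 by (intro power_mono)
    then show "real P * (\<Sum>i=1..D. 1 / real i)\<^sup>2 + real D ^ 2 \<le> real P * \<eta>\<^sup>2 + real D ^ 2"
      by (simp add: mult_left_mono)
  qed (use \<tau>0 in simp)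
  finally show ?thesis by (simp only: mult.assoc)
qed


definition triple_sols_upto :: "nat \<Rightarrow> nat \<Rightarrow> nat \<Rightarrow> nat \<Rightarrow> nat \<Rightarrow> nat set" where
  "triple_sols_upto M H u a b = {t \<in> triple_sols (int H) (int u) (int a) (int b). 1 \<le> t \<and> t \<le> M}"

text \<open>The first summand of the bound is the average number of near multiples, taken once per
  window. The second is the cost of the one additional solution that each later window may hold, for
  \<open>P\<close> values of \<open>u\<close> and \<open>D^2\<close> pairs of differences.\<close>

lemma sum_card_triple_sols:
  fixes P D H j T M :: nat and \<tau> \<eta> :: real
  assumes j: "1 \<le> j" and D: "1 \<le> D" "20 * D \<le> P" and M: "1 \<le> M"
    and H: "1 \<le> H" "10 * D * H \<le> j\<^sup>2 * P" "20 * D * H \<le> P\<^sup>2" "18 * D ^ 4 \<le> H * P\<^sup>2"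
    and T: "50 * D * H \<le> T * P"
    and \<tau>: "\<And>q. 0 < q \<Longrightarrow> q \<le> 18 * D\<^sup>2 \<Longrightarrow> real (card {d. d dvd q}) \<le> \<tau>"
    and \<eta>: "(\<Sum>i=1..D. 1 / real i) \<le> \<eta>"
  shows "(\<Sum>u\<in>{P<..2*P}. \<Sum>a\<in>{j..D}. \<Sum>b\<in>{j..D}.
      real (card (triple_sols_upto M H u a b)))
    \<le> 36 * real D ^ 3 * real M / real P ^ 2 * (6 * (2 * real T + 1) * \<tau> * (real P * \<eta>\<^sup>2 + real D ^ 2))
      + 36 * real M * real D ^ 6 / (real H * real P)"
proof -
  have P0: "P > 0" using D by simp
  have \<tau>0: "\<tau> \<ge> 0" using D by (intro order_trans[OF of_nat_0_le_iff \<tau>[of 1]]) auto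
  define F where "F = 6 * (2 * real T + 1) * \<tau> * (real P * \<eta>\<^sup>2 + real D ^ 2)"
  have F0: "F \<ge> 0" unfolding F_def using \<tau>0 by simp
  \<comment> \<open>The longest window for which \<open>K\<close>, about
    \<open>18 * D^3 * L / P^2\<close>, still satisfies \<open>K * D \<le> H\<close>.\<close>
  define L0 where "L0 = H * P\<^sup>2 div (18 * D ^ 4)"
  have L0: "L0 \<ge> 1" unfolding L0_def using H(4) D by (simp add: Suc_le_eq div_greater_zero_iff)
  \<comment> \<open>The cap at \<open>M + 1\<close> matters if \<open>M < L0\<close>: then
    \<open>W = 0\<close>, the cost of later windows disappears, and \<open>K\<close> shrinks in
    proportion to \<open>M\<close>.\<close>
  define L where "L = min L0 (M + 1)"
  have L: "L > 0" "L \<le> L0" "L \<le> M + 1" unfolding L_def using L0 by auto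
  define K where "K = 18 * D ^ 3 * L div P\<^sup>2"
  define W where "W = M div L"
  have L0': "L0 * (18 * D ^ 4) \<le> H * P\<^sup>2" unfolding L0_def by simp
  have K1: "k \<le> int K" if "k * (int P)\<^sup>2 \<le> 18 * (int D) ^ 3 * int L" for k
  proof -
    have "k = k * (int P)\<^sup>2 div (int P)\<^sup>2" using P0 by simp
    also have "\<dots> \<le> 18 * (int D) ^ 3 * int L div (int P)\<^sup>2" using that P0 by (intro zdiv_mono1) auto
    also have "\<dots> = int K" unfolding K_def by (simp add: zdiv_int)
    finally show ?thesis .
  qed
  have KP: "K * P\<^sup>2 \<le> 18 * D ^ 3 * L" unfolding K_def by simp
  have K2: "K * D \<le> H"
  proof -
    have "K * D * P\<^sup>2 = K * P\<^sup>2 * D" by simp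
    also have "\<dots> \<le> 18 * D ^ 3 * L * D" using KP by (rule mult_right_mono) simp
    also have "\<dots> = L * (18 * D ^ 4)" by (simp add: power4_eq_xxxx power3_eq_cube)
    also have "\<dots> \<le> L0 * (18 * D ^ 4)" using L by (intro mult_right_mono) auto
    also have "\<dots> \<le> H * P\<^sup>2" by (rule L0')
    finally show ?thesis using P0 by simp
  qed
  let ?N = "\<lambda>u a b. near_multiples K T (int u) (int a) (int b)"
  have each: "real (card (triple_sols_upto M H u a b))
      \<le> real W + (1 + real W) * real (card (?N u a b))"
    if "u \<in> {P<..2*P}" "a \<in> {j..D}" "b \<in> {j..D}" for u a b
  proof -
    have "card (triple_sols_upto M H u a b)
        \<le> card (?N u a b) + (M div L) * (1 + card (?N u a b))"
      unfolding triple_sols_upto_def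
    proof (rule card_triple_sols[of "int j" _ _ "int D" "int P"])
      show "10 * int D * int H \<le> (int j)\<^sup>2 * int P" "20 * int D * int H \<le> (int P)\<^sup>2"
        "50 * int D * int H \<le> int T * int P" "int K * int D \<le> int H"
        using H(2,3)[THEN of_nat_mono[where 'a = int]] T[THEN of_nat_mono[where 'a = int]]
          K2[THEN of_nat_mono[where 'a = int]] by simp_all
      show "20 * int D \<le> int P" using D by simp
    qed (use that j K1 L in auto)
    then have "real (card (triple_sols_upto M H u a b))
        \<le> real (card (?N u a b) + W * (1 + card (?N u a b)))" unfolding W_def by (rule of_nat_mono)
    then show ?thesis by (simp add: algebra_simps)
  qed
  have "(\<Sum>u\<in>{P<..2*P}. \<Sum>a\<in>{j..D}. \<Sum>b\<in>{j..D}.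
      real (card (triple_sols_upto M H u a b)))
    \<le> (\<Sum>u\<in>{P<..2*P}. \<Sum>a\<in>{j..D}. \<Sum>b\<in>{j..D}. real W + (1 + real W) * real (card (?N u a b)))"
    by (intro sum_mono each)
  also have "\<dots> \<le> (\<Sum>u\<in>{P<..2*P}. \<Sum>a\<in>{1..D}. \<Sum>b\<in>{1..D}. real W + (1 + real W) * real (card (?N u a b)))"
  proof (rule sum_mono)
    fix u
    have 1: "(\<Sum>b\<in>{j..D}. real W + (1 + real W) * real (card (?N u a b)))
        \<le> (\<Sum>b\<in>{1..D}. real W + (1 + real W) * real (card (?N u a b)))" for a
      using j by (intro sum_mono2) auto
    have "(\<Sum>a\<in>{j..D}. \<Sum>b\<in>{j..D}. real W + (1 + real W) * real (card (?N u a b)))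
        \<le> (\<Sum>a\<in>{j..D}. \<Sum>b\<in>{1..D}. real W + (1 + real W) * real (card (?N u a b)))"
      by (intro sum_mono 1)
    also have "\<dots> \<le> (\<Sum>a\<in>{1..D}. \<Sum>b\<in>{1..D}. real W + (1 + real W) * real (card (?N u a b)))"
      using j by (intro sum_mono2) (auto intro!: sum_nonneg)
    finally show "(\<Sum>a\<in>{j..D}. \<Sum>b\<in>{j..D}. real W + (1 + real W) * real (card (?N u a b)))
        \<le> (\<Sum>a\<in>{1..D}. \<Sum>b\<in>{1..D}. real W + (1 + real W) * real (card (?N u a b)))" .
  qed
  also have "\<dots> = real W * (real P * real D ^ 2) + (1 + real W) *
      (\<Sum>u\<in>{P<..2*P}. \<Sum>a\<in>{1..D}. \<Sum>b\<in>{1..D}. real (card (?N u a b)))"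
    by (simp add: sum.distrib sum_distrib_left power2_eq_square)
  also have "\<dots> \<le> real W * (real P * real D ^ 2) + (1 + real W) * (real K * F)"
    unfolding F_def using D
    by (intro add_left_mono mult_left_mono sum_card_near_multiples \<tau> \<eta>) auto
  also have "\<dots> \<le> 36 * real M * real D ^ 6 / (real H * real P) + 36 * real D ^ 3 * real M / real P ^ 2 * F"
  proof (rule add_mono)
    \<comment> \<open>All windows together, the incomplete one included, have length at most twice
      \<open>M\<close>. This makes \<open>(1 + W) * K\<close> linear in \<open>M\<close>.\<close>
    have "(1 + W) * L \<le> 2 * M"
    proof (cases "L0 \<le> M")
      case True
      then have "L \<le> M" unfolding L_def by simp
      moreover have "W * L \<le> M" unfolding W_def by simp
      ultimately show ?thesis by simp
    next
      case False
      then have "L = M + 1" unfolding L_def by simp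
      then show ?thesis using M unfolding W_def by simp
    qed
    then have WL: "(1 + real W) * real L \<le> 2 * real M"
      using of_nat_mono[OF \<open>(1 + W) * L \<le> 2 * M\<close>, where 'a = real] unfolding of_nat_mult by simp
    have "real K * real P ^ 2 \<le> 18 * real D ^ 3 * real L"
      using of_nat_mono[OF KP, where 'a = real] by simp
    then have "real K \<le> 18 * real D ^ 3 * real L / real P ^ 2" using P0 by (simp add: field_simps)
    then have "(1 + real W) * real K \<le> (1 + real W) * (18 * real D ^ 3 * real L / real P ^ 2)"
      by (intro mult_left_mono) auto
    also have "\<dots> = 18 * real D ^ 3 / real P ^ 2 * ((1 + real W) * real L)" by simp
    also have "\<dots> \<le> 18 * real D ^ 3 / real P ^ 2 * (2 * real M)"
      by (intro mult_left_mono WL) auto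
    finally have "(1 + real W) * real K \<le> 36 * real D ^ 3 * real M / real P ^ 2" by simp
    then show "(1 + real W) * (real K * F) \<le> 36 * real D ^ 3 * real M / real P ^ 2 * F"
      using F0 by (metis mult.assoc mult_right_mono)
    show "real W * (real P * real D ^ 2) \<le> 36 * real M * real D ^ 6 / (real H * real P)"
    proof (cases "L0 \<le> M")
      case True
      then have LL: "L = L0" unfolding L_def by simp
      have "H * P\<^sup>2 < (18 * D ^ 4) * (L0 + 1)"
        unfolding L0_def using dividend_less_times_div[of "18 * D ^ 4" "H * P\<^sup>2"] D by simp
      also have "\<dots> \<le> (18 * D ^ 4) * (2 * L0)" using L0 by (intro mult_left_mono) auto
      finally have "H * P\<^sup>2 \<le> 36 * D ^ 4 * L0" by simp
      from of_nat_mono[OF this, where 'a = real]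
      have HP: "real H * real P ^ 2 \<le> 36 * real D ^ 4 * real L0" by simp
      have "W * L0 \<le> M" unfolding W_def LL by simp
      then have "real W * real L0 \<le> real M"
        using of_nat_mono[of "W * L0" M, where 'a = real] by simp
      have "real W * (real H * real P ^ 2) \<le> real W * (36 * real D ^ 4 * real L0)"
        by (intro mult_left_mono HP) auto
      also have "\<dots> = 36 * real D ^ 4 * (real W * real L0)" by simp
      also have "\<dots> \<le> 36 * real D ^ 4 * real M" by (intro mult_left_mono) (use \<open>real W * real L0 \<le> real M\<close> in auto)
      finally have "real W * (real H * real P ^ 2) * real D ^ 2 \<le> 36 * real D ^ 4 * real M * real D ^ 2"
        by (rule mult_right_mono) simp
      also have "36 * real D ^ 4 * real M * real D ^ 2 = 36 * real M * real D ^ 6"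
        by (simp add: power_add[symmetric])
      finally have "real W * (real P * real D ^ 2) * (real H * real P) \<le> 36 * real M * real D ^ 6"
        by (simp add: power2_eq_square ac_simps)
      then show ?thesis using P0 H(1) by (simp add: pos_le_divide_eq)
    next
      case False
      then have "W = 0" unfolding W_def L_def by simp
      then show ?thesis by simp
    qed
  qed
  finally show ?thesis unfolding F_def by (simp add: add.commute)
qed

text \<open>A triple is encoded by the middle root, the two differences of roots and the middle
  cofactor. These data determine \<open>N1\<close> and all three roots, and then \<open>N0\<close>
  and \<open>N2\<close> as well: two different multiples of a square larger than \<open>P^2\<close>
  cannot both lie within \<open>H\<close> of \<open>N1\<close>, because
  \<open>20 * H \<le> P\<^sup>2\<close>.\<close>

lemma card_square_triples:
  fixes f :: "nat \<Rightarrow> nat" and P D H j T X :: nat and \<tau> \<eta> :: real and TT :: "(nat \<times> nat \<times> nat) set"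
  assumes j: "1 \<le> j" and D: "1 \<le> D" "20 * D \<le> P"
    and H: "1 \<le> H" "10 * D * H \<le> j\<^sup>2 * P" "20 * D * H \<le> P\<^sup>2" "18 * D ^ 4 \<le> H * P\<^sup>2"
    and T: "50 * D * H \<le> T * P"
    and \<tau>: "\<And>q. 0 < q \<Longrightarrow> q \<le> 18 * D\<^sup>2 \<Longrightarrow> real (card {d. d dvd q}) \<le> \<tau>"
    and \<eta>: "(\<Sum>i=1..D. 1 / real i) \<le> \<eta>"
    and TT: "\<And>N0 N1 N2. (N0, N1, N2) \<in> TT \<Longrightarrow>
      (\<forall>N\<in>{N0, N1, N2}. f N \<in> {P<..2*P} \<and> (f N)\<^sup>2 dvd N) \<and> 1 \<le> N1 \<and> N1 \<le> X
      \<and> \<bar>int N0 - int N1\<bar> \<le> int H \<and> \<bar>int N1 - int N2\<bar> \<le> int H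
      \<and> f N0 + j \<le> f N1 \<and> f N1 + j \<le> f N2 \<and> f N1 \<le> f N0 + D \<and> f N2 \<le> f N1 + D"
  shows "real (card TT) \<le> 36 * real D ^ 3 * real X / real P ^ 4 *
      (6 * (2 * real T + 1) * \<tau> * (real P * \<eta>\<^sup>2 + real D ^ 2))
      + 36 * real X * real D ^ 6 / (real H * real P ^ 3)"
proof -
  have P0: "P > 0" using D by simp
  define M where "M = X div P\<^sup>2"
  define S where "S = (SIGMA u:{P<..2*P}. SIGMA a:{j..D}. SIGMA b:{j..D}.
      triple_sols_upto M H u a b)"
  define g where "g = (\<lambda>(N0, N1, N2). (f N1, f N1 - f N0, f N2 - f N1, N1 div (f N1)\<^sup>2))"
  have finT: "finite (triple_sols_upto M H u a b)" for u a b
    unfolding triple_sols_upto_def by simp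
  have finS: "finite S" unfolding S_def by (intro finite_SigmaI finT) auto
  have gS: "g ` TT \<subseteq> S"
  proof
    fix x assume "x \<in> g ` TT"
    then obtain N0 N1 N2 where N: "(N0, N1, N2) \<in> TT" and x: "x = g (N0, N1, N2)" by auto
    note h = TT[OF N]
    define u where "u = f N1"
    define a where "a = f N1 - f N0"
    define b where "b = f N2 - f N1"
    define t where "t = N1 div (f N1)\<^sup>2"
    have ua: "f N0 = u - a" "int (f N0) = int u - int a" "f N2 = u + b"
      using h unfolding u_def a_def b_def by auto
    have u: "u \<in> {P<..2*P}" "a \<in> {j..D}" "b \<in> {j..D}" using h unfolding u_def a_def b_def by auto
    have N1: "N1 = u\<^sup>2 * t" using h unfolding u_def t_def by simp
    have "t \<ge> 1" using h N1 by (cases t) auto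
    have "t \<le> M"
    proof -
      have "P\<^sup>2 * t \<le> u\<^sup>2 * t" using u by (intro mult_right_mono power_mono) auto
      then have "P\<^sup>2 * t \<le> X" using N1 h by linarith
      then show ?thesis unfolding M_def using P0 by (simp add: less_eq_div_iff_mult_less_eq mult.commute)
    qed
    obtain t0 where t0: "N0 = (f N0)\<^sup>2 * t0" using h by (auto elim: dvdE)
    obtain t2 where t2: "N2 = (f N2)\<^sup>2 * t2" using h by (auto elim: dvdE)
    have i0: "int N0 = (int u - int a)\<^sup>2 * int t0"
      using ua(2) t0 by (metis of_nat_mult of_nat_power)
    have i1: "int N1 = (int u)\<^sup>2 * int t" unfolding N1 by simp
    have i2: "int N2 = (int u + int b)\<^sup>2 * int t2" by (subst t2, subst ua) simp
    have "t \<in> triple_sols (int H) (int u) (int a) (int b)"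
      using h unfolding i0 i1 i2 by (intro triple_solsI) auto
    then show "x \<in> S" unfolding x g_def S_def using u \<open>t \<ge> 1\<close> \<open>t \<le> M\<close>
      by (simp add: u_def a_def b_def t_def triple_sols_upto_def)
  qed
  have inj: "inj_on g TT"
  proof (rule inj_onI)
    fix x y assume xy: "x \<in> TT" "y \<in> TT" "g x = g y"
    obtain N0 N1 N2 where x: "x = (N0, N1, N2)" by (cases x) auto
    obtain M0 M1 M2 where y: "y = (M0, M1, M2)" by (cases y) auto
    note hx = TT[OF xy(1)[unfolded x]] and hy = TT[OF xy(2)[unfolded y]]
    have e: "f N1 = f M1" "f N1 - f N0 = f M1 - f M0" "f N2 - f N1 = f M2 - f M1"
      "N1 div (f N1)\<^sup>2 = M1 div (f M1)\<^sup>2"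
      using xy(3) unfolding x y g_def by auto
    have 1: "N1 = M1" using e hx hy by (metis dvd_mult_div_cancel insertCI)
    have f: "f N0 = f M0" "f N2 = f M2" using e hx hy by linarith+
    have close: "A = B" if "P < c" "c\<^sup>2 dvd A" "c\<^sup>2 dvd B" "\<bar>int A - int B\<bar> \<le> 2 * int H" for A B c
    proof (rule ccontr)
      assume "A \<noteq> B"
      have "(int c)\<^sup>2 dvd int A - int B"
        using that(2,3) by (intro dvd_diff) (metis of_nat_dvd_iff of_nat_power)+
      then have "(int c)\<^sup>2 \<le> \<bar>int A - int B\<bar>" using \<open>A \<noteq> B\<close> by (intro zdvd_imp_le) auto
      moreover have "(int P)\<^sup>2 < (int c)\<^sup>2" using that(1) by (intro power_strict_mono) auto
      moreover have "20 * int H \<le> (int P)\<^sup>2"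
      proof -
        have "H * 1 \<le> H * D" using D by (intro mult_left_mono) auto
        moreover have "20 * (H * D) \<le> P\<^sup>2" using H(3) by (simp add: ac_simps)
        ultimately have "20 * H \<le> P\<^sup>2" by linarith
        from of_nat_mono[OF this, where 'a = int] show ?thesis by simp
      qed
      ultimately show False using that(4) by linarith
    qed
    have 0: "N0 = M0" using hx hy f 1 by (intro close[of "f N0"]) auto
    have 2: "N2 = M2" using hx hy f 1 by (intro close[of "f N2"]) auto
    show "x = y" unfolding x y using 0 1 2 by simp
  qed
  have cTS: "card TT \<le> card S" using gS inj finS by (metis card_inj_on_le)
  have RHS: "36 * real D ^ 3 * real M / real P ^ 2 * (6 * (2 * real T + 1) * \<tau> * (real P * \<eta>\<^sup>2 + real D ^ 2))
      + 36 * real M * real D ^ 6 / (real H * real P) \<le>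
      36 * real D ^ 3 * real X / real P ^ 4 * (6 * (2 * real T + 1) * \<tau> * (real P * \<eta>\<^sup>2 + real D ^ 2))
      + 36 * real X * real D ^ 6 / (real H * real P ^ 3)"
  proof -
    have \<tau>0: "\<tau> \<ge> 0" using D by (intro order_trans[OF of_nat_0_le_iff \<tau>[of 1]]) auto
    have "M * P\<^sup>2 \<le> X" unfolding M_def by simp
    from of_nat_mono[OF this, where 'a = real] have "real M * real P ^ 2 \<le> real X" by simp
    then have MX: "real M \<le> real X / real P ^ 2" using P0 by (simp add: field_simps)
    have "36 * real D ^ 3 * real M / real P ^ 2 \<le> 36 * real D ^ 3 * (real X / real P ^ 2) / real P ^ 2"
      using MX by (intro divide_right_mono mult_left_mono) auto
    also have "\<dots> = 36 * real D ^ 3 * real X / real P ^ 4" by (simp add: power_add[symmetric])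
    finally have 1: "36 * real D ^ 3 * real M / real P ^ 2 \<le> 36 * real D ^ 3 * real X / real P ^ 4" .
    have "36 * real M * real D ^ 6 / (real H * real P) \<le> 36 * (real X / real P ^ 2) * real D ^ 6 / (real H * real P)"
      using MX by (intro divide_right_mono mult_right_mono mult_left_mono) auto
    also have "\<dots> = 36 * real X * real D ^ 6 / (real H * real P ^ 3)"
      by (simp add: power3_eq_cube power2_eq_square)
    finally show ?thesis using 1 \<tau>0 by (intro add_mono mult_right_mono) auto
  qed
  show ?thesis
  proof (cases "M \<ge> 1")
    case True
    have "real (card S) = (\<Sum>u\<in>{P<..2*P}. \<Sum>a\<in>{j..D}. \<Sum>b\<in>{j..D}.
      real (card (triple_sols_upto M H u a b)))"
      unfolding S_def by (simp add: card_SigmaI finT)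
    also have "\<dots> \<le> 36 * real D ^ 3 * real M / real P ^ 2 * (6 * (2 * real T + 1) * \<tau> * (real P * \<eta>\<^sup>2 + real D ^ 2))
      + 36 * real M * real D ^ 6 / (real H * real P)"
      by (rule sum_card_triple_sols[OF j D True H T \<tau> \<eta>])
    finally show ?thesis using RHS cTS by linarith
  next
    case False
    then have "S = {}" unfolding S_def by (auto simp: triple_sols_upto_def)
    moreover have "M = 0" using False by simp
    ultimately show ?thesis using cTS RHS by simp
  qed
qed

section \<open>Pairs of nearby multiples of squares\<close>

text \<open>With \<open>a = v - u\<close>, the fraction \<open>(2 * u - a) / (2 * u + 3 * a)\<close>
  is the Pade approximant of degree one over one to \<open>u^2 / v^2\<close> in the variable
  \<open>a / u\<close>. It is correct up to third order, which is why the cube of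
  \<open>v - u\<close> appears in \<open>pair_form_eq\<close>.\<close>

definition pair_form :: "int \<Rightarrow> int \<Rightarrow> int \<Rightarrow> int \<Rightarrow> int" where
  "pair_form u v m n = n * (2 * v + (v - u)) - m * (2 * u - (v - u))"

lemma pair_form_eq:
  "(v - u) ^ 3 * n = pair_form u v m n * u\<^sup>2 + (2 * u - (v - u)) * (u\<^sup>2 * m - v\<^sup>2 * n)"
  unfolding pair_form_def by algebra

text \<open>Each vanishing form equates a ratio of cofactors with the approximant to the ratio of
  squares. Exact ratios of squares are multiplicative along the three roots, but the approximants
  are not: after clearing denominators they miss by \<open>12 * a * b * (a + b)\<close>.\<close>

lemma pair_forms_not_all_zero:
  fixes u0 u1 u2 m0 m1 m2 :: int
  assumes "pair_form u0 u1 m0 m1 = 0" "pair_form u1 u2 m1 m2 = 0" "pair_form u0 u2 m0 m2 = 0"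
    and "u0 < u1" "u1 < u2" "m2 > 0"
  shows False
proof -
  define w a b where "w = 2 * u0" and "a = u1 - u0" and "b = u2 - u1"
  have u: "2 * u0 = w" "u1 = u0 + a" "u2 = u0 + a + b" unfolding w_def a_def b_def by simp_all
  have 1: "m0 * (w - a) = m1 * (w + 3 * a)"
    and 2: "m1 * (w + 2 * a - b) = m2 * (w + 2 * a + 3 * b)"
    and 3: "m0 * (w - a - b) = m2 * (w + 3 * a + 3 * b)"
    using assms(1-3) unfolding pair_form_def u(2,3) by (simp_all add: algebra_simps u(1)[symmetric])
  have "m2 * ((w - a) * (w + 2 * a - b) * (w + 3 * a + 3 * b)
      - (w + 3 * a) * (w + 2 * a + 3 * b) * (w - a - b)) = 0"
    using 1 2 3 by algebra
  moreover have "(w - a) * (w + 2 * a - b) * (w + 3 * a + 3 * b)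
      - (w + 3 * a) * (w + 2 * a + 3 * b) * (w - a - b) = 12 * (a * b * (a + b))" by algebra
  moreover have "a * b * (a + b) > 0" using assms(4,5) unfolding a_def b_def by simp
  then have "12 * (a * b * (a + b)) > 0" by linarith
  then have "m2 * (12 * (a * b * (a + b))) > 0" by (rule mult_pos_pos[OF assms(6)])
  ultimately show False by (metis less_irrefl)
qed

text \<open>If the outer form vanished, its identity would make \<open>(u2 - u0)^3 * m2\<close> at
  most \<open>2 * u0 * H\<close>. The inner differences are smaller and
  \<open>m1 \<le> 8 * m2\<close>, so each inner form times the square of its lower root
  \<open>x\<close> is at most \<open>18 * x * H\<close>, less than \<open>x^2\<close>. As integers
  the inner forms would vanish too, contrary to \<open>pair_forms_not_all_zero\<close>.\<close>

lemma pair_form_outer_nonzero: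
  fixes u0 u1 u2 m0 m1 m2 H :: int
  assumes u: "u0 < u1" "u1 < u2" "u2 \<le> 2 * u0" and H: "20 * H \<le> u0"
    and m: "m1 > 0" "m2 > 0" "H \<le> u2\<^sup>2 * m2"
    and r: "\<bar>u0\<^sup>2 * m0 - u1\<^sup>2 * m1\<bar> \<le> H" "\<bar>u1\<^sup>2 * m1 - u2\<^sup>2 * m2\<bar> \<le> H" "\<bar>u0\<^sup>2 * m0 - u2\<^sup>2 * m2\<bar> \<le> H"
  shows "pair_form u0 u2 m0 m2 \<noteq> 0"
proof
  assume z: "pair_form u0 u2 m0 m2 = 0"
  have H0: "H \<ge> 0" using r by linarith
  have u0: "u0 > 0" using u by simp
  have lin: "\<bar>(2 * x - (y - x)) * s\<bar> \<le> 2 * x * H"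
    if "u0 \<le> x" "x < y" "y \<le> 2 * u0" "\<bar>s\<bar> \<le> H" for x y s
    unfolding abs_mult using that u0 by (intro mult_mono) auto
  have zero: "pair_form x y m n = 0"
    if "u0 \<le> x" "x < y" "y \<le> 2 * u0" "\<bar>x\<^sup>2 * m - y\<^sup>2 * n\<bar> \<le> H" "n > 0" "(y - x) ^ 3 * n \<le> 16 * (x * H)" for x y m n
  proof -
    define E1 where "E1 = (y - x) ^ 3 * n"
    define E2 where "E2 = (2 * x - (y - x)) * (x\<^sup>2 * m - y\<^sup>2 * n)"
    define E3 where "E3 = x * H"
    have "pair_form x y m n * x\<^sup>2 = E1 - E2"
      using pair_form_eq[of y x n m] unfolding E1_def E2_def by simp
    moreover have "\<bar>E2\<bar> \<le> 2 * E3" unfolding E2_def E3_def mult.assoc[symmetric] by (intro lin that)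
    moreover have "0 \<le> E1" unfolding E1_def using that by simp
    moreover have "E1 \<le> 16 * E3" unfolding E1_def E3_def by (rule that)
    ultimately have "\<bar>pair_form x y m n * x\<^sup>2\<bar> \<le> 18 * E3" by linarith
    then have "\<bar>pair_form x y m n * x\<^sup>2\<bar> \<le> 18 * (x * H)" unfolding E3_def .
    also have "\<dots> < x\<^sup>2"
    proof -
      have "x * (20 * H) \<le> x * x" using H that u0 by (intro mult_left_mono) auto
      moreover have "x * x > 0" using that u0 by simp
      moreover have "x * H \<ge> 0" using that u0 H0 by simp
      ultimately show ?thesis unfolding power2_eq_square by linarith
    qed
    finally have "\<bar>pair_form x y m n\<bar> * x\<^sup>2 < 1 * x\<^sup>2" by (simp add: abs_mult)
    then have "\<bar>pair_form x y m n\<bar> < 1" by (rule mult_right_less_imp_less) simp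
    then show ?thesis by simp
  qed
  have A: "(u2 - u0) ^ 3 * m2 \<le> 2 * (u0 * H)"
    using pair_form_eq[of u2 u0 m2 m0] z lin[of u0 u2 "u0\<^sup>2 * m0 - u2\<^sup>2 * m2"] u r by simp
  have m1m2: "m1 \<le> 8 * m2"
  proof -
    have "u1\<^sup>2 * m1 \<le> 2 * (u2\<^sup>2 * m2)" using r(2) m(3) by linarith
    also have "u2\<^sup>2 * m2 \<le> (2 * u1)\<^sup>2 * m2" using u u0 m by (intro mult_right_mono power_mono) auto
    finally have "u1\<^sup>2 * m1 \<le> u1\<^sup>2 * (8 * m2)" by (simp add: power_mult_distrib)
    then show ?thesis using u u0 by simp
  qed
  have "(u1 - u0) ^ 3 * m1 \<le> (u2 - u0) ^ 3 * (8 * m2)"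
    using u m m1m2 by (intro mult_mono power_mono) auto
  then have "(u1 - u0) ^ 3 * m1 \<le> 16 * (u0 * H)" using A by simp
  then have z1: "pair_form u0 u1 m0 m1 = 0" using u r m by (intro zero) auto
  have "(u2 - u1) ^ 3 * m2 \<le> (u2 - u0) ^ 3 * m2"
    using u m by (intro mult_right_mono power_mono) auto
  moreover have "u0 * H \<le> u1 * H" using u H0 by (intro mult_right_mono) auto
  moreover have "0 \<le> u0 * H" using u0 H0 by simp
  ultimately have "(u2 - u1) ^ 3 * m2 \<le> 16 * (u1 * H)" using A by linarith
  then have z2: "pair_form u1 u2 m1 m2 = 0" using u r m by (intro zero) auto
  show False using pair_forms_not_all_zero[OF z1 z2 z u(1,2) m(2)] .
qed

text \<open>Dividing by \<open>u\<^sup>2\<close>, the condition reads \<open>l = r (a x\<^sup>2 - 2 x)\<close> modulo \<open>a\<^sup>3\<close> with \<open>x = 1 / u\<close>; this quadratic in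
  \<open>x\<close> has derivative \<open>2 (a x - 1) r\<close>, so it has a single simple root as far as \<open>r\<close> is invertible.\<close>

lemma pair_congruence_unique:
  fixes a l r u v :: int
  assumes "a ^ 3 dvd l * u\<^sup>2 + (2 * u - a) * r" "a ^ 3 dvd l * v\<^sup>2 + (2 * v - a) * r"
    and "coprime u a" "coprime v a" "odd u" "odd v"
  shows "a ^ 3 dvd 2 * r * (u - v)"
proof -
  \<comment> \<open>The sum \<open>u + v\<close> is even, so the factor 2 can be moved over to
    \<open>r\<close>. What remains, \<open>u * v - a * c\<close>, is coprime to \<open>a\<close>
    even when \<open>a\<close> is even, as it is for a difference of odd primes.\<close>
  obtain c where c: "u + v = 2 * c" using assms(5,6) by (metis odd_even_add evenE)
  have "a ^ 3 dvd v\<^sup>2 * (l * u\<^sup>2 + (2 * u - a) * r) - u\<^sup>2 * (l * v\<^sup>2 + (2 * v - a) * r)"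
    using assms(1,2) by (intro dvd_diff dvd_mult)
  also have "v\<^sup>2 * (l * u\<^sup>2 + (2 * u - a) * r) - u\<^sup>2 * (l * v\<^sup>2 + (2 * v - a) * r)
      = r * (v - u) * (2 * u * v - a * (u + v))" by algebra
  also have "\<dots> = (u * v - a * c) * (- (2 * r * (u - v)))" unfolding c by algebra
  finally have "a ^ 3 dvd (u * v - a * c) * (- (2 * r * (u - v)))" .
  moreover have "coprime (a ^ 3) (u * v - a * c)"
  proof -
    have uv: "coprime (u * v) a" using assms(3,4) by simp
    have "coprime a (u * v - a * c)"
    proof (rule coprimeI)
      fix d assume d: "d dvd a" "d dvd u * v - a * c"
      then have "d dvd (u * v - a * c) + a * c" by (intro dvd_add) auto
      then have "d dvd u * v" by simp
      then show "is_unit d" using uv d(1) by (meson coprime_common_divisor)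
    qed
    then show ?thesis by simp
  qed
  ultimately have "a ^ 3 dvd - (2 * r * (u - v))" using coprime_dvd_mult_right_iff by blast
  then show ?thesis by simp
qed

section \<open>Prime solutions of the cubic-modulus congruence\<close>

definition pair_roots :: "nat \<Rightarrow> nat \<Rightarrow> int \<Rightarrow> int \<Rightarrow> nat set" where
  "pair_roots P a l r =
    {u \<in> {P<..2*P}. prime u \<and> (int a) ^ 3 dvd l * (int u)\<^sup>2 + (2 * int u - int a) * r}"

lemma finite_pair_roots: "finite (pair_roots P a l r)"
  unfolding pair_roots_def by simp

text \<open>Primes beyond \<open>P\<close> satisfy the hypotheses of
  \<open>pair_congruence_unique\<close>: they exceed \<open>a\<close>, hence are coprime to it, and
  they exceed 2.\<close>

lemma card_pair_congruence:
  fixes a P :: nat and l r :: int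
  assumes "0 < a" "a < P"
  shows "real (card (pair_roots P a l r))
    \<le> real P * real_of_int (gcd (2 * r) (int a ^ 3)) / real a ^ 3 + 1"
proof -
  let ?A = "pair_roots P a l r"
  have "real (card ?A) = real (card (int ` ?A))" by (simp add: card_image)
  also have "\<dots> \<le> real P * real_of_int (gcd (2 * r) (int a ^ 3)) / real_of_int (int a ^ 3) + 1"
  proof (rule card_scaled_congruent_le)
    show "(int a) ^ 3 > 0" using assms by simp
    show "int ` ?A \<subseteq> {int P<..int P + int P}" by (auto simp: pair_roots_def)
    fix x y assume "x \<in> int ` ?A" "y \<in> int ` ?A"
    then obtain u v where u: "x = int u" "u \<in> ?A" and v: "y = int v" "v \<in> ?A" by blast
    have *: "coprime (int p) (int a) \<and> odd (int p)" if "p \<in> ?A" for p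
    proof -
      have p: "prime p" "p > P" using that by (auto simp: pair_roots_def)
      then have "\<not> p dvd a" using assms by (auto dest: dvd_imp_le)
      then have "coprime p a" using p by (simp add: prime_imp_coprime)
      moreover have "p > 2" using p assms by linarith
      then have "odd p" using p prime_odd_nat by blast
      ultimately show ?thesis by simp
    qed
    show "(int a) ^ 3 dvd 2 * r * (x - y)"
      unfolding u(1) v(1) using u(2) v(2) *[OF u(2)] *[OF v(2)]
      by (intro pair_congruence_unique[of _ l]) (auto simp: pair_roots_def)
  qed
  finally show ?thesis by simp
qed

text \<open>The value \<open>r = 0\<close> must be left out because there the gcd is all of
  \<open>a^3\<close> and the congruence for differences says nothing. For the other \<open>r\<close>
  the gcds average to a divisor function.\<close>

lemma sum_card_pair_congruence:
  fixes a P H :: nat and l :: int and \<tau> :: real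
  assumes a: "0 < a" "a < P" and \<tau>: "real (card {d. d dvd a ^ 3}) \<le> \<tau>"
  shows "(\<Sum>r\<in>{-int H..int H} - {0}. real (card (pair_roots P a l r)))
    \<le> 2 * real H + 4 * real P * real H * \<tau> / real a ^ 3"
proof -
  have g: "real_of_int (gcd (2 * r) (int a ^ 3)) \<le> 2 * real (gcd (nat \<bar>r\<bar>) (a ^ 3))" for r
  proof -
    have e: "gcd (2 * r) (int a ^ 3) = int (gcd (2 * nat \<bar>r\<bar>) (a ^ 3))"
      by (simp add: gcd_int_def nat_abs_mult_distrib nat_power_eq)
    have "gcd (2 * nat \<bar>r\<bar>) (a ^ 3) \<le> 2 * gcd (nat \<bar>r\<bar>) (a ^ 3)"
    proof -
      have "gcd (2 * nat \<bar>r\<bar>) (a ^ 3) dvd gcd (2 * nat \<bar>r\<bar>) (2 * a ^ 3)" by (intro gcd_mono) auto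
      also have "\<dots> = 2 * gcd (nat \<bar>r\<bar>) (a ^ 3)" by (rule gcd_mult_distrib_nat[symmetric])
      finally show ?thesis using a by (intro dvd_imp_le) auto
    qed
    from of_nat_mono[OF this, where 'a = real] show ?thesis
      unfolding e by (simp only: of_nat_mult of_nat_numeral of_int_of_nat_eq)
  qed
  have split: "(\<Sum>r\<in>{-int H..int H} - {0}. h (nat \<bar>r\<bar>)) = 2 * (\<Sum>r=1..H. h r)" for h :: "nat \<Rightarrow> real"
  proof -
    have "{-int H..int H} - {0} = (\<lambda>r. int r) ` {1..H} \<union> (\<lambda>r. - int r) ` {1..H}"
    proof (intro equalityI subsetI)
      fix r assume r: "r \<in> {-int H..int H} - {0}"
      show "r \<in> (\<lambda>r. int r) ` {1..H} \<union> (\<lambda>r. - int r) ` {1..H}"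
      proof (cases "r > 0")
        case True
        then show ?thesis using r by (intro UnI1 image_eqI[of _ _ "nat r"]) auto
      next
        case False
        then show ?thesis using r by (intro UnI2 image_eqI[of _ _ "nat (-r)"]) auto
      qed
    qed auto
    then have "(\<Sum>r\<in>{-int H..int H} - {0}. h (nat \<bar>r\<bar>)) =
        (\<Sum>r\<in>(\<lambda>r. int r) ` {1..H}. h (nat \<bar>r\<bar>)) + (\<Sum>r\<in>(\<lambda>r. - int r) ` {1..H}. h (nat \<bar>r\<bar>))"
      by (simp only:) (rule sum.union_disjoint, auto)
    also have "(\<Sum>r\<in>(\<lambda>r. int r) ` {1..H}. h (nat \<bar>r\<bar>)) = (\<Sum>r=1..H. h r)"
      by (subst sum.reindex) (auto simp: inj_on_def)
    also have "(\<Sum>r\<in>(\<lambda>r. - int r) ` {1..H}. h (nat \<bar>r\<bar>)) = (\<Sum>r=1..H. h r)"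
      by (subst sum.reindex) (auto simp: inj_on_def)
    finally show ?thesis by simp
  qed
  have gs: "(\<Sum>r=1..H. real (gcd r (a ^ 3))) \<le> real H * \<tau>"
  proof -
    have "real (\<Sum>r=1..H. gcd r (a ^ 3)) \<le> real (H * card {d. d dvd a ^ 3})"
      using a by (intro of_nat_mono sum_gcd_le) auto
    also have "\<dots> \<le> real H * \<tau>" using \<tau> by (simp add: mult_left_mono)
    finally show ?thesis by simp
  qed
  have "(\<Sum>r\<in>{-int H..int H} - {0}. real (card (pair_roots P a l r)))
    \<le> (\<Sum>r\<in>{-int H..int H} - {0}. 2 * real P / real a ^ 3 * real (gcd (nat \<bar>r\<bar>) (a ^ 3)) + 1)"
  proof (intro sum_mono)
    fix r
    have "real (card (pair_roots P a l r))
      \<le> real P * real_of_int (gcd (2 * r) (int a ^ 3)) / real a ^ 3 + 1"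
      by (rule card_pair_congruence[OF a])
    also have "\<dots> \<le> real P * (2 * real (gcd (nat \<bar>r\<bar>) (a ^ 3))) / real a ^ 3 + 1"
      using g by (intro add_right_mono divide_right_mono mult_left_mono) auto
    finally show "real (card (pair_roots P a l r))
      \<le> 2 * real P / real a ^ 3 * real (gcd (nat \<bar>r\<bar>) (a ^ 3)) + 1"
      by (simp only: times_divide_eq_left times_divide_eq_right ac_simps)
  qed
  also have "\<dots> = 2 * (\<Sum>r=1..H. 2 * real P / real a ^ 3 * real (gcd r (a ^ 3)) + 1)"
    by (rule split)
  also have "\<dots> = 2 * real H + 4 * real P / real a ^ 3 * (\<Sum>r=1..H. real (gcd r (a ^ 3)))"
    by (simp only: sum.distrib sum_distrib_left[symmetric]) (simp add: algebra_simps)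
  also have "\<dots> \<le> 2 * real H + 4 * real P / real a ^ 3 * (real H * \<tau>)"
    by (intro add_left_mono mult_left_mono gs) auto
  finally show ?thesis by (simp add: ac_simps)
qed

text \<open>A pair is encoded by the difference \<open>a\<close> of its roots, the value
  \<open>l\<close> of the form, the difference \<open>r\<close> of the two numbers and the lower
  root \<open>u\<close>. The identity then yields the cofactor of \<open>N1\<close>, and with it
  both numbers. Because \<open>l * u^2\<close> is at most twice \<open>a^3\<close> times that
  cofactor, \<open>l\<close> is at most \<open>2 * a^3 * X / P^4\<close>; summing over
  \<open>l\<close> cancels the density \<open>1 / a^3\<close> of the solutions
  \<open>u\<close>.\<close>

lemma card_square_pairs:
  fixes f :: "nat \<Rightarrow> nat" and P D H X :: nat and \<tau> :: real and PP :: "(nat \<times> nat) set"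
  assumes D: "1 \<le> D" "D < P" and H: "20 * H \<le> P"
    and \<tau>: "\<And>a. 0 < a \<Longrightarrow> a \<le> D \<Longrightarrow> real (card {d. d dvd a ^ 3}) \<le> \<tau>"
    and PP: "\<And>N0 N1. (N0, N1) \<in> PP \<Longrightarrow> (\<forall>N\<in>{N0, N1}. f N \<in> {P<..2*P} \<and> prime (f N) \<and> (f N)\<^sup>2 dvd N)
      \<and> 1 \<le> N1 \<and> N1 \<le> X \<and> N0 \<noteq> N1 \<and> \<bar>int N0 - int N1\<bar> \<le> int H \<and> f N0 < f N1 \<and> f N1 \<le> f N0 + D
      \<and> pair_form (int (f N0)) (int (f N1)) (int (N0 div (f N0)\<^sup>2)) (int (N1 div (f N1)\<^sup>2)) \<noteq> 0"
  shows "real (card PP) \<le> 4 * real X * real H * real D ^ 4 / real P ^ 4 + 8 * real X * real H * real D * \<tau> / real P ^ 3"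
proof -
  have P0: "P > 0" using D by simp
  define L where "L a = 2 * a ^ 3 * X div P ^ 4" for a
  let ?U = "\<lambda>a l r. pair_roots P a (int l) r"
  define S where "S = (SIGMA a:{1..D}. SIGMA l:{1..L a}. SIGMA r:{-int H..int H} - {0}. ?U a l r)"
  define F where "F N0 N1 = pair_form (int (f N0)) (int (f N1)) (int (N0 div (f N0)\<^sup>2)) (int (N1 div (f N1)\<^sup>2))" for N0 N1
  define g where "g = (\<lambda>(N0, N1). (f N1 - f N0, nat (F N0 N1), int N0 - int N1, f N0))"
  have finS: "finite S" unfolding S_def by (intro finite_SigmaI finite_pair_roots) auto
  have Fpos: "F N0 N1 \<ge> 1" and gmem: "g (N0, N1) \<in> S" if N: "(N0, N1) \<in> PP" for N0 N1
  proof -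
    note h = PP[OF N]
    define u v m n where "u = int (f N0)" "v = int (f N1)" "m = int (N0 div (f N0)\<^sup>2)" "n = int (N1 div (f N1)\<^sup>2)"
    note defs = this
    have "(f N0)\<^sup>2 * (N0 div (f N0)\<^sup>2) = N0" "(f N1)\<^sup>2 * (N1 div (f N1)\<^sup>2) = N1" using h by auto
    then have N0: "int N0 = u\<^sup>2 * m" and N1: "int N1 = v\<^sup>2 * n"
      unfolding defs by (metis of_nat_mult of_nat_power)+
    define r where "r = int N0 - int N1"
    have r: "\<bar>r\<bar> \<le> int H" "r \<noteq> 0" unfolding r_def using h by auto
    have uv: "int P < u" "u < v" "v \<le> u + int D" "v \<le> 2 * int P" "u \<le> 2 * int P" unfolding defs using h by auto
    have n1: "n \<ge> 1" using h N1 unfolding defs by (cases "N1 div (f N1)\<^sup>2") auto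
    have key: "(v - u) ^ 3 * n = F N0 N1 * u\<^sup>2 + (2 * u - (v - u)) * r"
      unfolding F_def r_def N0 N1 unfolding defs(1-4)[symmetric] by (rule pair_form_eq)
    have lin: "\<bar>(2 * u - (v - u)) * r\<bar> \<le> 2 * u * int H"
      unfolding abs_mult using uv r by (intro mult_mono) auto
    have uH: "20 * (u * int H) \<le> u\<^sup>2"
    proof -
      have "u * (20 * int H) \<le> u * u" using uv H by (intro mult_left_mono) auto
      then show ?thesis by (simp add: power2_eq_square)
    qed
    have u2: "u\<^sup>2 > 0" using uv by simp
    \<comment> \<open>The cubic term is nonnegative and the term with \<open>r\<close> is at most a
      tenth of \<open>u^2\<close>, so the form exceeds -1. Being nonzero, it is positive.\<close>
    have "0 \<le> (v - u) ^ 3 * n" using uv n1 by simp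
    then have "F N0 N1 * u\<^sup>2 > (-1) * u\<^sup>2" using key lin uH u2 by linarith
    then have "F N0 N1 > -1" by (rule mult_right_less_imp_less) simp
    then show F1: "F N0 N1 \<ge> 1" using h unfolding F_def by linarith
    have "F N0 N1 * u\<^sup>2 \<le> 2 * ((v - u) ^ 3 * n)"
    proof -
      have "1 * u\<^sup>2 \<le> F N0 N1 * u\<^sup>2" using F1 by (intro mult_right_mono) auto
      then show ?thesis using key lin uH by linarith
    qed
    then have "F N0 N1 * u\<^sup>2 * v\<^sup>2 \<le> 2 * ((v - u) ^ 3 * n) * v\<^sup>2" by (intro mult_right_mono) auto
    also have "\<dots> = 2 * (v - u) ^ 3 * int N1" unfolding N1 by simp
    also have "\<dots> \<le> 2 * (v - u) ^ 3 * int X" using h uv by (intro mult_left_mono) auto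
    finally have 1: "F N0 N1 * u\<^sup>2 * v\<^sup>2 \<le> 2 * (v - u) ^ 3 * int X" .
    have "F N0 N1 * (int P)\<^sup>2 * (int P)\<^sup>2 \<le> F N0 N1 * u\<^sup>2 * v\<^sup>2"
      using uv F1 by (intro mult_mono power_mono) auto
    then have 2: "F N0 N1 * int P ^ 4 \<le> 2 * (v - u) ^ 3 * int X" using 1 by (simp add: power_add[symmetric] mult.assoc)
    have a: "int (f N1 - f N0) = v - u" unfolding defs using h by (simp add: of_nat_diff)
    have "int (nat (F N0 N1) * P ^ 4) \<le> int (2 * (f N1 - f N0) ^ 3 * X)"
      using 2 F1 a by simp
    then have "nat (F N0 N1) * P ^ 4 \<le> 2 * (f N1 - f N0) ^ 3 * X" by (simp only: of_nat_le_iff)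
    then have LL: "nat (F N0 N1) \<le> L (f N1 - f N0)" unfolding L_def using P0 by (simp add: less_eq_div_iff_mult_less_eq)
    have "(int (f N1 - f N0)) ^ 3 dvd int (nat (F N0 N1)) * u\<^sup>2 + (2 * u - int (f N1 - f N0)) * r"
    proof -
      have "int (nat (F N0 N1)) = F N0 N1" using F1 by simp
      then show ?thesis unfolding a by (simp only: key[symmetric] dvd_triv_left)
    qed
    then show "g (N0, N1) \<in> S"
      unfolding g_def S_def using LL F1 h r unfolding r_def defs by (auto simp: pair_roots_def)
  qed
  have inj: "inj_on g PP"
  proof (rule inj_onI)
    fix x y assume xy: "x \<in> PP" "y \<in> PP" "g x = g y"
    obtain N0 N1 where x: "x = (N0, N1)" by (cases x) auto
    obtain M0 M1 where y: "y = (M0, M1)" by (cases y) auto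
    note hx = PP[OF xy(1)[unfolded x]] and hy = PP[OF xy(2)[unfolded y]]
    have e: "f N1 - f N0 = f M1 - f M0" "nat (F N0 N1) = nat (F M0 M1)" "int N0 - int N1 = int M0 - int M1" "f N0 = f M0"
      using xy(3) unfolding x y g_def by auto
    have F: "F N0 N1 = F M0 M1" using e(2) Fpos[OF xy(1)[unfolded x]] Fpos[OF xy(2)[unfolded y]] by simp
    have f1: "f N1 = f M1" using e hx hy by linarith
    have lt: "f M0 < f M1" using hy by simp
    have sq: "(int (f A))\<^sup>2 * int (A div (f A)\<^sup>2) = int A" if "(f A)\<^sup>2 dvd A" for A
      using that by (metis dvd_mult_div_cancel of_nat_mult of_nat_power)
    have "(int (f N1) - int (f N0)) ^ 3 * int (N1 div (f N1)\<^sup>2) = F N0 N1 * (int (f N0))\<^sup>2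
        + (2 * int (f N0) - (int (f N1) - int (f N0))) * (int N0 - int N1)"
      using pair_form_eq[of "int (f N1)" "int (f N0)" "int (N1 div (f N1)\<^sup>2)" "int (N0 div (f N0)\<^sup>2)"] hx
      unfolding F_def by (simp add: sq)
    moreover have "(int (f M1) - int (f M0)) ^ 3 * int (M1 div (f M1)\<^sup>2) = F M0 M1 * (int (f M0))\<^sup>2
        + (2 * int (f M0) - (int (f M1) - int (f M0))) * (int M0 - int M1)"
      using pair_form_eq[of "int (f M1)" "int (f M0)" "int (M1 div (f M1)\<^sup>2)" "int (M0 div (f M0)\<^sup>2)"] hy
      unfolding F_def by (simp add: sq)
    ultimately have "(int (f M1) - int (f M0)) ^ 3 * int (N1 div (f M1)\<^sup>2) = (int (f M1) - int (f M0)) ^ 3 * int (M1 div (f M1)\<^sup>2)"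
      using e(3,4) f1 F by simp
    then have "N1 div (f M1)\<^sup>2 = M1 div (f M1)\<^sup>2" using lt by simp
    then have "N1 = M1" using hx hy f1 by (metis dvd_mult_div_cancel insertCI)
    then show "x = y" unfolding x y using e(3) by simp
  qed
  have "card PP \<le> card S" using gmem inj finS by (intro card_inj_on_le[of g]) auto
  then have "real (card PP) \<le> real (card S)" by simp
  also have "real (card S) = (\<Sum>a\<in>{1..D}. \<Sum>l\<in>{1..L a}. \<Sum>r\<in>{-int H..int H} - {0}. real (card (?U a l r)))"
    unfolding S_def by (simp add: card_SigmaI finite_pair_roots)
  also have "\<dots> \<le> (\<Sum>a\<in>{1..D}. 4 * real X * real H * real D ^ 3 / real P ^ 4 + 8 * real X * real H * \<tau> / real P ^ 3)"
  proof (rule sum_mono)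
    fix a assume a: "a \<in> {1..D}"
    have \<tau>0: "\<tau> \<ge> 0" using a \<tau>[of a] by (intro order_trans[OF of_nat_0_le_iff \<tau>[of a]]) auto
    have "(\<Sum>l\<in>{1..L a}. \<Sum>r\<in>{-int H..int H} - {0}. real (card (?U a l r)))
      \<le> (\<Sum>l\<in>{1..L a}. 2 * real H + 4 * real P * real H * \<tau> / real a ^ 3)"
      using a D by (intro sum_mono sum_card_pair_congruence \<tau>) auto
    also have "\<dots> = real (L a) * (2 * real H + 4 * real P * real H * \<tau> / real a ^ 3)" by simp
    also have "\<dots> \<le> (2 * real a ^ 3 * real X / real P ^ 4) * (2 * real H + 4 * real P * real H * \<tau> / real a ^ 3)"
    proof (rule mult_right_mono)
      have "L a * P ^ 4 \<le> 2 * a ^ 3 * X" unfolding L_def by simp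
      from of_nat_mono[OF this, where 'a = real]
      show "real (L a) \<le> 2 * real a ^ 3 * real X / real P ^ 4" using P0 by (simp add: pos_le_divide_eq)
    qed (use \<tau>0 in simp)
    also have "\<dots> = 4 * real X * real H * real a ^ 3 / real P ^ 4 + 8 * real X * real H * \<tau> / real P ^ 3"
      using a P0 by (simp add: field_simps eval_nat_numeral)
    also have "\<dots> \<le> 4 * real X * real H * real D ^ 3 / real P ^ 4 + 8 * real X * real H * \<tau> / real P ^ 3"
      using a by (intro add_right_mono divide_right_mono mult_left_mono power_mono) auto
    finally show "(\<Sum>l\<in>{1..L a}. \<Sum>r\<in>{-int H..int H} - {0}. real (card (?U a l r)))
      \<le> 4 * real X * real H * real D ^ 3 / real P ^ 4 + 8 * real X * real H * \<tau> / real P ^ 3" .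
  qed
  also have "\<dots> = 4 * real X * real H * real D ^ 4 / real P ^ 4 + 8 * real X * real H * real D * \<tau> / real P ^ 3"
    by (simp add: algebra_simps eval_nat_numeral)
  finally show ?thesis .
qed

section \<open>Families of intervals\<close>

text \<open>The triples of roots are pulled back along \<open>f\<close> to triples of integers,
  interval by interval. Disjoint intervals keep them distinct. Injectivity of \<open>fst\<close> is
  recorded so that the middle entry can later be dropped without identifying triples.\<close>

lemma square_family_triples:
  fixes V :: "nat set" and W :: "nat \<Rightarrow> nat set" and f :: "nat \<Rightarrow> nat" and P D H :: nat and n1 :: real
  assumes "finite V" and disj: "\<And>n n'. n \<in> V \<Longrightarrow> n' \<in> V \<Longrightarrow> n < n' \<Longrightarrow> n + H \<le> n'"
    and W: "\<And>n. n \<in> V \<Longrightarrow> W n \<subseteq> {n<..n + H}" and inj: "\<And>n. n \<in> V \<Longrightarrow> inj_on f (W n)"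
    and f: "\<And>n. n \<in> V \<Longrightarrow> f ` W n \<subseteq> {P<..2 * P}" and n1: "\<And>n. n \<in> V \<Longrightarrow> n1 \<le> real (card (W n))"
    and D: "D > 0"
  obtains TT where "finite TT" "inj_on fst TT" "real (card V) * (n1 - 2 - 2 * real P / real D) \<le> real (card TT)"
    "\<And>N0 N1 N2. (N0, N1, N2) \<in> TT \<Longrightarrow> \<exists>n\<in>V. N0 \<in> W n \<and> N1 \<in> W n \<and> N2 \<in> W n
       \<and> f N0 < f N1 \<and> f N1 < f N2 \<and> f N2 \<le> f N0 + D"
proof -
  have finW: "finite (W n)" if "n \<in> V" for n using W[OF that] finite_subset by blast
  let ?good = "\<lambda>n T. T \<subseteq> f ` W n \<times> f ` W n \<times> f ` W n \<and> inj_on fst T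
      \<and> n1 - 2 - 2 * real P / real D \<le> real (card T)
      \<and> (\<forall>x y z. (x, y, z) \<in> T \<longrightarrow> x < y \<and> y < z \<and> z - x \<le> D)"
  have "\<forall>n\<in>V. \<exists>T. ?good n T"
  proof
    fix n assume n: "n \<in> V"
    obtain T where T: "T \<subseteq> f ` W n \<times> f ` W n \<times> f ` W n" "inj_on fst T"
        "real (card (f ` W n)) - 2 - 2 * real P / real D \<le> real (card T)"
        "\<And>x y z. (x, y, z) \<in> T \<Longrightarrow> x < y \<and> y < z \<and> z - x \<le> D"
      using consecutive_triples[OF _ f[OF n] D] finW[OF n] by (metis finite_imageI)
    have "card (f ` W n) = card (W n)" by (rule card_image[OF inj[OF n]])
    then have "n1 - 2 - 2 * real P / real D \<le> real (card T)" using T(3) n1[OF n] by simp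
    then show "\<exists>T. ?good n T"
      using T by blast
  qed
  from bchoice[OF this] obtain T where T': "\<forall>n\<in>V. ?good n (T n)" ..
  have T: "\<And>n. n \<in> V \<Longrightarrow> T n \<subseteq> f ` W n \<times> f ` W n \<times> f ` W n"
      "\<And>n. n \<in> V \<Longrightarrow> inj_on fst (T n)"
      "\<And>n. n \<in> V \<Longrightarrow> n1 - 2 - 2 * real P / real D \<le> real (card (T n))"
      "\<And>n x y z. n \<in> V \<Longrightarrow> (x, y, z) \<in> T n \<Longrightarrow> x < y \<and> y < z \<and> z - x \<le> D"
    using T' by blast+
  define g where "g n = the_inv_into (W n) f" for n
  have g: "g n x \<in> W n" "f (g n x) = x" if "n \<in> V" "x \<in> f ` W n" for n x
    unfolding g_def using that inj[OF that(1)] by (auto intro: the_inv_into_into f_the_inv_into_f)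
  define h where "h n = (\<lambda>(x, y, z). (g n x, g n y, g n z))" for n
  have finT: "finite (T n)" if "n \<in> V" for n
    using T(1)[OF that] finW[OF that] by (meson finite_SigmaI finite_imageI finite_subset)
  have mem: "\<exists>x y z. (x, y, z) \<in> T n \<and> f (fst q) = x \<and> q = h n (x, y, z) \<and> fst q \<in> W n"
    if nV: "n \<in> V" and q: "q \<in> h n ` T n" for n q
  proof -
    obtain x y z where xyz: "(x, y, z) \<in> T n" "q = h n (x, y, z)"
      using q by (metis imageE prod_cases3)
    then have "x \<in> f ` W n" using T(1)[OF nV] by auto
    then show ?thesis using xyz g[OF nV] by (auto simp: h_def)
  qed
  have same: "p = q" if hh: "n \<in> V" "n' \<in> V" "p \<in> h n ` T n" "q \<in> h n' ` T n'" "fst p = fst q" for n n' p q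
  proof -
    obtain x y z where p: "(x, y, z) \<in> T n" "f (fst p) = x" "p = h n (x, y, z)" "fst p \<in> W n"
      using mem[OF hh(1,3)] by blast
    obtain x' y' z' where q: "(x', y', z') \<in> T n'" "f (fst q) = x'" "q = h n' (x', y', z')" "fst q \<in> W n'"
      using mem[OF hh(2,4)] by blast
    have "n = n'"
    proof (rule ccontr)
      assume "n \<noteq> n'"
      then have "n + H \<le> n' \<or> n' + H \<le> n" using disj hh(1,2) by (meson linorder_neqE_nat)
      moreover have "fst p \<in> {n<..n + H}" "fst p \<in> {n'<..n' + H}" 
        using p(4) q(4) hh(5) W[OF hh(1)] W[OF hh(2)] by auto
      ultimately show False by auto
    qed
    moreover have "x = x'" using p(2) q(2) hh(5) by simp
    ultimately have "(x, y, z) = (x', y', z')"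
      using T(2)[OF hh(1)] p(1) q(1) by (metis fst_conv inj_onD)
    then show ?thesis using p(3) q(3) \<open>n = n'\<close> by simp
  qed
  define TT where "TT = (\<Union>n\<in>V. h n ` T n)"
  have disjT: "h n ` T n \<inter> h n' ` T n' = {}" if "n \<in> V" "n' \<in> V" "n \<noteq> n'" for n n'
  proof (rule ccontr)
    assume "h n ` T n \<inter> h n' ` T n' \<noteq> {}"
    then obtain p where p: "p \<in> h n ` T n" "p \<in> h n' ` T n'" by blast
    have "fst p \<in> {n<..n + H}" "fst p \<in> {n'<..n' + H}"
      using mem[OF that(1) p(1)] mem[OF that(2) p(2)] W[OF that(1)] W[OF that(2)] by blast+
    moreover have "n + H \<le> n' \<or> n' + H \<le> n" using disj that by (meson linorder_neqE_nat)
    ultimately show False by auto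
  qed
  have hinj: "inj_on (h n) (T n)" if n: "n \<in> V" for n
  proof (rule inj_onI)
    fix p q assume pq: "p \<in> T n" "q \<in> T n" "h n p = h n q"
    obtain x y z where p: "p = (x, y, z)" by (cases p) auto
    obtain x' y' z' where q: "q = (x', y', z')" by (cases q) auto
    have "x \<in> f ` W n" "x' \<in> f ` W n" using pq T(1)[OF n] p q by auto
    then have "x = x'" using pq(3) g[OF n] unfolding p q h_def by (metis (mono_tags, lifting) case_prod_conv prod.inject)
    then show "p = q" using T(2)[OF n] pq p q by (metis fst_conv inj_onD)
  qed
  have "card TT = (\<Sum>n\<in>V. card (h n ` T n))"
    unfolding TT_def using assms(1) finT disjT by (intro card_UN_disjoint) auto
  also have "\<dots> = (\<Sum>n\<in>V. card (T n))" by (intro sum.cong refl card_image hinj)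
  finally have cTT: "real (card TT) = (\<Sum>n\<in>V. real (card (T n)))" by simp
  show ?thesis
  proof (rule that[of TT])
    show "finite TT" unfolding TT_def using assms(1) finT by auto
    show "inj_on fst TT"
    proof (rule inj_onI)
      fix p q assume "p \<in> TT" "q \<in> TT" "fst p = fst q"
      then show "p = q" unfolding TT_def using same by blast
    qed
    have "real (card V) * (n1 - 2 - 2 * real P / real D) = (\<Sum>n\<in>V. n1 - 2 - 2 * real P / real D)" by simp
    also have "\<dots> \<le> (\<Sum>n\<in>V. real (card (T n)))" by (intro sum_mono T(3))
    finally show "real (card V) * (n1 - 2 - 2 * real P / real D) \<le> real (card TT)" unfolding cTT .
    fix N0 N1 N2 assume "(N0, N1, N2) \<in> TT"
    then obtain n x y z where n: "n \<in> V" "(x, y, z) \<in> T n" "(N0, N1, N2) = h n (x, y, z)"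
      unfolding TT_def by auto
    then have xyz: "x \<in> f ` W n" "y \<in> f ` W n" "z \<in> f ` W n" using T(1)[OF n(1)] by auto
    have "x < y" "y < z" "z - x \<le> D" using T(4)[OF n(1,2)] by auto
    then show "\<exists>n\<in>V. N0 \<in> W n \<and> N1 \<in> W n \<and> N2 \<in> W n
       \<and> f N0 < f N1 \<and> f N1 < f N2 \<and> f N2 \<le> f N0 + D"
      using n xyz g[OF n(1)] by (intro bexI[of _ n]) (auto simp: h_def)
  qed
qed

lemma card_family_pairs:
  fixes V :: "nat set" and W :: "nat \<Rightarrow> nat set" and f :: "nat \<Rightarrow> nat" and P H X :: nat and \<tau> n0 :: real
  assumes V: "finite V" "\<And>n n'. n \<in> V \<Longrightarrow> n' \<in> V \<Longrightarrow> n < n' \<Longrightarrow> n + H \<le> n'" "\<And>n. n \<in> V \<Longrightarrow> n + H \<le> X"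
    and W: "\<And>n. n \<in> V \<Longrightarrow> W n \<subseteq> {n<..n + H}" "\<And>n. n \<in> V \<Longrightarrow> inj_on f (W n)"
      "\<And>n. n \<in> V \<Longrightarrow> f ` W n \<subseteq> {P<..2 * P}" "\<And>n. n \<in> V \<Longrightarrow> n0 \<le> real (card (W n))"
    and f: "\<And>n N. n \<in> V \<Longrightarrow> N \<in> W n \<Longrightarrow> prime (f N) \<and> (f N)\<^sup>2 dvd N"
    and n0: "10 \<le> n0" and H: "20 * H \<le> P"
    and \<tau>: "\<And>a. 0 < a \<Longrightarrow> a \<le> P \<Longrightarrow> real (card {d. d dvd a ^ 3}) \<le> \<tau>"
  shows "real (card V) \<le> 52488 * real X * real H / n0 ^ 5 + 144 * real X * real H * \<tau> / (n0\<^sup>2 * real P ^ 2)"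
proof (cases "V = {}")
  case True
  show ?thesis
  proof (cases "P = 0")
    case True then show ?thesis using \<open>V = {}\<close> n0 by simp
  next
    case False
    then have "\<tau> \<ge> 0" by (intro order_trans[OF of_nat_0_le_iff \<tau>[of 1]]) auto
    then show ?thesis using \<open>V = {}\<close> n0 by simp
  qed
next
  case False
  then obtain n where n: "n \<in> V" by blast
  have "card (W n) = card (f ` W n)" using W(2)[OF n] by (simp add: card_image)
  also have "\<dots> \<le> card {P<..2*P}" using W(3)[OF n] by (intro card_mono) auto
  finally have nP: "n0 \<le> real P" using W(4)[OF n] by simp
  then have P0: "P > 0" using n0 by (cases P) auto
  have \<tau>0: "\<tau> \<ge> 0" using P0 by (intro order_trans[OF of_nat_0_le_iff \<tau>[of 1]]) auto
  \<comment> \<open>Eight times the mean spacing of the roots: discarding the wider triples loses at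
    most \<open>n0 / 4\<close>, and at least \<open>n0 / 2\<close> remain since
    \<open>n0 \<ge> 10\<close>.\<close>
  define D where "D = nat \<lceil>8 * real P / n0\<rceil>"
  have D1: "8 * real P / n0 \<le> real D" unfolding D_def by linarith
  have q0: "8 * real P / n0 > 0" using P0 n0 by simp
  then have "real D \<le> 8 * real P / n0 + 1" unfolding D_def by linarith
  moreover have "1 \<le> real P / n0" using nP n0 by simp
  ultimately have D2: "real D \<le> 9 * (real P / n0)" by linarith
  have D0: "D \<ge> 1" using D1 q0 by linarith
  have "real P / n0 \<le> real P / 10" using n0 by (intro divide_left_mono) auto
  then have DP: "D < P" using D2 P0 by simp
  have PD: "2 * real P / real D \<le> n0 / 4"
  proof -
    have "8 * real P \<le> real D * n0" using D1 n0 by (simp add: pos_divide_le_eq)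
    then show ?thesis using D0 by (simp add: pos_divide_le_eq mult.commute)
  qed
  obtain TT where TT: "finite TT" "inj_on fst TT" "real (card V) * (n0 - 2 - 2 * real P / real D) \<le> real (card TT)"
    "\<And>N0 N1 N2. (N0, N1, N2) \<in> TT \<Longrightarrow> \<exists>n\<in>V. N0 \<in> W n \<and> N1 \<in> W n \<and> N2 \<in> W n
       \<and> f N0 < f N1 \<and> f N1 < f N2 \<and> f N2 \<le> f N0 + D"
    using square_family_triples[OF V(1,2) W, of D] D0 by auto
  define PP where "PP = (\<lambda>(N0, N1, N2). (N0, N2)) ` TT"
  have "card PP = card TT" unfolding PP_def
  proof (rule card_image, rule inj_onI)
    fix p q assume pq: "p \<in> TT" "q \<in> TT" "(case p of (N0, N1, N2) \<Rightarrow> (N0, N2)) = (case q of (N0, N1, N2) \<Rightarrow> (N0, N2))"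
    then have "fst p = fst q" by (auto split: prod.splits)
    then show "p = q" using TT(2) pq by (meson inj_onD)
  qed
  have "n0 / 2 \<le> n0 - 2 - 2 * real P / real D" using PD n0 by linarith
  then have "real (card V) * (n0 / 2) \<le> real (card V) * (n0 - 2 - 2 * real P / real D)" by (rule mult_left_mono) simp
  also have "\<dots> \<le> real (card PP)" using TT(3) \<open>card PP = card TT\<close> by simp
  also have "\<dots> \<le> 4 * real X * real H * real D ^ 4 / real P ^ 4 + 8 * real X * real H * real D * \<tau> / real P ^ 3"
  proof (rule card_square_pairs[where f = f])
    show "20 * H \<le> P" "1 \<le> D" "D < P" by fact+
    show "real (card {d. d dvd a ^ 3}) \<le> \<tau>" if "0 < a" "a \<le> D" for a using \<tau>[of a] that DP by auto
    fix N0 N2 assume "(N0, N2) \<in> PP"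
    then obtain N1 where "(N0, N1, N2) \<in> TT" unfolding PP_def by auto
    then obtain n where n: "n \<in> V" and N: "N0 \<in> W n" "N1 \<in> W n" "N2 \<in> W n"
      and ff: "f N0 < f N1" "f N1 < f N2" "f N2 \<le> f N0 + D" using TT(4) by blast
    have mem: "f N \<in> {P<..2*P}" "prime (f N)" "(f N)\<^sup>2 dvd N" "n < N" "N \<le> n + H" if "N \<in> W n" for N
      using W(1,3)[OF n] f[OF n that] that by auto
    have le: "N \<le> X" "1 \<le> N" if "N \<in> W n" for N using mem(4,5)[OF that] V(3)[OF n] by auto
    have dist: "\<bar>int A - int B\<bar> \<le> int H" if "A \<in> W n" "B \<in> W n" for A B
      using mem(4,5)[OF that(1)] mem(4,5)[OF that(2)] by linarith
    have sq: "(int (f A))\<^sup>2 * int (A div (f A)\<^sup>2) = int A" if "A \<in> W n" for A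
      using mem(3)[OF that] by (metis dvd_mult_div_cancel of_nat_mult of_nat_power)
    have qpos: "int (A div (f A)\<^sup>2) > 0" if "A \<in> W n" for A
      using sq[OF that] le(2)[OF that] by (cases "A div (f A)\<^sup>2") auto
    have "pair_form (int (f N0)) (int (f N2)) (int (N0 div (f N0)\<^sup>2)) (int (N2 div (f N2)\<^sup>2)) \<noteq> 0"
    proof (rule pair_form_outer_nonzero[of _ "int (f N1)" _ "int H" "int (N1 div (f N1)\<^sup>2)"])
      show "int (f N0) < int (f N1)" "int (f N1) < int (f N2)" using ff by auto
      show "int (f N2) \<le> 2 * int (f N0)" "20 * int H \<le> int (f N0)" using mem(1)[OF N(1)] mem(1)[OF N(3)] H by auto
      show "int (N1 div (f N1)\<^sup>2) > 0" "int (N2 div (f N2)\<^sup>2) > 0" using qpos N by blast+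
      show "int H \<le> (int (f N2))\<^sup>2 * int (N2 div (f N2)\<^sup>2)"
      proof -
        have "int H \<le> int (f N2)" using mem(1)[OF N(3)] H by simp
        also have "int (f N2) * 1 \<le> int (f N2) * (int (f N2) * int (N2 div (f N2)\<^sup>2))"
        proof (rule mult_left_mono)
          have "0 < int (f N2) * int (N2 div (f N2)\<^sup>2)" using qpos[OF N(3)] mem(1)[OF N(3)] by simp
          then show "1 \<le> int (f N2) * int (N2 div (f N2)\<^sup>2)" by linarith
        qed simp
        finally show ?thesis by (simp add: power2_eq_square ac_simps)
      qed
    qed (unfold sq[OF N(1)] sq[OF N(2)] sq[OF N(3)], (intro dist N)+)
    moreover have "N0 \<noteq> N2" using ff by auto
    ultimately show "(\<forall>N\<in>{N0, N2}. f N \<in> {P<..2*P} \<and> prime (f N) \<and> (f N)\<^sup>2 dvd N)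
      \<and> 1 \<le> N2 \<and> N2 \<le> X \<and> N0 \<noteq> N2 \<and> \<bar>int N0 - int N2\<bar> \<le> int H \<and> f N0 < f N2 \<and> f N2 \<le> f N0 + D
      \<and> pair_form (int (f N0)) (int (f N2)) (int (N0 div (f N0)\<^sup>2)) (int (N2 div (f N2)\<^sup>2)) \<noteq> 0"
      using mem[OF N(1)] mem[OF N(3)] le[OF N(3)] dist[OF N(1,3)] ff by auto
  qed
  also have "\<dots> \<le> 4 * real X * real H * (9 * (real P / n0)) ^ 4 / real P ^ 4 + 8 * real X * real H * (9 * (real P / n0)) * \<tau> / real P ^ 3"
    using D2 \<tau>0 by (intro add_mono divide_right_mono mult_left_mono mult_right_mono power_mono) auto
  also have "\<dots> = (52488 * real X * real H / n0 ^ 5 + 144 * real X * real H * \<tau> / (n0\<^sup>2 * real P ^ 2)) * (n0 / 2)"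
    using P0 n0 by (simp add: field_simps eval_nat_numeral)
  finally show ?thesis using n0 by simp
qed

text \<open>The triple count requires roots that are \<open>j\<close> apart with
  \<open>10 * D * H \<le> j\<^sup>2 * P\<close>. Thinning to one residue class modulo
  \<open>j\<close> raises the mean spacing to about \<open>P * j / n0\<close>, and for such
  \<open>D\<close> the requirement becomes \<open>90 * H \<le> j * n0\<close>. As \<open>n0\<close>
  will be almost \<open>H\<close>, a small \<open>j\<close> suffices and the loss is a fixed power
  of \<open>j\<close>.\<close>

lemma card_family_triples:
  fixes V :: "nat set" and W :: "nat \<Rightarrow> nat set" and f :: "nat \<Rightarrow> nat" and P H X j :: nat and \<tau> \<eta> n0 :: real
  assumes V: "finite V" "\<And>n n'. n \<in> V \<Longrightarrow> n' \<in> V \<Longrightarrow> n < n' \<Longrightarrow> n + H \<le> n'" "\<And>n. n \<in> V \<Longrightarrow> n + H \<le> X"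
    and W: "\<And>n. n \<in> V \<Longrightarrow> W n \<subseteq> {n<..n + H}" "\<And>n. n \<in> V \<Longrightarrow> inj_on f (W n)"
      "\<And>n. n \<in> V \<Longrightarrow> f ` W n \<subseteq> {P<..2 * P}" "\<And>n. n \<in> V \<Longrightarrow> n0 \<le> real (card (W n))"
    and f: "\<And>n N. n \<in> V \<Longrightarrow> N \<in> W n \<Longrightarrow> (f N)\<^sup>2 dvd N"
    and j: "1 \<le> j" "180 * real j \<le> n0" "90 * real H \<le> real j * n0" "180 * real j * real H \<le> n0 * real P"
      "118098 * real P ^ 2 * real j ^ 4 \<le> real H * n0 ^ 4" "81 * real P * real j ^ 2 \<le> n0\<^sup>2"
    and H: "1 \<le> H" "n0 \<le> real H"
    and \<tau>: "\<And>q. 0 < q \<Longrightarrow> q \<le> 18 * P\<^sup>2 \<Longrightarrow> real (card {d. d dvd q}) \<le> \<tau>"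
    and \<eta>: "1 \<le> \<eta>" "(\<Sum>i=1..P. 1 / real i) \<le> \<eta>"
  shows "real (card V) \<le> 2 * 10 ^ 9 * real X * real H * \<tau> * \<eta>\<^sup>2 * real j ^ 5 / n0 ^ 5
    + 10 ^ 8 * real X * real P ^ 3 * real j ^ 7 / (real H * n0 ^ 7)"
proof (cases "V = {}")
  case True
  have "P > 0"
  proof (rule ccontr)
    assume "\<not> P > 0"
    then have "180 * real j * real H \<le> 0" using j(4) by simp
    then show False using j(1) H(1) by (simp add: mult_le_0_iff)
  qed
  then have "\<tau> \<ge> 0" by (intro order_trans[OF of_nat_0_le_iff \<tau>[of 1]]) auto
  then show ?thesis using True j by simp
next
  case False
  then obtain n where n: "n \<in> V" by blast
  have n0: "n0 \<ge> 180" using j by simp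
  have "card (W n) = card (f ` W n)" using W(2)[OF n] by (simp add: card_image)
  also have "\<dots> \<le> card {P<..2*P}" using W(3)[OF n] by (intro card_mono) auto
  finally have nP: "n0 \<le> real P" using W(4)[OF n] by simp
  then have P0: "P > 0" using n0 by (cases P) auto
  have \<tau>0: "\<tau> \<ge> 0" using P0 by (intro order_trans[OF of_nat_0_le_iff \<tau>[of 1]]) auto
  \<comment> \<open>The mean spacing of the roots left after thinning.\<close>
  define x where "x = real P * real j / n0"
  have x0: "x > 0" unfolding x_def using P0 n0 j by simp
  have x1: "x \<ge> 1"
  proof -
    have "n0 * 1 \<le> real P * real j" using nP j n0 by (intro mult_mono) auto
    then show ?thesis unfolding x_def using n0 by simp
  qed
  have xn: "x * n0 = real P * real j" unfolding x_def using n0 by simp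
  define D where "D = nat \<lceil>8 * x\<rceil>"
  have D1: "8 * x \<le> real D" unfolding D_def by linarith
  have "real D \<le> 8 * x + 1" unfolding D_def using x0 by linarith
  then have D2: "real D \<le> 9 * x" using x1 by linarith
  have D0: "D \<ge> 1" using D1 x1 by linarith
  have PD: "2 * real P / real D \<le> n0 / (4 * real j)"
  proof -
    have "8 * (real P * real j) \<le> real D * n0" using D1 n0 mult_right_mono[OF D1, of n0] xn by (simp add: mult.assoc)
    then show ?thesis using D0 j by (simp add: field_simps)
  qed
  \<comment> \<open>The smallest choice compatible with \<open>50 * D * H \<le> T * P\<close> for
    \<open>D\<close> up to \<open>9 * x\<close>, because \<open>x * H = y * P\<close>.\<close>
  define T where "T = nat \<lceil>450 * (real j * real H / n0)\<rceil>"
  define y where "y = real j * real H / n0"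
  have y1: "y \<ge> 1"
  proof -
    have "1 * n0 \<le> real j * real H" using H j n0 by (intro mult_mono) auto
    then show ?thesis unfolding y_def using n0 by simp
  qed
  have T1: "450 * y \<le> real T" unfolding T_def y_def by linarith
  have "real T \<le> 450 * y + 1" unfolding T_def y_def[symmetric] using y1 by linarith
  then have T2: "2 * real T + 1 \<le> 903 * y" using y1 by linarith
  have xP: "180 * x \<le> real P"
  proof -
    have "180 * x * n0 \<le> real P * n0" using xn j mult_left_mono[OF j(2), of "real P"] by (simp add: mult.assoc mult.left_commute)
    then show ?thesis using n0 by simp
  qed
  have c1: "20 * D \<le> P" using D2 xP by linarith
  have c2: "10 * D * H \<le> j\<^sup>2 * P"
  proof -
    have "10 * real D * real H * n0 \<le> 10 * (9 * x) * real H * n0"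
      using D2 n0 by (intro mult_right_mono mult_left_mono) auto
    also have "\<dots> = 90 * real H * (real P * real j)" unfolding xn[symmetric] by simp
    also have "\<dots> \<le> (real j * n0) * (real P * real j)" using j by (intro mult_right_mono) auto
    finally have "10 * real D * real H * n0 \<le> (real j ^ 2 * real P) * n0" by (simp add: power2_eq_square ac_simps)
    then have "10 * real D * real H \<le> real j ^ 2 * real P" using n0 by simp
    then have "real (10 * D * H) \<le> real (j\<^sup>2 * P)" by simp
    then show ?thesis by (simp only: of_nat_le_iff)
  qed
  have c3: "20 * D * H \<le> P\<^sup>2"
  proof -
    have "20 * real D * real H * n0 \<le> 20 * (9 * x) * real H * n0"
      using D2 n0 by (intro mult_right_mono mult_left_mono) auto
    also have "\<dots> = (180 * real j * real H) * real P" using xn by (simp add: algebra_simps)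
    also have "\<dots> \<le> (n0 * real P) * real P" using j by (intro mult_right_mono) auto
    finally have "20 * real D * real H * n0 \<le> (real P ^ 2) * n0" by (simp add: power2_eq_square ac_simps)
    then have "20 * real D * real H \<le> real P ^ 2" using n0 by simp
    then have "real (20 * D * H) \<le> real (P\<^sup>2)" by simp
    then show ?thesis by (simp only: of_nat_le_iff)
  qed
  have c4: "18 * D ^ 4 \<le> H * P\<^sup>2"
  proof -
    have "18 * real D ^ 4 * n0 ^ 4 \<le> 18 * (9 * x) ^ 4 * n0 ^ 4"
      using D2 n0 by (intro mult_right_mono mult_left_mono power_mono) auto
    also have "\<dots> = 118098 * (x * n0) ^ 4" by (simp add: power_mult_distrib)
    also have "\<dots> = (118098 * real P ^ 2 * real j ^ 4) * real P ^ 2"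
      unfolding xn by (simp add: power_mult_distrib power_add[symmetric])
    also have "\<dots> \<le> (real H * n0 ^ 4) * real P ^ 2" using j by (intro mult_right_mono) auto
    finally have "18 * real D ^ 4 * n0 ^ 4 \<le> (real H * real P ^ 2) * n0 ^ 4" by (simp add: ac_simps)
    then have "18 * real D ^ 4 \<le> real H * real P ^ 2" using n0 by simp
    then have "real (18 * D ^ 4) \<le> real (H * P\<^sup>2)" by simp
    then show ?thesis by (simp only: of_nat_le_iff)
  qed
  have xy: "x * real H = y * real P" unfolding x_def y_def by simp
  have c5: "50 * D * H \<le> T * P"
  proof -
    have "50 * real D * real H \<le> 50 * (9 * x) * real H"
      using D2 by (intro mult_right_mono mult_left_mono) auto
    also have "\<dots> = (450 * y) * real P" using xy by simp
    also have "\<dots> \<le> real T * real P" using T1 by (intro mult_right_mono) auto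
    finally have "real (50 * D * H) \<le> real (T * P)" by simp
    then show ?thesis by (simp only: of_nat_le_iff)
  qed
  have DP: "D \<le> P" using c1 by simp
  have \<tau>': "real (card {d. d dvd q}) \<le> \<tau>" if "0 < q" "q \<le> 18 * D\<^sup>2" for q
  proof -
    have "D\<^sup>2 \<le> P\<^sup>2" using DP by (intro power_mono) auto
    then have "q \<le> 18 * P\<^sup>2" using that by linarith
    then show ?thesis using that by (intro \<tau>)
  qed
  have \<eta>': "(\<Sum>i=1..D. 1 / real i) \<le> \<eta>"
  proof -
    have "(\<Sum>i=1..D. 1 / real i) \<le> (\<Sum>i=1..P. 1 / real i)" using DP by (intro sum_mono2) auto
    then show ?thesis using \<eta> by linarith
  qed
  \<comment> \<open>Restricting to one residue class modulo \<open>j\<close> forces the points to be \<open>j\<close> apart.\<close>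
  have "\<forall>n\<in>V. \<exists>c. n0 / real j \<le> real (card {N \<in> W n. f N mod j = c})"
  proof
    fix n assume n: "n \<in> V"
    have finW: "finite (W n)" using W(1)[OF n] finite_subset by blast
    show "\<exists>c. n0 / real j \<le> real (card {N \<in> W n. f N mod j = c})"
    proof (rule ccontr)
      assume a: "\<not> ?thesis"
      have "W n = (\<Union>c<j. {N \<in> W n. f N mod j = c})" using j by auto
      then have "card (W n) = card (\<Union>c<j. {N \<in> W n. f N mod j = c})" by (rule arg_cong)
      also have "\<dots> \<le> (\<Sum>c<j. card {N \<in> W n. f N mod j = c})" by (rule card_UN_le) simp
      finally have "card (W n) \<le> (\<Sum>c<j. card {N \<in> W n. f N mod j = c})" .
      then have "real (card (W n)) \<le> (\<Sum>c<j. real (card {N \<in> W n. f N mod j = c}))"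
        unfolding of_nat_sum[symmetric] by (rule of_nat_mono)
      also have "\<dots> < (\<Sum>c<j. n0 / real j)" using a j(1) by (intro sum_strict_mono) (auto simp: not_le lessThan_empty_iff)
      also have "\<dots> = n0" using j by simp
      finally show False using W(4)[OF n] by simp
    qed
  qed
  then obtain c where c: "\<And>n. n \<in> V \<Longrightarrow> n0 / real j \<le> real (card {N \<in> W n. f N mod j = c n})"
    using bchoice[of V] by meson
  define W' where "W' n = {N \<in> W n. f N mod j = c n}" for n
  have W': "W' n \<subseteq> {n<..n + H}" "inj_on f (W' n)" "f ` W' n \<subseteq> {P<..2 * P}" "n0 / real j \<le> real (card (W' n))" if "n \<in> V" for n
    using W(1-3)[OF that] c[OF that] unfolding W'_def by (auto intro: inj_on_subset)
  obtain TT where TT: "finite TT" "inj_on fst TT" "real (card V) * (n0 / real j - 2 - 2 * real P / real D) \<le> real (card TT)"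
    "\<And>N0 N1 N2. (N0, N1, N2) \<in> TT \<Longrightarrow> \<exists>n\<in>V. N0 \<in> W' n \<and> N1 \<in> W' n \<and> N2 \<in> W' n
       \<and> f N0 < f N1 \<and> f N1 < f N2 \<and> f N2 \<le> f N0 + D"
    using square_family_triples[OF V(1,2) W', of D] D0 by auto
  have "n0 / real j \<ge> 180" using j by (simp add: pos_le_divide_eq)
  moreover have "n0 / (4 * real j) = (n0 / real j) / 4" by simp
  ultimately have "n0 / (4 * real j) \<le> n0 / real j - 2 - 2 * real P / real D" using PD by linarith
  then have "real (card V) * (n0 / (4 * real j)) \<le> real (card V) * (n0 / real j - 2 - 2 * real P / real D)"
    by (rule mult_left_mono) simp
  also have "\<dots> \<le> real (card TT)" by (rule TT(3))
  also have "\<dots> \<le> 36 * real D ^ 3 * real X / real P ^ 4 *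
      (6 * (2 * real T + 1) * \<tau> * (real P * \<eta>\<^sup>2 + real D ^ 2))
      + 36 * real X * real D ^ 6 / (real H * real P ^ 3)"
  proof (rule card_square_triples[OF j(1) D0 c1 H(1) c2 c3 c4 c5 \<tau>' \<eta>'])
    fix N0 N1 N2 assume "(N0, N1, N2) \<in> TT"
    then obtain n where n: "n \<in> V" and N: "N0 \<in> W' n" "N1 \<in> W' n" "N2 \<in> W' n"
      and ff: "f N0 < f N1" "f N1 < f N2" "f N2 \<le> f N0 + D" using TT(4) by blast
    have mem: "f N \<in> {P<..2*P}" "(f N)\<^sup>2 dvd N" "n < N" "N \<le> n + H" "f N mod j = c n" if "N \<in> W' n" for N
      using W(1,3)[OF n] f[OF n] that unfolding W'_def by auto
    have sep: "x + j \<le> y" if "x < y" "x mod j = y mod j" for x y :: nat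
    proof -
      have "j dvd y - x" using that mod_eq_dvd_iff_nat[of x y j] by simp
      then have "j \<le> y - x" using that by (intro dvd_imp_le) auto
      then show ?thesis using that by simp
    qed
    show "(\<forall>N\<in>{N0, N1, N2}. f N \<in> {P<..2*P} \<and> (f N)\<^sup>2 dvd N) \<and> 1 \<le> N1 \<and> N1 \<le> X
      \<and> \<bar>int N0 - int N1\<bar> \<le> int H \<and> \<bar>int N1 - int N2\<bar> \<le> int H
      \<and> f N0 + j \<le> f N1 \<and> f N1 + j \<le> f N2 \<and> f N1 \<le> f N0 + D \<and> f N2 \<le> f N1 + D"
      using mem[OF N(1)] mem[OF N(2)] mem[OF N(3)] ff V(3)[OF n] sep by auto
  qed auto
  also have "\<dots> \<le> 36 * (9 * x) ^ 3 * real X / real P ^ 4 * (6 * (903 * y) * \<tau> * (real P * \<eta>\<^sup>2 + real P * \<eta>\<^sup>2))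
      + 36 * real X * (9 * x) ^ 6 / (real H * real P ^ 3)"
  proof -
    \<comment> \<open>The rounding contribution \<open>D^2\<close> is dominated by the main
      contribution of size \<open>P\<close>, because \<open>P\<close> is at most \<open>n0^2\<close>
      up to a power of \<open>j\<close>.\<close>
    have "real D ^ 2 \<le> real P * \<eta>\<^sup>2"
    proof -
      have "real D ^ 2 * n0\<^sup>2 \<le> (9 * x) ^ 2 * n0\<^sup>2" using D2 by (intro mult_right_mono power_mono) auto
      also have "\<dots> = 81 * (x * n0) ^ 2" by (simp add: power_mult_distrib)
      also have "\<dots> = real P * (81 * real P * real j ^ 2)" unfolding xn by (simp add: power2_eq_square)
      also have "\<dots> \<le> real P * n0\<^sup>2" using j by (intro mult_left_mono) auto
      finally have "real D ^ 2 \<le> real P" using n0 by simp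
      also have "real P * 1 \<le> real P * \<eta>\<^sup>2" using \<eta>(1) by (intro mult_left_mono) auto
      finally show ?thesis by simp
    qed
    moreover have "6 * (2 * real T + 1) * \<tau> \<le> 6 * (903 * y) * \<tau>"
      using T2 \<tau>0 by (intro mult_right_mono) auto
    ultimately have B: "6 * (2 * real T + 1) * \<tau> * (real P * \<eta>\<^sup>2 + real D ^ 2)
        \<le> 6 * (903 * y) * \<tau> * (real P * \<eta>\<^sup>2 + real P * \<eta>\<^sup>2)"
      by (rule_tac mult_mono) (use \<tau>0 y1 in auto)
    have A: "36 * real D ^ 3 * real X / real P ^ 4 \<le> 36 * (9 * x) ^ 3 * real X / real P ^ 4"
      using D2 by (intro divide_right_mono mult_right_mono mult_left_mono power_mono) auto
    have "36 * real D ^ 3 * real X / real P ^ 4 * (6 * (2 * real T + 1) * \<tau> * (real P * \<eta>\<^sup>2 + real D ^ 2))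
        \<le> 36 * (9 * x) ^ 3 * real X / real P ^ 4 * (6 * (903 * y) * \<tau> * (real P * \<eta>\<^sup>2 + real P * \<eta>\<^sup>2))"
      by (rule mult_mono[OF A B]) (use \<tau>0 x0 in auto)
    moreover have "36 * real X * real D ^ 6 / (real H * real P ^ 3) \<le> 36 * real X * (9 * x) ^ 6 / (real H * real P ^ 3)"
      using D2 by (intro divide_right_mono mult_left_mono power_mono) auto
    ultimately show ?thesis by (rule add_mono)
  qed
  also have "\<dots> = (4 * 284379984 * real X * real H * \<tau> * \<eta>\<^sup>2 * real j ^ 5 / n0 ^ 5
      + 4 * 19131876 * real X * real P ^ 3 * real j ^ 7 / (real H * n0 ^ 7)) * (n0 / (4 * real j))"
    unfolding x_def y_def using P0 n0 j H by (simp add: field_simps eval_nat_numeral)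
  finally have le: "real (card V) * (n0 / (4 * real j)) \<le> (4 * 284379984 * real X * real H * \<tau> * \<eta>\<^sup>2 * real j ^ 5 / n0 ^ 5
      + 4 * 19131876 * real X * real P ^ 3 * real j ^ 7 / (real H * n0 ^ 7)) * (n0 / (4 * real j))" .
  have "n0 / (4 * real j) > 0" using n0 j by simp
  with le have "real (card V) \<le> 4 * 284379984 * real X * real H * \<tau> * \<eta>\<^sup>2 * real j ^ 5 / n0 ^ 5
      + 4 * 19131876 * real X * real P ^ 3 * real j ^ 7 / (real H * n0 ^ 7)"
    by (rule mult_right_le_imp_le)
  also have "\<dots> \<le> 2 * 10 ^ 9 * real X * real H * \<tau> * \<eta>\<^sup>2 * real j ^ 5 / n0 ^ 5
    + 10 ^ 8 * real X * real P ^ 3 * real j ^ 7 / (real H * n0 ^ 7)"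
    using \<tau>0 n0 by (intro add_mono divide_right_mono mult_right_mono) auto
  finally show ?thesis .
qed

section \<open>Intervals without squarefree numbers\<close>

definition sqprime :: "nat \<Rightarrow> nat" where
  "sqprime N = (SOME p. prime p \<and> p\<^sup>2 dvd N)"

lemma sqprime:
  assumes "\<not> squarefree N"
  shows "prime (sqprime N)" "(sqprime N)\<^sup>2 dvd N"
proof -
  obtain x where x: "x\<^sup>2 dvd N" "\<not> is_unit x" using assms unfolding squarefree_def by blast
  then obtain p where "prime p" "p dvd x" using prime_factor_nat[of x] by auto
  then have "prime p \<and> p\<^sup>2 dvd N" using x by (meson dvd_power_same dvd_trans)
  then have "prime (sqprime N) \<and> (sqprime N)\<^sup>2 dvd N" unfolding sqprime_def by (rule someI)
  then show "prime (sqprime N)" "(sqprime N)\<^sup>2 dvd N" by auto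
qed

section \<open>Sifting an interval by the squares of small integers\<close>

lemma card_multiples_le:
  fixes n H m :: nat
  assumes "m > 0"
  shows "real (card {N \<in> {n<..n + H}. m dvd N}) \<le> real H / real m + 1"
proof -
  have "real (card {N \<in> {n<..n + H}. m dvd N}) = real (card (int ` {N \<in> {n<..n + H}. m dvd N}))"
    by (simp add: card_image)
  also have "\<dots> \<le> real H / real_of_int (int m) + 1"
    by (rule card_congruent_le[of _ _ "int n"]) (use assms in \<open>auto intro: dvd_diff\<close>)
  finally show ?thesis by simp
qed

lemma inverse_square_telescope:
  assumes "n \<ge> 1"
  shows "1 / real (Suc n) ^ 2 \<le> 1 / real n - 1 / real (Suc n)"
proof -
  have "real n * (1 + real n) \<le> (1 + real n)\<^sup>2" by (simp add: power2_eq_square algebra_simps)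
  then have "1 / (1 + real n)\<^sup>2 \<le> 1 / (real n * (1 + real n))" using assms by (intro frac_le) auto
  also have "\<dots> = 1 / real n - 1 / real (Suc n)" using assms by (simp add: field_simps)
  finally show ?thesis by simp
qed

text \<open>The terms from 3 on telescope to at most 1/2, and the first term is 1/4.\<close>

lemma sum_inverse_squares_from_2: "(\<Sum>d=2..K. 1 / real d ^ 2) \<le> 3 / 4"
proof -
  have "(\<Sum>d=2..K. 1 / real d ^ 2) \<le> 3 / 4 - 1 / real K" if "K \<ge> 2"
    using that
  proof (induction K rule: dec_induct)
    case (step n)
    then show ?case using inverse_square_telescope[of n] by simp
  qed simp
  moreover have "1 / real K \<ge> 0" by simp
  ultimately show ?thesis by (cases "K \<ge> 2") (linarith, simp)
qed

lemma sum_inverse_squares_tail: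
  assumes "Z \<ge> 1"
  shows "(\<Sum>d=Suc Z..K. 1 / real d ^ 2) \<le> 1 / real Z"
proof -
  have "(\<Sum>d=Suc Z..K. 1 / real d ^ 2) \<le> 1 / real Z - 1 / real K" if "K \<ge> Z"
    using that
  proof (induction K rule: dec_induct)
    case (step n)
    then show ?case using inverse_square_telescope[of n] assms by simp
  qed simp
  moreover have "1 / real K \<ge> 0" by simp
  ultimately show ?thesis by (cases "K \<ge> Z") (linarith, simp)
qed

definition large_sq :: "nat \<Rightarrow> nat \<Rightarrow> nat set" where
  "large_sq H n = {N \<in> {n<..n + H}. \<forall>d\<in>{2..H div 10}. \<not> d\<^sup>2 dvd N}"

text \<open>Removing multiples of \<open>d^2\<close> for all integers \<open>d \<ge> 2\<close>, not
  just primes, still removes a proportion of at most 3/4. Each \<open>d\<close> also costs a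
  rounding error of 1; stopping at \<open>H div 10\<close> limits these to \<open>H / 10\<close>,
  and 1 - 3/4 - 1/10 = 3/20.\<close>

lemma card_large_sq: "real (card (large_sq H n)) \<ge> 3 / 20 * real H"
proof -
  let ?S = "\<lambda>d. {N \<in> {n<..n + H}. d\<^sup>2 dvd N}"
  have "real (card (\<Union>d\<in>{2..H div 10}. ?S d)) \<le> (\<Sum>d\<in>{2..H div 10}. real (card (?S d)))"
    unfolding of_nat_sum[symmetric] by (intro of_nat_mono card_UN_le) simp
  also have "\<dots> \<le> (\<Sum>d\<in>{2..H div 10}. real H * (1 / real d ^ 2) + 1)"
  proof (rule sum_mono)
    fix d assume "d \<in> {2..H div 10}"
    then show "real (card (?S d)) \<le> real H * (1 / real d ^ 2) + 1"
      using card_multiples_le[of "d\<^sup>2" n H] by simp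
  qed
  also have "\<dots> = real H * (\<Sum>d=2..H div 10. 1 / real d ^ 2) + real (card {2..H div 10})"
    by (simp only: sum.distrib sum_distrib_left sum_constant mult_1_right)
  also have "\<dots> \<le> real H * (3 / 4) + real H / 10"
  proof (rule add_mono)
    show "real H * (\<Sum>d=2..H div 10. 1 / real d ^ 2) \<le> real H * (3 / 4)"
      by (intro mult_left_mono sum_inverse_squares_from_2) simp
    have "real (card {2..H div 10}) \<le> real (H div 10)" by simp
    also have "\<dots> \<le> real H / 10" using real_of_int_div4[of "int H" 10] by linarith
    finally show "real (card {2..H div 10}) \<le> real H / 10" .
  qed
  finally have small: "real (card (\<Union>d\<in>{2..H div 10}. ?S d)) \<le> 17 / 20 * real H" by simp
  have "{n<..n + H} = large_sq H n \<union> (\<Union>d\<in>{2..H div 10}. ?S d)" unfolding large_sq_def by blast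
  then have "card {n<..n + H} \<le> card (large_sq H n) + card (\<Union>d\<in>{2..H div 10}. ?S d)"
    by (metis card_Un_le)
  then have "real H \<le> real (card (large_sq H n)) + real (card (\<Union>d\<in>{2..H div 10}. ?S d))" by simp
  then show ?thesis using small by linarith
qed

lemma sqprime_large:
  assumes "N \<in> large_sq H n" "\<not> squarefree N"
  shows "H < 10 * sqprime N"
proof (rule ccontr)
  assume "\<not> H < 10 * sqprime N"
  then have "sqprime N \<in> {2..H div 10}"
    using prime_ge_2_nat[OF sqprime(1)[OF assms(2)]] by auto
  then show False using assms(1) sqprime(2)[OF assms(2)] unfolding large_sq_def by blast
qed

text \<open>A prime above \<open>H / 10\<close> with \<open>H \<ge> 100\<close> has a square of at
  least \<open>H\<close>, so that square cannot divide two different elements of the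
  interval.\<close>

lemma sqprime_inj:
  assumes "H \<ge> 100" "\<And>N. N \<in> {n<..n + H} \<Longrightarrow> \<not> squarefree N"
  shows "inj_on sqprime (large_sq H n)"
proof (rule inj_onI, rule ccontr)
  fix N M assume NM: "N \<in> large_sq H n" "M \<in> large_sq H n" "sqprime N = sqprime M" "N \<noteq> M"
  have ns: "\<not> squarefree N" "\<not> squarefree M" using NM assms(2) unfolding large_sq_def by auto
  define p where "p = sqprime N"
  have p: "H < 10 * p" unfolding p_def by (rule sqprime_large[OF NM(1) ns(1)])
  have "int (p\<^sup>2) dvd int N" "int (p\<^sup>2) dvd int M"
    using sqprime(2)[OF ns(1)] sqprime(2)[OF ns(2)] NM(3) unfolding p_def by (simp_all only: int_dvd_int_iff)
  then have "int (p\<^sup>2) dvd int N - int M" by (rule dvd_diff)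
  then have "int (p\<^sup>2) \<le> \<bar>int N - int M\<bar>" using NM(4) by (intro zdvd_imp_le) auto
  also have "\<dots> < int H" using NM(1,2) unfolding large_sq_def by auto
  finally have "p\<^sup>2 < H" by simp
  moreover have "10 * p \<le> p * p" using p assms(1) by (intro mult_right_mono) auto
  ultimately show False using p by (simp add: power2_eq_square)
qed

lemma card_large_square_factor:
  assumes "Z \<ge> 1"
  shows "real (card {N \<in> {1..X}. \<exists>d>Z. d\<^sup>2 dvd N}) \<le> real X / real Z"
proof -
  let ?S = "\<lambda>d. {N \<in> {1..X}. d\<^sup>2 dvd N}"
  have "{N \<in> {1..X}. \<exists>d>Z. d\<^sup>2 dvd N} \<subseteq> (\<Union>d\<in>{Suc Z..X}. ?S d)"
  proof
    fix N assume "N \<in> {N \<in> {1..X}. \<exists>d>Z. d\<^sup>2 dvd N}"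
    then obtain d where d: "N \<in> {1..X}" "d > Z" "d\<^sup>2 dvd N" by blast
    have "d * 1 \<le> d * d" using d by (intro mult_left_mono) auto
    also have "\<dots> \<le> N" using d by (auto simp: power2_eq_square dest: dvd_imp_le)
    finally have "d \<le> X" using d by simp
    then show "N \<in> (\<Union>d\<in>{Suc Z..X}. ?S d)" using d by (intro UN_I[of d]) auto
  qed
  then have "card {N \<in> {1..X}. \<exists>d>Z. d\<^sup>2 dvd N} \<le> card (\<Union>d\<in>{Suc Z..X}. ?S d)"
    by (intro card_mono) auto
  also have "\<dots> \<le> (\<Sum>d\<in>{Suc Z..X}. card (?S d))" by (rule card_UN_le) simp
  finally have "real (card {N \<in> {1..X}. \<exists>d>Z. d\<^sup>2 dvd N}) \<le> (\<Sum>d\<in>{Suc Z..X}. real (card (?S d)))"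
    unfolding of_nat_sum[symmetric] by (rule of_nat_mono)
  also have "\<dots> \<le> (\<Sum>d\<in>{Suc Z..X}. real X * (1 / real d ^ 2))"
  proof (rule sum_mono)
    fix d assume "d \<in> {Suc Z..X}"
    then show "real (card (?S d)) \<le> real X * (1 / real d ^ 2)"
      using of_nat_mono[OF card_multiples_initial_le[of "d\<^sup>2" X], where 'a = real]
      by (simp add: pos_le_divide_eq mult.commute)
  qed
  also have "\<dots> \<le> real X * (1 / real Z)"
    unfolding sum_distrib_left[symmetric] by (intro mult_left_mono sum_inverse_squares_tail assms) simp
  finally show ?thesis by simp
qed

definition squareful_starts :: "nat \<Rightarrow> nat \<Rightarrow> nat set \<Rightarrow> bool" where
  "squareful_starts H X V \<longleftrightarrow> finite V \<and> (\<forall>n\<in>V. \<forall>n'\<in>V. n < n' \<longrightarrow> n + H \<le> n') \<and>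
     (\<forall>n\<in>V. n + H \<le> X \<and> (\<forall>N\<in>{n<..n + H}. \<not> squarefree N))"

lemma squareful_starts_subset: "squareful_starts H X V \<Longrightarrow> U \<subseteq> V \<Longrightarrow> squareful_starts H X U"
  unfolding squareful_starts_def by (meson finite_subset subsetD)

definition dyadic_sq :: "nat \<Rightarrow> nat \<Rightarrow> nat \<Rightarrow> nat \<Rightarrow> nat set" where
  "dyadic_sq H Z i n = {N \<in> large_sq H n. sqprime N \<le> Z \<and> 2 ^ i < sqprime N \<and> sqprime N \<le> 2 ^ Suc i}"

text \<open>Split 3/20 as 1/20 + 1/10. Either \<open>H / 20\<close> of the selected integers have a
  prime beyond \<open>Z\<close>, or one of the \<open>I\<close> dyadic ranges receives at least
  \<open>H / (10 * I)\<close> of them. In the first case the intervals are disjoint, so all these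
  integers are counted together among the at most \<open>X / Z\<close> integers up to
  \<open>X\<close> that are divisible by a square \<open>d^2\<close> with
  \<open>d > Z\<close>.\<close>

lemma squareful_starts_dyadic:
  assumes V: "squareful_starts H X V" and H: "H \<ge> 1" and Z: "1 \<le> Z" "Z \<le> 2 ^ I" "I \<ge> 1"
  shows "real (card V) \<le> 20 * real X / (real H * real Z) +
    (\<Sum>i<I. real (card {n\<in>V. real H / (10 * real I) \<le> real (card (dyadic_sq H Z i n))}))"
proof -
  have finV: "finite V" and disj: "\<And>n n'. n \<in> V \<Longrightarrow> n' \<in> V \<Longrightarrow> n < n' \<Longrightarrow> n + H \<le> n'"
    and ns: "\<And>n N. n \<in> V \<Longrightarrow> N \<in> {n<..n + H} \<Longrightarrow> \<not> squarefree N" and X: "\<And>n. n \<in> V \<Longrightarrow> n + H \<le> X"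
    using V unfolding squareful_starts_def by auto
  define B where "B n = {N \<in> large_sq H n. sqprime N > Z}" for n
  define V1 where "V1 = {n\<in>V. real H / 20 \<le> real (card (B n))}"
  define V2 where "V2 i = {n\<in>V. real H / (10 * real I) \<le> real (card (dyadic_sq H Z i n))}" for i
  have finL: "finite (large_sq H n)" for n unfolding large_sq_def by simp
  have "V \<subseteq> V1 \<union> (\<Union>i<I. V2 i)"
  proof (rule subsetI, rule ccontr)
    fix n assume n: "n \<in> V" and no: "n \<notin> V1 \<union> (\<Union>i<I. V2 i)"
    have 1: "real (card (B n)) < real H / 20" using no n unfolding V1_def by auto
    have 2: "real (card (dyadic_sq H Z i n)) < real H / (10 * real I)" if "i < I" for i
    proof -
      have "n \<notin> V2 i" using no that by blast
      then show ?thesis using n unfolding V2_def by (simp add: not_le)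
    qed
    have "large_sq H n \<subseteq> B n \<union> (\<Union>i<I. dyadic_sq H Z i n)"
    proof
      fix N assume N: "N \<in> large_sq H n"
      then have "\<not> squarefree N" using ns[OF n] unfolding large_sq_def by auto
      then have p2: "sqprime N \<ge> 2" using sqprime(1) prime_ge_2_nat by blast
      show "N \<in> B n \<union> (\<Union>i<I. dyadic_sq H Z i n)"
      proof (cases "sqprime N > Z")
        case False
        define P where "P i \<longleftrightarrow> sqprime N \<le> 2 ^ i" for i
        have PI: "P I" using False Z unfolding P_def by linarith
        define k where "k = (LEAST i. P i)"
        have Pk: "P k" unfolding k_def using PI by (rule LeastI)
        have kI: "k \<le> I" unfolding k_def using PI by (rule Least_le)
        have "k \<noteq> 0" using Pk p2 unfolding P_def by (intro notI) simp
        then obtain i where i: "k = Suc i" using not0_implies_Suc by blast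
        have "\<not> P i" using not_less_Least[of i P] i unfolding k_def by simp
        then have "N \<in> dyadic_sq H Z i n"
          using N False Pk i unfolding P_def dyadic_sq_def by simp
        then show ?thesis using i kI by auto
      qed (use N in \<open>simp add: B_def\<close>)
    qed
    then have "card (large_sq H n) \<le> card (B n \<union> (\<Union>i<I. dyadic_sq H Z i n))"
      using finL by (intro card_mono) (auto simp: B_def dyadic_sq_def)
    also have "\<dots> \<le> card (B n) + card (\<Union>i<I. dyadic_sq H Z i n)" by (rule card_Un_le)
    also have "card (\<Union>i<I. dyadic_sq H Z i n) \<le> (\<Sum>i<I. card (dyadic_sq H Z i n))" by (rule card_UN_le) simp
    finally have "real (card (large_sq H n)) \<le> real (card (B n)) + (\<Sum>i<I. real (card (dyadic_sq H Z i n)))"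
      unfolding of_nat_sum[symmetric] of_nat_add[symmetric] by (intro of_nat_mono) simp
    also have "(\<Sum>i<I. real (card (dyadic_sq H Z i n))) \<le> (\<Sum>i<I. real H / (10 * real I))"
      by (intro sum_mono less_imp_le 2) simp
    also have "\<dots> = real H / 10" using Z by simp
    finally show False using 1 card_large_sq[of H n] by simp
  qed
  then have "card V \<le> card (V1 \<union> (\<Union>i<I. V2 i))"
    using finV by (intro card_mono) (auto simp: V1_def V2_def)
  also have "\<dots> \<le> card V1 + card (\<Union>i<I. V2 i)" by (rule card_Un_le)
  also have "card (\<Union>i<I. V2 i) \<le> (\<Sum>i<I. card (V2 i))" by (rule card_UN_le) simp
  finally have le: "real (card V) \<le> real (card V1) + (\<Sum>i<I. real (card (V2 i)))"
    unfolding of_nat_sum[symmetric] of_nat_add[symmetric] by (intro of_nat_mono) simp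
  have "real (card V1) * (real H / 20) = (\<Sum>n\<in>V1. real H / 20)" by simp
  also have "\<dots> \<le> (\<Sum>n\<in>V1. real (card (B n)))" by (intro sum_mono) (simp add: V1_def)
  also have "\<dots> = real (card (\<Union>n\<in>V1. B n))"
  proof -
    have "B n \<inter> B n' = {}" if "n \<in> V1" "n' \<in> V1" "n \<noteq> n'" for n n'
    proof -
      have "n + H \<le> n' \<or> n' + H \<le> n" using disj that unfolding V1_def by (metis (mono_tags, lifting) linorder_neqE_nat mem_Collect_eq)
      then show ?thesis unfolding B_def large_sq_def by auto
    qed
    then have "card (\<Union>n\<in>V1. B n) = (\<Sum>n\<in>V1. card (B n))"
      using finV finL by (intro card_UN_disjoint) (auto simp: V1_def B_def)
    then show ?thesis by simp
  qed
  also have "\<dots> \<le> real (card {N \<in> {1..X}. \<exists>d>Z. d\<^sup>2 dvd N})"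
  proof (intro of_nat_mono card_mono)
    show "(\<Union>n\<in>V1. B n) \<subseteq> {N \<in> {1..X}. \<exists>d>Z. d\<^sup>2 dvd N}"
    proof
      fix N assume "N \<in> (\<Union>n\<in>V1. B n)"
      then obtain n where n: "n \<in> V" "N \<in> {n<..n + H}" "sqprime N > Z"
        unfolding V1_def B_def large_sq_def by auto
      then show "N \<in> {N \<in> {1..X}. \<exists>d>Z. d\<^sup>2 dvd N}"
        using X[OF n(1)] sqprime(2)[OF ns[OF n(1,2)]] by auto
    qed
  qed simp
  also have "\<dots> \<le> real X / real Z" by (rule card_large_square_factor[OF Z(1)])
  finally have "real (card V1) \<le> 20 * real X / (real H * real Z)" using H Z by (simp add: field_simps)
  then show ?thesis using le unfolding V2_def by linarith
qed

section \<open>Choice of the parameters and the bound for squareful intervals\<close>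

lemma harmonic_le_ln:
  assumes "n > 0"
  shows "(\<Sum>i=1..n. 1 / real i) \<le> 1 + ln (real n)"
proof -
  have "harm (Suc (n - 1)) - ln (real (Suc (n - 1))) \<le> harm (Suc 0) - ln (real (Suc 0))"
    by (rule decseqD[OF decseq_harm_diff_ln]) simp
  then show ?thesis using assms by (simp add: harm_def inverse_eq_divide)
qed

text \<open>The size conditions of the pair and triple counts for \<open>x = H\<close>, taken at the
  extreme values \<open>n0 = x powr 0.999\<close>, \<open>j = 91 * x powr 0.001\<close>, and
  \<open>P\<close> equal to \<open>x / 20\<close> or \<open>x powr 1.39\<close>. The first condition
  controls the number of dyadic ranges, the last two the harmonic sum and the arguments of the
  divisor function.\<close>

definition large_enough :: "real \<Rightarrow> bool" where
  "large_enough x \<longleftrightarrow>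
    10 * (2.8 * log 2 x + 3) \<le> x powr 0.001 \<and> 10 \<le> x powr 0.999 \<and> 20 * x \<le> x powr 1.39
    \<and> 180 * (91 * x powr 0.001) \<le> x powr 0.999
    \<and> 180 * (91 * x powr 0.001) * x \<le> x powr 0.999 * (x / 20)
    \<and> 118098 * (x powr 1.39) ^ 2 * (91 * x powr 0.001) ^ 4 \<le> x * (x powr 0.999) ^ 4
    \<and> 81 * (x powr 1.39) * (91 * x powr 0.001) ^ 2 \<le> (x powr 0.999) ^ 2
    \<and> 1 + ln (x powr 1.39) \<le> x powr 0.001 \<and> 18 * (x powr 1.39) ^ 2 \<le> 8 * x powr 8.4"

lemma eventually_large_enough:
  obtains x0 where "x0 \<ge> 100" "\<And>x. x \<ge> x0 \<Longrightarrow> large_enough x"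
proof -
  have "\<forall>\<^sub>F x in at_top. large_enough x"
    unfolding large_enough_def by (intro eventually_conj; real_asymp)
  then obtain N where "\<And>x. x \<ge> N \<Longrightarrow> large_enough x" unfolding eventually_at_top_linorder by blast
  then show ?thesis by (intro that[of "max N 100"]) auto
qed

lemma squareful_starts_bound:
  obtains C :: real where "C > 0"
    "\<And>H X V. H \<ge> 1 \<Longrightarrow> squareful_starts H X V \<Longrightarrow> real (card V) \<le> C * real X * real H powr (-3.76)"
proof -
  obtain x0 where x0: "x0 \<ge> 100" and asy: "\<And>x. x \<ge> x0 \<Longrightarrow> large_enough x"
    by (rule eventually_large_enough) blast
  \<comment> \<open>The divisor function is evaluated at arguments up to
    \<open>8 * x powr 8.4\<close>, where 8.4 is three times 2.8 on account of the cube
    \<open>a ^ 3\<close>. Since 8.4 / 9000 is below 0.001, the cost is a constant times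
    \<open>L\<close>.\<close>
  obtain K :: real where K: "K \<ge> 1" "\<And>n::nat. n > 0 \<Longrightarrow> real (card {d. d dvd n}) \<le> K * real n powr (1 / 9000)"
    by (rule card_divisors_le_powr[of "1 / 9000"]) auto
  define c where "c = 52488 + 1152 * K + 16 * 10 ^ 9 * 91 ^ 5 * K + 10 ^ 8 * 91 ^ 7"
  have c0: "c > 0" unfolding c_def using K by simp
  show ?thesis
  \<comment> \<open>The summand \<open>x0 powr 3.76\<close> settles \<open>H < x0\<close>, where the
    trivial bound \<open>card V \<le> X\<close> is enough.\<close>
  proof (rule that[of "20 + c + x0 powr 3.76"])
    show "20 + c + x0 powr 3.76 > 0" using c0 by (simp add: add_pos_nonneg)
    fix H X :: nat and V assume H: "H \<ge> 1" and V: "squareful_starts H X V"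
    define x where "x = real H"
    have xpos: "x \<ge> 1" unfolding x_def using H by simp
    show "real (card V) \<le> (20 + c + x0 powr 3.76) * real X * real H powr (-3.76)"
    proof (cases "x < x0")
      case True
      have "V \<subseteq> {..<X}" using V H unfolding squareful_starts_def by force
      then have "card V \<le> X" using card_mono[of "{..<X}" V] by simp
      moreover have "1 \<le> x0 powr 3.76 * x powr (-3.76)"
      proof -
        have "x powr 3.76 \<le> x0 powr 3.76" using True xpos by (intro powr_mono2) auto
        then show ?thesis using xpos by (simp add: powr_minus field_simps)
      qed
      ultimately have "real (card V) \<le> x0 powr 3.76 * x powr (-3.76) * real X"
        using mult_right_mono[of 1 "x0 powr 3.76 * x powr (-3.76)" "real X"] by simp
      also have "\<dots> \<le> (20 + c + x0 powr 3.76) * x powr (-3.76) * real X"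
        using c0 by (intro mult_right_mono) auto
      finally show ?thesis unfolding x_def by (simp only: ac_simps)
    next
      case False
      then have xx: "x \<ge> x0" by simp
      note A = asy[OF xx, unfolded large_enough_def]
      \<comment> \<open>One small power absorbs every loss: \<open>n0\<close> is
        \<open>x / L\<close>, and the number of ranges, the harmonic sum, the divisor bound and
        \<open>j\<close> are all at most constant multiples of \<open>L\<close>.\<close>
      define L where "L = x powr 0.001"
      have L1: "L \<ge> 1" unfolding L_def using xpos by (simp add: ge_one_powr_ge_zero)
      have n0L: "x powr 0.999 = x / L" 
      proof -
        have "x powr 0.999 = x powr (1 - 0.001)" by simp
        also have "\<dots> = x powr 1 / x powr 0.001" by (rule powr_diff)
        finally show ?thesis unfolding L_def using xpos by simp
      qed
      \<comment> \<open>The value of \<open>1 / (x * P^2)\<close> at \<open>P = x powr 1.39\<close>.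
        It dominates the other contributions, whose exponents are -3.8, -3.83 and -4.\<close>
      define w where "w = x powr (-3.78)"
      have w0: "w > 0" unfolding w_def using xpos by simp
      have Lpow: "L ^ m \<le> L ^ 14" if "m \<le> 14" for m using L1 that by (intro power_increasing)
      define Z where "Z = nat \<lceil>x powr 2.8\<rceil>"
      define I where "I = nat \<lceil>2.8 * log 2 x\<rceil> + 1"
      have lg: "log 2 x \<ge> 0" using xpos by simp
      have xp1: "x powr 2.8 \<ge> 1" using xpos by (simp add: ge_one_powr_ge_zero)
      have Z1: "x powr 2.8 \<le> real Z" unfolding Z_def by linarith
      have Zge: "1 \<le> Z" using Z1 xp1 by linarith
      have ZI: "Z \<le> 2 ^ I"
      proof -
        have "x powr 2.8 = (2 powr log 2 x) powr 2.8" using xpos by simp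
        also have "\<dots> = 2 powr (2.8 * log 2 x)" by (simp only: powr_powr mult.commute)
        also have "\<dots> \<le> 2 powr (real (nat \<lceil>2.8 * log 2 x\<rceil>))" by (intro powr_mono) linarith+
        also have "\<dots> = real (2 ^ nat \<lceil>2.8 * log 2 x\<rceil>)" by (simp add: powr_realpow)
        finally have "Z \<le> 2 ^ nat \<lceil>2.8 * log 2 x\<rceil>" unfolding Z_def by linarith
        then show ?thesis unfolding I_def by (simp add: power_add)
      qed
      have IL: "10 * real I \<le> L"
      proof -
        have "real I \<le> 2.8 * log 2 x + 2" unfolding I_def using lg by linarith
        then have "10 * real I \<le> 10 * (2.8 * log 2 x + 3)" by simp
        also have "\<dots> \<le> L" using A unfolding L_def by blast
        finally show ?thesis .
      qed
      have I1: "I \<ge> 1" unfolding I_def by simp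
      have n0I: "x / L \<le> real H / (10 * real I)" unfolding x_def[symmetric] using IL I1 xpos L1 by (intro divide_left_mono) auto
      define \<tau> where "\<tau> = 8 * K * L"
      have \<tau>: "real (card {d. d dvd q}) \<le> \<tau>" if "q > 0" "real q \<le> 8 * x powr 8.4" for q :: nat
      proof -
        have "real q powr (1 / 9000) \<le> (8 * x powr 8.4) powr (1 / 9000)" using that by (intro powr_mono2) auto
        also have "\<dots> = 8 powr (1 / 9000) * x powr (8.4 / 9000)" by (simp add: powr_mult powr_powr)
        also have "\<dots> \<le> 8 powr 1 * x powr 0.001" using xpos by (intro mult_mono powr_mono) auto
        finally have "real q powr (1 / 9000) \<le> 8 * L" unfolding L_def by simp
        then have "K * real q powr (1 / 9000) \<le> K * (8 * L)" using K by (intro mult_left_mono) auto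
        then show ?thesis using K(2)[OF that(1)] unfolding \<tau>_def by simp
      qed
      define U where "U i = {n\<in>V. real H / (10 * real I) \<le> real (card (dyadic_sq H Z i n))}" for i
      have Ubound: "real (card (U i)) \<le> c * real X * L ^ 14 * w" for i
      proof (cases "U i = {}")
        case True
        then show ?thesis using c0 L1 w0 by simp
      next
        case False
        then obtain n where n: "n \<in> U i" by blast
        have "real H / (10 * real I) > 0" using H I1 by simp
        then have "card (dyadic_sq H Z i n) > 0" using n unfolding U_def by (auto intro: Nat.gr0I)
        then obtain N where N: "N \<in> dyadic_sq H Z i n" by (metis card.empty ex_in_conv less_irrefl)
        have VU: "squareful_starts H X (U i)" by (rule squareful_starts_subset[OF V]) (auto simp: U_def)
        then have sf: "finite (U i)" "\<And>n n'. n \<in> U i \<Longrightarrow> n' \<in> U i \<Longrightarrow> n < n' \<Longrightarrow> n + H \<le> n'"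
          "\<And>n. n \<in> U i \<Longrightarrow> n + H \<le> X" "\<And>n N. n \<in> U i \<Longrightarrow> N \<in> {n<..n + H} \<Longrightarrow> \<not> squarefree N"
          unfolding squareful_starts_def by auto
        define P :: nat where "P = 2 ^ i"
        have Nn: "\<not> squarefree N" "N \<in> large_sq H n" using N sf(4)[OF n] unfolding dyadic_sq_def large_sq_def by auto
        have Pp: "P < sqprime N" "sqprime N \<le> 2 * P" "sqprime N \<le> Z" using N unfolding dyadic_sq_def P_def by auto
        \<comment> \<open>A single member of a nonempty class shows \<open>H < 20 * P\<close>; the
          cutoff \<open>Z\<close> supplies the upper bound for \<open>P\<close>.\<close>
        have Px: "x / 20 \<le> real P"
        proof -
          have "H < 20 * P" using sqprime_large[OF Nn(2,1)] Pp by linarith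
          then show ?thesis unfolding x_def by simp
        qed
        have PZ: "real P \<le> x powr 2.8" using Pp unfolding Z_def by linarith
        have P0: "P > 0" unfolding P_def by simp
        have W: "\<And>n. n \<in> U i \<Longrightarrow> dyadic_sq H Z i n \<subseteq> {n<..n + H}"
          "\<And>n. n \<in> U i \<Longrightarrow> inj_on sqprime (dyadic_sq H Z i n)"
          "\<And>n. n \<in> U i \<Longrightarrow> sqprime ` dyadic_sq H Z i n \<subseteq> {P<..2 * P}"
          "\<And>n. n \<in> U i \<Longrightarrow> x / L \<le> real (card (dyadic_sq H Z i n))"
        proof -
          fix n assume n: "n \<in> U i"
          show "dyadic_sq H Z i n \<subseteq> {n<..n + H}" unfolding dyadic_sq_def large_sq_def by auto
          have "inj_on sqprime (large_sq H n)" using xx x0 sf(4)[OF n] unfolding x_def by (intro sqprime_inj) auto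
          then show "inj_on sqprime (dyadic_sq H Z i n)" by (rule inj_on_subset) (auto simp: dyadic_sq_def)
          show "sqprime ` dyadic_sq H Z i n \<subseteq> {P<..2 * P}" unfolding dyadic_sq_def P_def by auto
          show "x / L \<le> real (card (dyadic_sq H Z i n))" using n n0I unfolding U_def by auto
        qed
        have f: "prime (sqprime N) \<and> (sqprime N)\<^sup>2 dvd N" if "n \<in> U i" "N \<in> dyadic_sq H Z i n" for n N
          using sqprime sf(4)[OF that(1)] W(1)[OF that(1)] that(2) by blast
        have x4: "1 / x ^ 4 \<le> w"
        proof -
          have "1 / x ^ 4 = x powr (-4)" using xpos by (simp add: powr_minus powr_numeral inverse_eq_divide)
          also have "\<dots> \<le> w" unfolding w_def using xpos by (intro powr_mono) auto
          finally show ?thesis .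
        qed
        show ?thesis
        proof (cases "x powr 1.39 \<le> real P")
          case True
          have "real (card (U i)) \<le> 52488 * real X * real H / (x / L) ^ 5 + 144 * real X * real H * \<tau> / ((x / L)\<^sup>2 * real P ^ 2)"
          proof (rule card_family_pairs[OF sf(1-3) W f])
            show "10 \<le> x / L" using A n0L by simp
            have "20 * real H \<le> real P" using A True unfolding x_def by linarith
            then show "20 * H \<le> P" by linarith
            fix a :: nat assume a: "0 < a" "a \<le> P"
            have "real (a ^ 3) \<le> (x powr 2.8) ^ 3" unfolding of_nat_power using a PZ by (intro power_mono) auto
            also have "\<dots> = x powr 8.4" using xpos by (simp add: powr_power)
            also have "\<dots> \<le> 8 * x powr 8.4" by simp
            finally show "real (card {d. d dvd a ^ 3}) \<le> \<tau>" using a by (intro \<tau>) auto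
          qed
          also have "52488 * real X * real H / (x / L) ^ 5 = 52488 * real X * (L ^ 5 * (1 / x ^ 4))"
            unfolding x_def[symmetric] using xpos L1 by (simp add: field_simps eval_nat_numeral)
          also have "\<dots> \<le> 52488 * real X * (L ^ 14 * w)"
            using x4 Lpow[of 5] L1 by (intro mult_left_mono mult_mono) auto
          also have "144 * real X * real H * \<tau> / ((x / L)\<^sup>2 * real P ^ 2) = 1152 * K * real X * (L ^ 3 * (1 / (x * real P ^ 2)))"
            unfolding x_def[symmetric] \<tau>_def using xpos L1 P0 by (simp add: field_simps eval_nat_numeral)
          also have "\<dots> \<le> 1152 * K * real X * (L ^ 14 * w)"
          proof -
            have "1 / (x * real P ^ 2) \<le> 1 / (x * (x powr 1.39) ^ 2)"
              using True xpos P0 by (intro divide_left_mono mult_left_mono power_mono) auto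
            also have "\<dots> = 1 / (x powr 1 * x powr 2.78)" using xpos by (simp add: powr_power)
            also have "\<dots> = w" unfolding w_def powr_add[symmetric] using xpos by (simp add: powr_minus_divide)
            finally have "L ^ 3 * (1 / (x * real P ^ 2)) \<le> L ^ 14 * w" using Lpow[of 3] L1 xpos by (intro mult_mono) auto
            then show ?thesis using K by (intro mult_left_mono) auto
          qed
          finally have "real (card (U i)) \<le> (52488 + 1152 * K) * (real X * L ^ 14 * w)" by (simp add: algebra_simps)
          also have "\<dots> \<le> c * (real X * L ^ 14 * w)" unfolding c_def using K L1 w0 by (intro mult_right_mono) auto
          finally show ?thesis by (simp only: ac_simps)
        next
          case False
          \<comment> \<open>Just large enough for \<open>90 * H \<le> j * n0\<close> when
            \<open>n0 = x / L\<close>.\<close>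
          define j where "j = nat \<lceil>90 * L\<rceil>"
          have j: "90 * L \<le> real j" "real j \<le> 91 * L" unfolding j_def using L1 by linarith+
          have PP: "real P \<le> x powr 1.39" using False by simp
          have nx: "x / L > 0" using xpos L1 by simp
          have "real (card (U i)) \<le> 2 * 10 ^ 9 * real X * real H * \<tau> * L\<^sup>2 * real j ^ 5 / (x / L) ^ 5
            + 10 ^ 8 * real X * real P ^ 3 * real j ^ 7 / (real H * (x / L) ^ 7)"
          proof (rule card_family_triples[OF sf(1-3) W])
            show "(sqprime N)\<^sup>2 dvd N" if "n \<in> U i" "N \<in> dyadic_sq H Z i n" for n N using f[OF that] by blast
            show "1 \<le> j" using j L1 by linarith
            show "180 * real j \<le> x / L" using A j unfolding n0L L_def[symmetric] by linarith
            show "90 * real H \<le> real j * (x / L)"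
            proof -
              have "90 * L * (x / L) \<le> real j * (x / L)" using j nx by (intro mult_right_mono) auto
              then show ?thesis unfolding x_def[symmetric] using L1 by simp
            qed
            show "180 * real j * real H \<le> x / L * real P"
            proof -
              have "180 * real j * real H \<le> 180 * (91 * L) * x" unfolding x_def using j by (intro mult_right_mono) auto
              also have "\<dots> \<le> x / L * (x / 20)" using A unfolding n0L L_def[symmetric] by blast
              also have "\<dots> \<le> x / L * real P" using Px nx by (intro mult_left_mono) auto
              finally show ?thesis .
            qed
            show "118098 * real P ^ 2 * real j ^ 4 \<le> real H * (x / L) ^ 4"
            proof -
              have "118098 * real P ^ 2 * real j ^ 4 \<le> 118098 * (x powr 1.39) ^ 2 * (91 * L) ^ 4"
                using PP j by (intro mult_mono power_mono) auto
              also have "\<dots> \<le> x * (x / L) ^ 4" using A unfolding n0L L_def[symmetric] by blast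
              finally show ?thesis unfolding x_def .
            qed
            show "81 * real P * real j ^ 2 \<le> (x / L)\<^sup>2"
            proof -
              have "81 * real P * real j ^ 2 \<le> 81 * (x powr 1.39) * (91 * L) ^ 2"
                using PP j by (intro mult_mono power_mono) auto
              also have "\<dots> \<le> (x / L)\<^sup>2" using A unfolding n0L L_def[symmetric] by blast
              finally show ?thesis .
            qed
            show "1 \<le> H" by fact
            show "x / L \<le> real H" unfolding x_def[symmetric] using L1 xpos by (simp add: pos_divide_le_eq)
            show "1 \<le> L" by fact
            show "(\<Sum>i=1..P. 1 / real i) \<le> L"
            proof -
              have "(\<Sum>i=1..P. 1 / real i) \<le> 1 + ln (real P)" by (rule harmonic_le_ln[OF P0])
              also have "\<dots> \<le> 1 + ln (x powr 1.39)" 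
                using PP P0 xpos by (intro add_left_mono ln_le_cancel_iff[THEN iffD2]) auto
              also have "\<dots> \<le> L" using A unfolding L_def by blast
              finally show ?thesis .
            qed
            fix q :: nat assume q: "0 < q" "q \<le> 18 * P\<^sup>2"
            have "real q \<le> 18 * real P ^ 2" using of_nat_mono[OF q(2), where 'a = real] by simp
            also have "\<dots> \<le> 18 * (x powr 1.39) ^ 2" using PP by (intro mult_left_mono power_mono) auto
            also have "\<dots> \<le> 8 * x powr 8.4" using A by blast
            finally show "real (card {d. d dvd q}) \<le> \<tau>" by (intro \<tau> q)
          qed
          also have "\<dots> \<le> 2 * 10 ^ 9 * real X * real H * \<tau> * L\<^sup>2 * (91 * L) ^ 5 / (x / L) ^ 5
            + 10 ^ 8 * real X * (x powr 1.39) ^ 3 * (91 * L) ^ 7 / (real H * (x / L) ^ 7)"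
          proof (rule add_mono)
            show "2 * 10 ^ 9 * real X * real H * \<tau> * L\<^sup>2 * real j ^ 5 / (x / L) ^ 5
              \<le> 2 * 10 ^ 9 * real X * real H * \<tau> * L\<^sup>2 * (91 * L) ^ 5 / (x / L) ^ 5"
              using j nx K L1 by (intro divide_right_mono mult_left_mono power_mono) (auto simp: \<tau>_def)
            have "real P ^ 3 * real j ^ 7 \<le> (x powr 1.39) ^ 3 * (91 * L) ^ 7"
              using PP j by (intro mult_mono power_mono) auto
            then have "10 ^ 8 * real X * (real P ^ 3 * real j ^ 7) / (real H * (x / L) ^ 7)
              \<le> 10 ^ 8 * real X * ((x powr 1.39) ^ 3 * (91 * L) ^ 7) / (real H * (x / L) ^ 7)"
              using nx by (intro divide_right_mono mult_left_mono) auto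
            then show "10 ^ 8 * real X * real P ^ 3 * real j ^ 7 / (real H * (x / L) ^ 7)
              \<le> 10 ^ 8 * real X * (x powr 1.39) ^ 3 * (91 * L) ^ 7 / (real H * (x / L) ^ 7)"
              by (simp only: mult.assoc)
          qed
          also have "2 * 10 ^ 9 * real X * real H * \<tau> * L\<^sup>2 * (91 * L) ^ 5 / (x / L) ^ 5
              = 16 * 10 ^ 9 * 91 ^ 5 * K * real X * (L ^ 13 * (1 / x ^ 4))"
            unfolding x_def[symmetric] \<tau>_def using xpos L1 by (simp add: field_simps eval_nat_numeral)
          also have "\<dots> \<le> 16 * 10 ^ 9 * 91 ^ 5 * K * real X * (L ^ 14 * w)"
            using x4 Lpow[of 13] L1 K by (intro mult_left_mono mult_mono) auto
          also have "10 ^ 8 * real X * (x powr 1.39) ^ 3 * (91 * L) ^ 7 / (real H * (x / L) ^ 7)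
              = 10 ^ 8 * 91 ^ 7 * real X * (L ^ 14 * ((x powr 1.39) ^ 3 / x ^ 8))"
          proof -
            have "(91 * L) ^ 7 / (x / L) ^ 7 = 91 ^ 7 * (L ^ 14 / x ^ 7)"
              using xpos L1 by (simp add: power_mult_distrib power_divide power_add[symmetric])
            moreover have "x ^ 8 = x * x ^ 7" by (simp add: power_Suc[symmetric])
            ultimately show ?thesis unfolding x_def[symmetric]
              by (simp add: divide_simps)
          qed
          also have "\<dots> \<le> 10 ^ 8 * 91 ^ 7 * real X * (L ^ 14 * w)"
          proof -
            have "(x powr 1.39) ^ 3 / x ^ 8 = x powr 4.17 / x powr 8"
              using xpos by (simp add: powr_power powr_numeral)
            also have "\<dots> = x powr (-3.83)" by (simp add: powr_diff[symmetric])
            also have "\<dots> \<le> w" unfolding w_def using xpos by (intro powr_mono) auto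
            finally show ?thesis using L1 by (intro mult_left_mono) auto
          qed
          finally have "real (card (U i)) \<le> (16 * 10 ^ 9 * 91 ^ 5 * K + 10 ^ 8 * 91 ^ 7) * (real X * L ^ 14 * w)"
            by (simp add: algebra_simps)
          also have "\<dots> \<le> c * (real X * L ^ 14 * w)" unfolding c_def using K L1 w0 by (intro mult_right_mono) auto
          finally show ?thesis by (simp only: ac_simps)
        qed
      qed
      have "real (card V) \<le> 20 * real X / (real H * real Z) + (\<Sum>i<I. real (card (U i)))"
        unfolding U_def by (rule squareful_starts_dyadic[OF V H Zge ZI I1])
      also have "(\<Sum>i<I. real (card (U i))) \<le> (\<Sum>i<I. c * real X * L ^ 14 * w)" by (intro sum_mono Ubound)
      also have "\<dots> = real I * (c * real X * L ^ 14 * w)" by simp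
      also have "\<dots> \<le> L * (c * real X * L ^ 14 * w)" using IL c0 L1 w0 by (intro mult_right_mono) auto
      also have "20 * real X / (real H * real Z) \<le> 20 * real X * (L ^ 15 * w)"
      proof -
        have "1 / (real H * real Z) \<le> 1 / (x powr 1 * x powr 2.8)"
          unfolding x_def[symmetric] using Z1 xpos by (intro frac_le mult_mono) auto
        also have "\<dots> = x powr (-3.8)" unfolding powr_add[symmetric] by (simp add: powr_minus_divide)
        also have "\<dots> \<le> w" unfolding w_def using xpos by (intro powr_mono) auto
        also have "\<dots> \<le> L ^ 15 * w" using L1 w0 by simp
        finally have "20 * real X * (1 / (real H * real Z)) \<le> 20 * real X * (L ^ 15 * w)"
          by (intro mult_left_mono) auto
        then show ?thesis by simp
      qed
      finally have "real (card V) \<le> 20 * real X * (L ^ 15 * w) + L * (c * real X * L ^ 14 * w)" by simp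
      also have "L * (c * real X * L ^ 14 * w) = c * real X * (L ^ 15 * w)" by (simp add: eval_nat_numeral)
      finally have "real (card V) \<le> (20 + c) * real X * (L ^ 15 * w)" by (simp add: algebra_simps)
      \<comment> \<open>Fourteen factors \<open>L\<close> come from the worst dyadic range and one
        from the number of ranges; 0.015 - 3.78 = -3.765.\<close>
      also have "L ^ 15 * w \<le> x powr (-3.76)"
      proof -
        have "L ^ 15 * w = x powr 0.015 * x powr (-3.78)" unfolding L_def w_def using xpos by (simp add: powr_power)
        also have "\<dots> = x powr (-3.765)" unfolding powr_add[symmetric] by simp
        also have "\<dots> \<le> x powr (-3.76)" using xpos by (intro powr_mono) auto
        finally show ?thesis .
      qed
      also have "(20 + c) * real X * x powr (-3.76) \<le> (20 + c + x0 powr 3.76) * real X * x powr (-3.76)"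
        by (intro mult_right_mono) auto
      finally show ?thesis unfolding x_def using c0 by (simp add: mult_left_mono)
    qed
  qed
qed

section \<open>Gap densities and moments\<close>

lemma sqf_seq_squarefree:
  assumes "k \<ge> 1"
  shows "sqf_seq k > 0" "squarefree (sqf_seq k)"
  using sqf_seq_image assms by auto

lemma sqf_seq_less_iff:
  assumes "1 \<le> j" "1 \<le> k"
  shows "sqf_seq j < sqf_seq k \<longleftrightarrow> j < k"
proof
  assume "sqf_seq j < sqf_seq k"
  then show "j < k" using sqf_seq_less[of k j] assms by (metis less_asym linorder_neqE_nat)
qed (use sqf_seq_less assms in blast)

lemma sqf_seq_between:
  assumes "k \<ge> 1" "sqf_seq k < m" "m < sqf_seq (k + 1)"
  shows "\<not> squarefree m"
proof
  assume "squarefree m"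
  then have "m \<in> sqf_seq ` {1..}" unfolding sqf_seq_image using assms by simp
  then obtain j where j: "j \<ge> 1" "m = sqf_seq j" by auto
  then have "k < j" "j < k + 1" using assms sqf_seq_less_iff[of k j] sqf_seq_less_iff[of j "k + 1"] by auto
  then show False by simp
qed

text \<open>A gap as a local condition on its left end, independent of the enumeration, so that it
  can be compared with a periodic set.\<close>

definition gap_starts :: "nat \<Rightarrow> nat set" where
  "gap_starts h = {n. n > 0 \<and> squarefree n \<and> squarefree (n + h) \<and> (\<forall>i\<in>{1..<h}. \<not> squarefree (n + i))}"

lemma sqf_gap_eq_iff: "sqf_gap k = real h \<longleftrightarrow> sqf_seq (k + 1) = sqf_seq k + h"
  unfolding sqf_gap_def by linarith

definition gap_indices :: "nat \<Rightarrow> real \<Rightarrow> nat set" where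
  "gap_indices h x = {k. k \<ge> 1 \<and> real (sqf_seq (k + 1)) \<le> x \<and> sqf_gap k = real h}"

lemma finite_gap_indices: "finite (gap_indices h x)"
  by (rule finite_subset[OF _ finite_sqf_seq_le[of x]]) (auto simp: gap_indices_def)

lemma bij_betw_gap_starts:
  assumes "h \<ge> 1"
  shows "bij_betw sqf_seq (gap_indices h x) {n \<in> gap_starts h. real (n + h) \<le> x}"
  unfolding bij_betw_def
proof
  show "inj_on sqf_seq (gap_indices h x)"
  proof (rule inj_onI)
    fix j k assume "j \<in> gap_indices h x"
      "k \<in> gap_indices h x" "sqf_seq j = sqf_seq k"
    then show "j = k"
      using sqf_seq_less_iff[of j k] sqf_seq_less_iff[of k j] by (auto simp: gap_indices_def)
  qed
  show "sqf_seq ` gap_indices h x = {n \<in> gap_starts h. real (n + h) \<le> x}"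
  proof (intro equalityI subsetI)
    fix n assume "n \<in> sqf_seq ` gap_indices h x"
    then obtain k where k: "k \<ge> 1" "real (sqf_seq (k + 1)) \<le> x" "sqf_seq (k + 1) = n + h" "n = sqf_seq k"
      by (auto simp: gap_indices_def sqf_gap_eq_iff)
    have "\<not> squarefree (n + i)" if "i \<in> {1..<h}" for i
      using that k by (intro sqf_seq_between[OF k(1)]) auto
    moreover have "squarefree (n + h)" using sqf_seq_squarefree[of "k + 1"] k by simp
    ultimately show "n \<in> {n \<in> gap_starts h. real (n + h) \<le> x}"
      using k sqf_seq_squarefree[OF k(1)] unfolding gap_starts_def by auto
  next
    fix n assume n: "n \<in> {n \<in> gap_starts h. real (n + h) \<le> x}"
    then have "n \<in> sqf_seq ` {1..}" "n + h \<in> sqf_seq ` {1..}" unfolding sqf_seq_image gap_starts_def by auto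
    then obtain k j where k: "k \<ge> 1" "n = sqf_seq k" and j: "j \<ge> 1" "n + h = sqf_seq j" by auto
    have kj: "k < j" using sqf_seq_less_iff[OF k(1) j(1)] k j assms by simp
    have "j = k + 1"
    proof (rule ccontr)
      assume "j \<noteq> k + 1"
      then have "sqf_seq k < sqf_seq (k + 1)" "sqf_seq (k + 1) < sqf_seq j"
        using kj k by (auto intro!: sqf_seq_less)
      then have "sqf_seq (k + 1) - n \<in> {1..<h}" "sqf_seq (k + 1) = n + (sqf_seq (k + 1) - n)"
        using k j by auto
      then have "\<not> squarefree (sqf_seq (k + 1))" using n unfolding gap_starts_def by (metis (mono_tags, lifting) mem_Collect_eq)
      then show False using sqf_seq_squarefree[of "k + 1"] by simp
    qed
    then show "n \<in> sqf_seq ` gap_indices h x"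
      using k j n by (intro image_eqI[of _ _ k]) (auto simp: gap_indices_def sqf_gap_eq_iff)
  qed
qed

section \<open>Existence of the gap densities\<close>

lemma card_periodic_set:
  fixes B :: "nat set" and M :: nat
  assumes M: "M > 0" and per: "\<And>n. n + M \<in> B \<longleftrightarrow> n \<in> B"
  shows "\<bar>real (card (B \<inter> {1..X})) - real X * (real (card (B \<inter> {1..M})) / real M)\<bar> \<le> real M"
proof -
  define c where "c X = card (B \<inter> {1..X})" for X
  have add: "c (X + M) = c M + c X" for X
  proof -
    have "B \<inter> {1..X + M} = (B \<inter> {1..M}) \<union> (\<lambda>n. n + M) ` (B \<inter> {1..X})"
    proof (intro equalityI subsetI)
      fix n assume n: "n \<in> B \<inter> {1..X + M}"
      show "n \<in> (B \<inter> {1..M}) \<union> (\<lambda>n. n + M) ` (B \<inter> {1..X})"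
      proof (cases "n \<le> M")
        case False
        then have "n = (n - M) + M" "n - M \<in> B \<inter> {1..X}" using n per[of "n - M"] by auto
        then show ?thesis by blast
      qed (use n in auto)
    qed (auto simp: per)
    moreover have "card ((B \<inter> {1..M}) \<union> (\<lambda>n. n + M) ` (B \<inter> {1..X})) = card (B \<inter> {1..M}) + card ((\<lambda>n. n + M) ` (B \<inter> {1..X}))"
      by (rule card_Un_disjoint) auto
    moreover have "card ((\<lambda>n. n + M) ` (B \<inter> {1..X})) = card (B \<inter> {1..X})" by (rule card_image) (simp add: inj_on_def)
    ultimately show ?thesis unfolding c_def by simp
  qed
  have mult: "c (q * M + r) = q * c M + c r" for q r
  proof (induction q)
    case (Suc q)
    have "c (Suc q * M + r) = c (q * M + r + M)" by (simp add: algebra_simps)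
    then show ?case using add Suc by simp
  qed simp
  have cle: "c r \<le> r" for r unfolding c_def using card_mono[of "{1..r}" "B \<inter> {1..r}"] by simp
  define q r where "q = X div M" and "r = X mod M"
  have X: "X = q * M + r" "r < M" unfolding q_def r_def using M by auto
  have "real (c X) - real X * (real (c M) / real M) = real (c r) - real r * (real (c M) / real M)"
    unfolding X(1) mult using M by (simp add: field_simps)
  moreover have "0 \<le> real r * (real (c M) / real M)" "real r * (real (c M) / real M) \<le> real r * 1"
    using cle[of M] M by (simp, intro mult_left_mono) auto
  moreover have "real (c r) \<le> real M" "real r \<le> real M" using cle[of r] X(2) by linarith+
  ultimately show ?thesis unfolding c_def by linarith
qed

text \<open>The approximating densities change with \<open>e\<close>, so the Cauchy criterion takes
  the place of an explicit limit.\<close>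

lemma convergent_if_approx:
  fixes f :: "nat \<Rightarrow> real"
  assumes "\<And>e. e > 0 \<Longrightarrow> \<exists>d. \<forall>\<^sub>F n in sequentially. \<bar>f n - d\<bar> \<le> e"
  shows "convergent f"
proof -
  have "Cauchy f"
  proof (rule metric_CauchyI)
    fix e :: real assume "e > 0"
    then obtain d where "\<forall>\<^sub>F n in sequentially. \<bar>f n - d\<bar> \<le> e / 3" using assms[of "e / 3"] by auto
    then obtain N where N: "\<And>n. n \<ge> N \<Longrightarrow> \<bar>f n - d\<bar> \<le> e / 3" unfolding eventually_sequentially by blast
    have "dist (f m) (f n) < e" if "m \<ge> N" "n \<ge> N" for m n
      using N[OF that(1)] N[OF that(2)] \<open>e > 0\<close> unfolding dist_real_def by linarith
    then show "\<exists>M. \<forall>m\<ge>M. \<forall>n\<ge>M. dist (f m) (f n) < e" by blast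
  qed
  then show ?thesis by (rule Cauchy_convergent)
qed

definition free_upto :: "nat \<Rightarrow> nat \<Rightarrow> bool" where
  "free_upto y n \<longleftrightarrow> (\<forall>d\<in>{2..y}. \<not> d\<^sup>2 dvd n)"

lemma free_upto_periodic: "free_upto y (n + (fact y)\<^sup>2) \<longleftrightarrow> free_upto y n"
proof -
  have "d\<^sup>2 dvd (fact y :: nat)\<^sup>2" if "d \<in> {2..y}" for d
    using that by (intro dvd_power_same dvd_fact) auto
  then show ?thesis unfolding free_upto_def by (meson dvd_add_left_iff)
qed

lemma squarefree_imp_free_upto: "squarefree n \<Longrightarrow> free_upto y n"
  unfolding free_upto_def squarefree_def by force

lemma free_upto_not_squarefree:
  assumes "free_upto y n" "\<not> squarefree n"
  shows "\<exists>d>y. d\<^sup>2 dvd n"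
proof -
  have "sqprime n \<ge> 2" "(sqprime n)\<^sup>2 dvd n" using sqprime[OF assms(2)] prime_ge_2_nat by auto
  then have "sqprime n > y" using assms(1) unfolding free_upto_def by force
  then show ?thesis using \<open>(sqprime n)\<^sup>2 dvd n\<close> by blast
qed

text \<open>Testing only squares up to \<open>y^2\<close> turns the gap condition into one of period
  \<open>(fact y)^2\<close>. The two conditions can disagree at \<open>n\<close> only if one of
  \<open>n\<close>, ..., \<open>n + h\<close> is divisible by \<open>d^2\<close> with
  \<open>d > y\<close>, which happens for at most \<open>(h + 1) * (X + h) / y\<close> values of
  \<open>n\<close> up to \<open>X\<close>.\<close>

lemma gap_starts_density: "convergent (\<lambda>X. real (card (gap_starts h \<inter> {1..X})) / real X)"
proof (rule convergent_if_approx)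
  fix e :: real assume e: "e > 0"
  \<comment> \<open>Makes the proportion of disagreements at most \<open>e / 2\<close>; the other
    half absorbs the bounded periodic error and the shift by \<open>h\<close>.\<close>
  define y where "y = nat \<lceil>2 * real (h + 1) / e\<rceil> + 1"
  have y1: "y \<ge> 1" unfolding y_def by simp
  have y2: "real (h + 1) / real y \<le> e / 2"
  proof -
    have "2 * real (h + 1) / e \<le> real y" unfolding y_def by linarith
    then show ?thesis using e y1 by (simp add: field_simps)
  qed
  define B where "B = {n. free_upto y n \<and> free_upto y (n + h) \<and> (\<forall>i\<in>{1..<h}. \<not> free_upto y (n + i))}"
  define M :: nat where "M = (fact y)\<^sup>2"
  have M0: "M > 0" unfolding M_def by simp
  have per: "n + M \<in> B \<longleftrightarrow> n \<in> B" for n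
  proof -
    have "free_upto y (n + M + i) \<longleftrightarrow> free_upto y (n + i)" for i
      using free_upto_periodic[of y "n + i"] unfolding M_def by (simp add: ac_simps)
    from this[of 0] this show ?thesis unfolding B_def by simp
  qed
  define d where "d = real (card (B \<inter> {1..M})) / real M"
  define E where "E X = {N \<in> {1..X}. \<exists>d>y. d\<^sup>2 dvd N}" for X
  \<comment> \<open>Formulated for two arbitrary sets because it is applied in both
    directions.\<close>
  have diff: "real (card (S \<inter> {1..X})) \<le> real (card (S' \<inter> {1..X})) + real (h + 1) * (real (X + h) / real y)"
    if "S \<inter> {1..X} - S' \<subseteq> (\<Union>i\<le>h. {n\<in>{1..X}. n + i \<in> E (X + h)})" for S S' X
  proof -
    have "card (S \<inter> {1..X}) \<le> card ((S' \<inter> {1..X}) \<union> (\<Union>i\<le>h. {n\<in>{1..X}. n + i \<in> E (X + h)}))"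
      using that by (intro card_mono) auto
    also have "\<dots> \<le> card (S' \<inter> {1..X}) + card (\<Union>i\<le>h. {n\<in>{1..X}. n + i \<in> E (X + h)})" by (rule card_Un_le)
    also have "card (\<Union>i\<le>h. {n\<in>{1..X}. n + i \<in> E (X + h)}) \<le> (\<Sum>i\<le>h. card {n\<in>{1..X}. n + i \<in> E (X + h)})"
      by (rule card_UN_le) simp
    also have "\<dots> \<le> (\<Sum>i\<le>h. card (E (X + h)))"
    proof (rule sum_mono)
      fix i
      show "card {n\<in>{1..X}. n + i \<in> E (X + h)} \<le> card (E (X + h))"
        by (rule card_inj_on_le[of "\<lambda>n. n + i"]) (auto simp: E_def inj_on_def)
    qed
    also have "\<dots> = (h + 1) * card (E (X + h))" by simp
    finally have "real (card (S \<inter> {1..X})) \<le> real (card (S' \<inter> {1..X}) + (h + 1) * card (E (X + h)))"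
      by (intro of_nat_mono) simp
    also have "\<dots> = real (card (S' \<inter> {1..X})) + real (h + 1) * real (card (E (X + h)))"
      by (simp add: algebra_simps)
    also have "\<dots> \<le> real (card (S' \<inter> {1..X})) + real (h + 1) * (real (X + h) / real y)"
      unfolding E_def by (intro add_left_mono mult_left_mono card_large_square_factor y1) simp
    finally show ?thesis .
  qed
  have mem: "n + i \<in> E (X + h)" if "n \<in> {1..X}" "i \<le> h" "free_upto y (n + i)" "\<not> squarefree (n + i)" for n i X
    using that free_upto_not_squarefree[OF that(3,4)] unfolding E_def by auto
  have s1: "gap_starts h \<inter> {1..X} - B \<subseteq> (\<Union>i\<le>h. {n\<in>{1..X}. n + i \<in> E (X + h)})" for X
  proof
    fix n assume n: "n \<in> gap_starts h \<inter> {1..X} - B"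
    then have "free_upto y n" "free_upto y (n + h)" using squarefree_imp_free_upto unfolding gap_starts_def by auto
    then obtain i where i: "i \<in> {1..<h}" "free_upto y (n + i)" using n unfolding B_def by auto
    then have "\<not> squarefree (n + i)" using n unfolding gap_starts_def by auto
    then show "n \<in> (\<Union>i\<le>h. {n\<in>{1..X}. n + i \<in> E (X + h)})" using mem[of n X i] i n by auto
  qed
  have s2: "B \<inter> {1..X} - gap_starts h \<subseteq> (\<Union>i\<le>h. {n\<in>{1..X}. n + i \<in> E (X + h)})" for X
  proof
    fix n assume n: "n \<in> B \<inter> {1..X} - gap_starts h"
    have "\<not> squarefree (n + i)" if "i \<in> {1..<h}" for i
      using n that squarefree_imp_free_upto unfolding B_def by blast
    then have "\<not> squarefree (n + 0) \<or> \<not> squarefree (n + h)" using n unfolding gap_starts_def by auto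
    moreover have "free_upto y (n + 0)" "free_upto y (n + h)" using n unfolding B_def by auto
    ultimately have "n + 0 \<in> E (X + h) \<or> n + h \<in> E (X + h)" using mem[of n X 0] mem[of n X h] n by auto
    then obtain i where "i \<le> h" "n + i \<in> E (X + h)" by blast
    then show "n \<in> (\<Union>i\<le>h. {n\<in>{1..X}. n + i \<in> E (X + h)})" using n by auto
  qed
  have main: "\<bar>real (card (gap_starts h \<inter> {1..X})) - real X * d\<bar> \<le> real M + e / 2 * real (X + h)" for X
  proof -
    have "real (h + 1) * (real (X + h) / real y) = real (h + 1) / real y * real (X + h)" by simp
    also have "\<dots> \<le> e / 2 * real (X + h)" using y2 by (intro mult_right_mono) auto
    finally show ?thesis using diff[OF s1[of X]] diff[OF s2[of X]] card_periodic_set[OF M0 per, of X]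
      unfolding d_def by linarith
  qed
  have "\<forall>\<^sub>F X in sequentially. real M + e / 2 * real (X + h) \<le> e * real X"
  proof -
    have "\<forall>\<^sub>F X::nat in sequentially. real X \<ge> (real M + e / 2 * real h) * (2 / e)"
      using filterlim_real_sequentially unfolding filterlim_at_top by blast
    then show ?thesis
    proof eventually_elim
      case (elim X)
      then have "(real M + e / 2 * real h) * (2 / e) * (e / 2) \<le> real X * (e / 2)" using e by (intro mult_right_mono) auto
      then have "real M * 2 + e * real h \<le> e * real X" using e by (simp add: algebra_simps)
      moreover have "e / 2 * real (X + h) = e * real X / 2 + e * real h / 2"
        by (simp add: algebra_simps add_divide_distrib)
      moreover have "p + (r / 2 + q / 2) \<le> r" if "p * 2 + q \<le> r" for p q r :: real
        using that by (simp add: field_simps)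
      ultimately show ?case by presburger
    qed
  qed
  then have "\<forall>\<^sub>F X in sequentially. \<bar>real (card (gap_starts h \<inter> {1..X})) / real X - d\<bar> \<le> e"
    using eventually_gt_at_top[of 0]
  proof eventually_elim
    case (elim X)
    have "\<bar>real (card (gap_starts h \<inter> {1..X})) / real X - d\<bar> = \<bar>real (card (gap_starts h \<inter> {1..X})) - real X * d\<bar> / real X"
    proof -
      have "real (card (gap_starts h \<inter> {1..X})) / real X - d = (real (card (gap_starts h \<inter> {1..X})) - real X * d) / real X"
        using elim(2) by (simp add: field_simps)
      then show ?thesis by (simp only: abs_divide abs_of_nat)
    qed
    also have "\<dots> \<le> (e * real X) / real X" using main[of X] elim by (intro divide_right_mono) auto
    finally show ?case using elim(2) by simp
  qed
  then show "\<exists>d. \<forall>\<^sub>F n in sequentially. \<bar>real (card (gap_starts h \<inter> {1..n})) / real n - d\<bar> \<le> e" by blast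
qed

definition gap_count :: "nat \<Rightarrow> real \<Rightarrow> nat" where
  "gap_count h x = card (gap_indices h x)"

text \<open>\<open>gap_density\<close> is a \<open>Lim\<close>, whose value is informative only once
  a limit is known to exist. The limit over integer cutoffs for left ends is transferred to real
  cutoffs for right ends.\<close>

lemma gap_count_tendsto:
  assumes h: "h \<ge> 1"
  shows "((\<lambda>x. 1 / x * real (gap_count h x)) \<longlongrightarrow> gap_density h) at_top"
proof -
  obtain l where l: "(\<lambda>X. real (card (gap_starts h \<inter> {1..X})) / real X) \<longlonglongrightarrow> l"
    using gap_starts_density unfolding convergent_def by blast
  \<comment> \<open>The shift by \<open>h\<close> passes from right ends to left ends. The truncated
    subtraction is exact from \<open>x \<ge> h + 1\<close> on.\<close>
  define N where "N x = nat \<lfloor>x\<rfloor> - h" for x :: real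
  have cnt: "real (gap_count h x) = real (card (gap_starts h \<inter> {1..N x}))" if "x \<ge> real h + 1" for x
  proof -
    have "gap_count h x = card {n \<in> gap_starts h. real (n + h) \<le> x}"
      unfolding gap_count_def by (rule bij_betw_same_card[OF bij_betw_gap_starts[OF h]])
    also have "{n \<in> gap_starts h. real (n + h) \<le> x} = gap_starts h \<inter> {1..N x}"
    proof -
      have "real (n + h) \<le> x \<longleftrightarrow> n \<le> N x" for n
      proof -
        have "real (n + h) \<le> x \<longleftrightarrow> n + h \<le> nat \<lfloor>x\<rfloor>" using that by (simp add: le_nat_iff le_floor_iff)
        also have "\<dots> \<longleftrightarrow> n \<le> N x" using that unfolding N_def by linarith
        finally show ?thesis .
      qed
      then show ?thesis unfolding gap_starts_def by auto
    qed
    finally show ?thesis by simp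
  qed
  have Ntop: "filterlim N sequentially at_top"
  proof -
    have "filterlim (\<lambda>x::real. nat \<lfloor>x\<rfloor>) sequentially at_top" by real_asymp
    then have "\<forall>\<^sub>F x::real in at_top. m + h \<le> nat \<lfloor>x\<rfloor>" for m unfolding filterlim_at_top by blast
    then have "\<forall>\<^sub>F x::real in at_top. m \<le> N x" for m
      unfolding N_def by (rule eventually_mono[of "\<lambda>x. m + h \<le> nat \<lfloor>x\<rfloor>"]) linarith
    then show ?thesis unfolding filterlim_at_top by blast
  qed
  have Nx: "((\<lambda>x. real (N x) / x) \<longlongrightarrow> 1) at_top"
  proof (rule Lim_transform_eventually)
    show "((\<lambda>x. (real_of_int \<lfloor>x\<rfloor> - real h) / x) \<longlongrightarrow> 1) at_top" by real_asymp
    show "\<forall>\<^sub>F x in at_top. (real_of_int \<lfloor>x\<rfloor> - real h) / x = real (N x) / x"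
      using eventually_ge_at_top[of "real h + 1"]
    proof eventually_elim
      case (elim x)
      then have "h \<le> nat \<lfloor>x\<rfloor>" "\<lfloor>x\<rfloor> \<ge> 0" by linarith+
      then show ?case unfolding N_def by (simp add: of_nat_diff)
    qed
  qed
  have "((\<lambda>x. real (card (gap_starts h \<inter> {1..N x})) / real (N x) * (real (N x) / x)) \<longlongrightarrow> l * 1) at_top"
    by (rule tendsto_mult[OF filterlim_compose[OF l Ntop] Nx])
  moreover have "\<forall>\<^sub>F x in at_top. real (card (gap_starts h \<inter> {1..N x})) / real (N x) * (real (N x) / x)
      = 1 / x * real (gap_count h x)"
    using eventually_ge_at_top[of "real h + 1"] Ntop[unfolded filterlim_at_top, rule_format, of 1]
  proof eventually_elim
    case (elim x)
    then show ?case using cnt[of x] by simp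
  qed
  ultimately have "((\<lambda>x. 1 / x * real (gap_count h x)) \<longlongrightarrow> l) at_top"
    using Lim_transform_eventually by fastforce
  moreover from this have "gap_density h = l"
    unfolding gap_density_def gap_indices_def[symmetric] gap_count_def[symmetric] by (intro tendsto_Lim) auto
  ultimately show ?thesis by simp
qed

lemma gap_density_nonneg: "h \<ge> 1 \<Longrightarrow> gap_density h \<ge> 0"
  by (rule tendsto_lowerbound[OF gap_count_tendsto]) (auto intro!: eventually_at_top_linorderI[of 0])


section \<open>Moments of long gaps\<close>

lemma sqf_gap_nat:
  assumes "k \<ge> 1"
  obtains h where "h \<ge> 1" "sqf_gap k = real h" "sqf_seq (k + 1) = sqf_seq k + h"
proof (rule that[of "sqf_seq (k + 1) - sqf_seq k"])
  have "sqf_seq k < sqf_seq (k + 1)" using assms by (intro sqf_seq_less) auto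
  then show "sqf_seq (k + 1) - sqf_seq k \<ge> 1" "sqf_gap k = real (sqf_seq (k + 1) - sqf_seq k)"
    "sqf_seq (k + 1) = sqf_seq k + (sqf_seq (k + 1) - sqf_seq k)"
    unfolding sqf_gap_def by auto
qed

text \<open>The inequality \<open>H < sqf_gap k\<close> is strict because the interval after
  \<open>sqf_seq k\<close> contains its right end, which must stay below the next squarefree
  number.\<close>

lemma squareful_starts_gaps:
  assumes "finite A" "\<And>k. k \<in> A \<Longrightarrow> k \<ge> 1 \<and> sqf_seq (k + 1) \<le> X \<and> real H < sqf_gap k"
  shows "squareful_starts H X (sqf_seq ` A)"
  unfolding squareful_starts_def
proof (intro conjI ballI impI)
  show "finite (sqf_seq ` A)" using assms(1) by simp
  have step: "sqf_seq k + H < sqf_seq (k + 1)" if "k \<in> A" for k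
    using assms(2)[OF that] unfolding sqf_gap_def by linarith
  fix n assume "n \<in> sqf_seq ` A"
  then obtain k where k: "k \<in> A" "n = sqf_seq k" by blast
  show "n + H \<le> X" using step[OF k(1)] assms(2)[OF k(1)] k by linarith
  show "\<not> squarefree N" if "N \<in> {n<..n + H}" for N
    using that step[OF k(1)] k assms(2)[OF k(1)] by (intro sqf_seq_between[of k]) auto
  fix n' assume "n' \<in> sqf_seq ` A" "n < n'"
  then obtain k' where k': "k' \<in> A" "n' = sqf_seq k'" by blast
  then have "k < k'" using \<open>n < n'\<close> k sqf_seq_less_iff[of k k'] assms(2) by blast
  then have "sqf_seq (k + 1) \<le> sqf_seq k'"
    using sqf_seq_less[of "k + 1" k'] by (cases "k' = k + 1") auto
  then show "n + H \<le> n'" using step[OF k(1)] k k' by linarith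
qed

definition large_gaps :: "nat \<Rightarrow> real \<Rightarrow> nat set" where
  "large_gaps m x = {k. k \<ge> 1 \<and> real (sqf_seq (k + 1)) \<le> x \<and> sqf_gap k > 2 ^ m}"

lemma finite_large_gaps: "finite (large_gaps m x)"
  by (rule finite_subset[OF _ finite_sqf_seq_le[of x]]) (auto simp: large_gaps_def)

text \<open>Gaps between \<open>2^i\<close> and \<open>2^(i+1)\<close> number at most
  \<open>C * x * 2 powr (-3.76 * i)\<close>, and each weighs at most
  \<open>2 powr (\<gamma> * (i + 1))\<close>. The dyadic contributions therefore decay with ratio
  \<open>2 powr (\<gamma> - 3.76)\<close>, which is less than 1.\<close>

lemma large_gaps_moment:
  fixes \<gamma> :: real
  assumes \<gamma>: "0 \<le> \<gamma>" "\<gamma> < 3.75"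
  obtains K \<rho> :: real where "K > 0" "0 < \<rho>" "\<rho> < 1"
    "\<And>m x. x \<ge> 1 \<Longrightarrow> (\<Sum>k\<in>large_gaps m x. sqf_gap k powr \<gamma>) \<le> K * \<rho> ^ m * x"
proof -
  obtain C :: real where C: "C > 0"
    "\<And>H X V. H \<ge> 1 \<Longrightarrow> squareful_starts H X V \<Longrightarrow> real (card V) \<le> C * real X * real H powr (-3.76)"
    by (rule squareful_starts_bound) blast
  define \<rho> where "\<rho> = 2 powr (\<gamma> - 3.76)"
  have \<rho>0: "0 < \<rho>" unfolding \<rho>_def by simp
  have "\<rho> < 2 powr 0" unfolding \<rho>_def using \<gamma> by (intro powr_less_mono) auto
  then have \<rho>1: "\<rho> < 1" by simp
  define K where "K = C * 2 powr \<gamma> / (1 - \<rho>)"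
  have K0: "K > 0" unfolding K_def using C \<rho>1 by simp
  show ?thesis
  proof (rule that[OF K0 \<rho>0 \<rho>1])
    fix m :: nat and x :: real assume x: "x \<ge> 1"
    define A where "A i = {k. k \<ge> 1 \<and> real (sqf_seq (k + 1)) \<le> x \<and> 2 ^ i < sqf_gap k \<and> sqf_gap k \<le> 2 ^ Suc i}" for i
    \<comment> \<open>A gap whose right end is at most \<open>x\<close> is itself at most
      \<open>x\<close>, so only finitely many dyadic ranges occur.\<close>
    obtain I where I: "x < 2 ^ I" using real_arch_pow[of 2 x] by auto
    have fin: "finite (A i)" for i by (rule finite_subset[OF _ finite_sqf_seq_le[of x]]) (auto simp: A_def)
    have disj: "A i \<inter> A j = {}" if "i \<noteq> j" for i j
    proof -
      have "A i \<inter> A j = {}" if "i < j" for i j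
      proof -
        have "(2::real) ^ Suc i \<le> 2 ^ j" using that by (intro power_increasing) auto
        then show ?thesis unfolding A_def by auto
      qed
      then show ?thesis using that by (metis inf_commute linorder_neqE_nat)
    qed
    have sub: "large_gaps m x \<subseteq> (\<Union>i\<in>{m..<I}. A i)"
    proof
      fix k assume "k \<in> large_gaps m x"
      then have k: "k \<ge> 1" "real (sqf_seq (k + 1)) \<le> x" "sqf_gap k > 2 ^ m"
        by (auto simp: large_gaps_def)
      have gI: "sqf_gap k \<le> 2 ^ I" using k I unfolding sqf_gap_def by linarith
      define j where "j = (LEAST i. sqf_gap k \<le> 2 ^ i)"
      have j: "sqf_gap k \<le> 2 ^ j" unfolding j_def using gI by (rule LeastI)
      have jI: "j \<le> I" unfolding j_def using gI by (rule Least_le)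
      have mj: "m < j"
      proof (rule ccontr)
        assume "\<not> m < j"
        then have "(2::real) ^ j \<le> 2 ^ m" by (intro power_increasing) auto
        then show False using j k by linarith
      qed
      then obtain i where i: "j = Suc i" by (cases j) auto
      have "\<not> sqf_gap k \<le> 2 ^ i" using not_less_Least[of i "\<lambda>i. sqf_gap k \<le> 2 ^ i"] i unfolding j_def by simp
      then have "k \<in> A i" unfolding A_def using k j i by simp
      then show "k \<in> (\<Union>i\<in>{m..<I}. A i)" using i jI mj by (intro UN_I[of i]) auto
    qed
    have "(\<Sum>k\<in>large_gaps m x. sqf_gap k powr \<gamma>)
        \<le> (\<Sum>k\<in>(\<Union>i\<in>{m..<I}. A i). sqf_gap k powr \<gamma>)"
      using fin by (intro sum_mono2[OF _ sub]) auto
    also have "\<dots> = (\<Sum>i\<in>{m..<I}. \<Sum>k\<in>A i. sqf_gap k powr \<gamma>)"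
      using fin disj by (intro sum.UNION_disjoint) auto
    also have "\<dots> \<le> (\<Sum>i\<in>{m..<I}. C * x * 2 powr \<gamma> * \<rho> ^ i)"
    proof (rule sum_mono)
      fix i
      have "squareful_starts (2 ^ i) (nat \<lfloor>x\<rfloor>) (sqf_seq ` A i)"
        using fin by (intro squareful_starts_gaps) (auto simp: A_def le_nat_floor)
      then have "real (card (sqf_seq ` A i)) \<le> C * real (nat \<lfloor>x\<rfloor>) * real (2 ^ i) powr (-3.76)"
        by (intro C(2)) auto
      also have "card (sqf_seq ` A i) = card (A i)"
      proof (rule card_image, rule inj_onI)
        fix j k assume "j \<in> A i" "k \<in> A i" "sqf_seq j = sqf_seq k"
        then show "j = k" using sqf_seq_less_iff[of j k] sqf_seq_less_iff[of k j] unfolding A_def by auto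
      qed
      also have "C * real (nat \<lfloor>x\<rfloor>) * real (2 ^ i) powr (-3.76) \<le> C * x * (2 powr real i) powr (-3.76)"
        using C x by (intro mult_mono mult_left_mono) (auto simp: powr_realpow)
      finally have cA: "real (card (A i)) \<le> C * x * (2 powr real i) powr (-3.76)" .
      have "(\<Sum>k\<in>A i. sqf_gap k powr \<gamma>) \<le> (\<Sum>k\<in>A i. (2 powr real (Suc i)) powr \<gamma>)"
      proof (rule sum_mono)
        fix k assume k: "k \<in> A i"
        have "(0::real) < 2 ^ i" by simp
        then have "0 \<le> sqf_gap k" using k unfolding A_def by (simp add: less_imp_le order_less_trans)
        moreover have "sqf_gap k \<le> 2 powr real (Suc i)" using k unfolding A_def by (simp add: powr_realpow del: of_nat_Suc)
        ultimately show "sqf_gap k powr \<gamma> \<le> (2 powr real (Suc i)) powr \<gamma>" using \<gamma> by (intro powr_mono2) auto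
      qed
      also have "\<dots> = real (card (A i)) * (2 powr real (Suc i)) powr \<gamma>" by simp
      also have "\<dots> \<le> C * x * (2 powr real i) powr (-3.76) * (2 powr real (Suc i)) powr \<gamma>"
        by (rule mult_right_mono[OF cA]) simp
      also have "\<dots> = C * x * 2 powr (real i * (-3.76) + real (Suc i) * \<gamma>)"
        unfolding powr_powr powr_add by (simp only: mult.assoc)
      also have "real i * (-3.76) + real (Suc i) * \<gamma> = \<gamma> + (\<gamma> - 3.76) * real i" by (simp add: algebra_simps)
      also have "C * x * 2 powr (\<gamma> + (\<gamma> - 3.76) * real i) = C * x * 2 powr \<gamma> * \<rho> ^ i"
        unfolding powr_add powr_powr[symmetric] \<rho>_def[symmetric] using \<rho>0 by (simp add: powr_realpow)
      finally show "(\<Sum>k\<in>A i. sqf_gap k powr \<gamma>) \<le> C * x * 2 powr \<gamma> * \<rho> ^ i" .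
    qed
    also have "\<dots> = C * x * 2 powr \<gamma> * (\<Sum>i\<in>{m..<I}. \<rho> ^ i)" by (rule sum_distrib_left[symmetric])
    also have "(\<Sum>i\<in>{m..<I}. \<rho> ^ i) \<le> \<rho> ^ m / (1 - \<rho>)"
    proof -
      have "(\<Sum>i\<in>{m..<I}. \<rho> ^ i) = (if m \<le> I then (\<rho> ^ m - \<rho> ^ I) / (1 - \<rho>) else 0)"
      proof (cases "m \<le> I")
        case True
        have "(1 - \<rho>) * (\<Sum>i\<in>{m..<I}. \<rho> ^ i) = \<rho> ^ m - \<rho> ^ I"
          using True
        proof (induction I rule: dec_induct)
          case (step n)
          have "(1 - \<rho>) * (\<Sum>i\<in>{m..<Suc n}. \<rho> ^ i) = (1 - \<rho>) * (\<Sum>i\<in>{m..<n}. \<rho> ^ i) + (1 - \<rho>) * \<rho> ^ n"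
            using step by (simp add: distrib_left)
          then show ?case unfolding step by (simp add: left_diff_distrib)
        qed simp
        then show ?thesis using True \<rho>1 by (simp add: field_simps)
      qed simp
      also have "\<dots> \<le> \<rho> ^ m / (1 - \<rho>)" using \<rho>0 \<rho>1 by (auto intro!: divide_right_mono)
      finally show ?thesis .
    qed
    then have "C * x * 2 powr \<gamma> * (\<Sum>i\<in>{m..<I}. \<rho> ^ i) \<le> C * x * 2 powr \<gamma> * (\<rho> ^ m / (1 - \<rho>))"
      using C x by (intro mult_left_mono) auto
    also have "\<dots> = K * \<rho> ^ m * x" unfolding K_def by simp
    finally show "(\<Sum>k\<in>large_gaps m x. sqf_gap k powr \<gamma>) \<le> K * \<rho> ^ m * x" .
  qed
qed

section \<open>Gaps ending between x/2 and x\<close>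

definition half_gaps :: "real \<Rightarrow> nat set" where
  "half_gaps x = {k. k \<ge> 1 \<and> x / 2 < real (sqf_seq (k + 1)) \<and> real (sqf_seq (k + 1)) \<le> x}"

lemma finite_half_gaps: "finite (half_gaps x)"
  by (rule finite_subset[OF _ finite_sqf_seq_le[of x]]) (auto simp: half_gaps_def)

text \<open>Only finitely many lengths occur, so limits may be taken term by term. The count on the
  half-interval is the count up to \<open>x\<close> minus the count up to \<open>x / 2\<close>;
  after division by \<open>x\<close> the latter tends to half the density.\<close>

lemma small_gaps_tendsto:
  "((\<lambda>x. (\<Sum>k\<in>{k \<in> half_gaps x. sqf_gap k \<le> real T}. sqf_gap k powr \<gamma>) / x)
    \<longlongrightarrow> (\<Sum>h=1..T. real h powr \<gamma> * (gap_density h / 2))) at_top"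
proof -
  have eq: "(\<Sum>k\<in>{k \<in> half_gaps x. sqf_gap k \<le> real T}. sqf_gap k powr \<gamma>) / x
      = (\<Sum>h=1..T. real h powr \<gamma> * (1 / x * real (gap_count h x) - 1 / (x / 2) * real (gap_count h (x / 2)) / 2))"
    if x: "x > 0" for x
  proof -
    let ?S = "\<lambda>h. {k \<in> half_gaps x. sqf_gap k = real h}"
    have "{k \<in> half_gaps x. sqf_gap k \<le> real T} = (\<Union>h\<in>{1..T}. ?S h)"
    proof (intro equalityI subsetI)
      fix k assume k: "k \<in> {k \<in> half_gaps x. sqf_gap k \<le> real T}"
      then have "k \<ge> 1" by (simp add: half_gaps_def)
      then obtain h where "h \<ge> 1" "sqf_gap k = real h" by (rule sqf_gap_nat)
      then show "k \<in> (\<Union>h\<in>{1..T}. ?S h)" using k by (intro UN_I[of h]) auto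
    qed auto
    then have "(\<Sum>k\<in>{k \<in> half_gaps x. sqf_gap k \<le> real T}. sqf_gap k powr \<gamma>) = (\<Sum>h=1..T. \<Sum>k\<in>?S h. sqf_gap k powr \<gamma>)"
      using finite_half_gaps by (simp only:) (rule sum.UNION_disjoint, auto)
    also have "\<dots> = (\<Sum>h=1..T. real h powr \<gamma> * (real (gap_count h x) - real (gap_count h (x / 2))))"
    proof (rule sum.cong[OF refl])
      fix h
      have "?S h = gap_indices h x - gap_indices h (x / 2)"
        unfolding half_gaps_def gap_indices_def by auto
      also have "card \<dots> = gap_count h x - gap_count h (x / 2)"
        unfolding gap_count_def
        by (rule card_Diff_subset) (use x in \<open>auto simp: finite_gap_indices, auto simp: gap_indices_def\<close>)
      finally have c: "card (?S h) = gap_count h x - gap_count h (x / 2)" .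
      have "gap_count h (x / 2) \<le> gap_count h x"
        unfolding gap_count_def
        by (rule card_mono) (use x in \<open>auto simp: finite_gap_indices, auto simp: gap_indices_def\<close>)
      then have "real (card (?S h)) = real (gap_count h x) - real (gap_count h (x / 2))" unfolding c by (rule of_nat_diff)
      then show "(\<Sum>k\<in>?S h. sqf_gap k powr \<gamma>) = real h powr \<gamma> * (real (gap_count h x) - real (gap_count h (x / 2)))"
        by simp
    qed
    finally show ?thesis using x by (simp add: sum_divide_distrib field_simps)
  qed
  have half: "filterlim (\<lambda>x::real. x / 2) at_top at_top" by real_asymp
  have "((\<lambda>x. \<Sum>h=1..T. real h powr \<gamma> * (1 / x * real (gap_count h x) - 1 / (x / 2) * real (gap_count h (x / 2)) / 2))
      \<longlongrightarrow> (\<Sum>h=1..T. real h powr \<gamma> * (gap_density h - gap_density h / 2))) at_top"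
    by (intro tendsto_sum tendsto_mult tendsto_diff tendsto_const tendsto_divide gap_count_tendsto
        filterlim_compose[OF gap_count_tendsto half]) auto
  moreover have "\<forall>\<^sub>F x in at_top. (\<Sum>h=1..T. real h powr \<gamma> * (1 / x * real (gap_count h x) - 1 / (x / 2) * real (gap_count h (x / 2)) / 2))
      = (\<Sum>k\<in>{k \<in> half_gaps x. sqf_gap k \<le> real T}. sqf_gap k powr \<gamma>) / x"
    using eventually_gt_at_top[of 0] by eventually_elim (simp only: eq)
  ultimately have "((\<lambda>x. (\<Sum>k\<in>{k \<in> half_gaps x. sqf_gap k \<le> real T}. sqf_gap k powr \<gamma>) / x)
      \<longlongrightarrow> (\<Sum>h=1..T. real h powr \<gamma> * (gap_density h - gap_density h / 2))) at_top"
    by (rule Lim_transform_eventually)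
  then show ?thesis by simp
qed

text \<open>This makes the moment nonzero, so that dividing by it is legitimate. Squares of
  \<open>d \<ge> 2\<close> remove at most 3/4 of the integers between \<open>x / 2\<close> and
  \<open>x\<close>, with a rounding error of 1 for each \<open>d\<close> up to
  \<open>sqrt x\<close>.\<close>

lemma card_half_gaps_lower: "\<forall>\<^sub>F x in at_top. x / 20 \<le> real (card (half_gaps x))"
proof -
  have main: "(x / 2 - 1) / 4 - sqrt x \<le> real (card (half_gaps x))" if x: "x \<ge> 2" for x
  proof -
    define n where "n = nat \<lfloor>x / 2\<rfloor>"
    define H where "H = nat \<lfloor>x\<rfloor> - n"
    define D where "D = nat \<lfloor>sqrt x\<rfloor>"
    have n1: "n \<ge> 1" unfolding n_def using x by linarith
    have nH: "n + H = nat \<lfloor>x\<rfloor>" unfolding H_def n_def using x by linarith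
    have H: "real H \<ge> x / 2 - 1" unfolding H_def n_def using x by linarith
    define Q where "Q = {m \<in> {n<..n + H}. squarefree m}"
    have "Q \<subseteq> (\<lambda>k. sqf_seq (k + 1)) ` half_gaps x"
    proof
      fix m assume m: "m \<in> Q"
      then have "m \<in> sqf_seq ` {1..}" unfolding sqf_seq_image Q_def by auto
      then obtain j where j: "j \<ge> 1" "m = sqf_seq j" by auto
      \<comment> \<open>As 1 is squarefree, \<open>m > 1\<close> is not the first term of the
        sequence. Hence it ends a gap with index \<open>j - 1 \<ge> 1\<close>.\<close>
      have "1 \<in> sqf_seq ` {1..}" unfolding sqf_seq_image by simp
      then obtain i where i: "i \<ge> 1" "sqf_seq i = 1" by auto
      have "m > 1" using m n1 unfolding Q_def by auto
      then have "i < j" using i j sqf_seq_less_iff[of i j] by simp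
      then have j2: "j - 1 \<ge> 1" "m = sqf_seq (j - 1 + 1)" using i j by auto
      have "n < m" "m \<le> nat \<lfloor>x\<rfloor>" using m nH unfolding Q_def by auto
      then have "x / 2 < real m" "real m \<le> x" unfolding n_def using x by linarith+
      then have "j - 1 \<in> half_gaps x" unfolding half_gaps_def using j2 by auto
      then show "m \<in> (\<lambda>k. sqf_seq (k + 1)) ` half_gaps x" using j2 by blast
    qed
    then have "card Q \<le> card (half_gaps x)"
      using finite_half_gaps by (meson card_image_le card_mono finite_imageI le_trans)
    let ?S = "\<lambda>d. {N \<in> {n<..n + H}. d\<^sup>2 dvd N}"
    have "{n<..n + H} \<subseteq> Q \<union> (\<Union>d\<in>{2..D}. ?S d)"
    proof
      fix m assume m: "m \<in> {n<..n + H}"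
      show "m \<in> Q \<union> (\<Union>d\<in>{2..D}. ?S d)"
      proof (cases "squarefree m")
        case False
        have p: "sqprime m \<ge> 2" "(sqprime m)\<^sup>2 dvd m" using sqprime[OF False] prime_ge_2_nat by auto
        have "(sqprime m)\<^sup>2 \<le> m" using p m by (intro dvd_imp_le) auto
        then have "real ((sqprime m)\<^sup>2) \<le> real m" by (rule of_nat_mono)
        also have "\<dots> \<le> x" using m nH x by (simp add: le_nat_iff le_floor_iff)
        finally have "real (sqprime m) \<le> sqrt x" by (intro real_le_rsqrt) simp
        then have "sqprime m \<le> D" unfolding D_def by (rule le_nat_floor)
        then show ?thesis using p m by auto
      qed (use m in \<open>simp add: Q_def\<close>)
    qed
    then have "card {n<..n + H} \<le> card (Q \<union> (\<Union>d\<in>{2..D}. ?S d))"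
      by (intro card_mono) (auto simp: Q_def)
    also have "\<dots> \<le> card Q + card (\<Union>d\<in>{2..D}. ?S d)" by (rule card_Un_le)
    also have "card (\<Union>d\<in>{2..D}. ?S d) \<le> (\<Sum>d\<in>{2..D}. card (?S d))" by (rule card_UN_le) simp
    finally have HQ: "real H \<le> real (card Q) + (\<Sum>d\<in>{2..D}. real (card (?S d)))"
      unfolding of_nat_sum[symmetric] of_nat_add[symmetric] by (intro of_nat_mono) simp
    have "(\<Sum>d\<in>{2..D}. real (card (?S d))) \<le> (\<Sum>d\<in>{2..D}. real H * (1 / real d ^ 2) + 1)"
    proof (rule sum_mono)
      fix d assume "d \<in> {2..D}"
      then show "real (card (?S d)) \<le> real H * (1 / real d ^ 2) + 1"
        using card_multiples_le[of "d\<^sup>2" n H] by simp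
    qed
    also have "\<dots> = real H * (\<Sum>d=2..D. 1 / real d ^ 2) + real (card {2..D})"
      by (simp only: sum.distrib sum_distrib_left sum_constant mult_1_right)
    also have "\<dots> \<le> real H * (3 / 4) + sqrt x"
    proof (rule add_mono)
      show "real H * (\<Sum>d=2..D. 1 / real d ^ 2) \<le> real H * (3 / 4)"
        by (intro mult_left_mono sum_inverse_squares_from_2) simp
      have "real (card {2..D}) \<le> real D" by simp
      also have "\<dots> \<le> sqrt x" unfolding D_def using x by simp
      finally show "real (card {2..D}) \<le> sqrt x" .
    qed
    finally have "(\<Sum>d\<in>{2..D}. real (card (?S d))) \<le> real H * (3 / 4) + sqrt x" .
    moreover have "real (card Q) \<le> real (card (half_gaps x))"
      using \<open>card Q \<le> card (half_gaps x)\<close> by (rule of_nat_mono)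
    ultimately have "real H \<le> real (card (half_gaps x)) + (real H * (3 / 4) + sqrt x)"
      using HQ by linarith
    then show ?thesis using H by (simp add: field_simps)
  qed
  have "\<forall>\<^sub>F x::real in at_top. x / 20 \<le> (x / 2 - 1) / 4 - sqrt x" by real_asymp
  then show ?thesis using eventually_ge_at_top[of 2]
  proof eventually_elim
    case (elim x)
    show ?case by (rule order_trans[OF elim(1) main[OF elim(2)]])
  qed
qed

theorem theorem1:
  fixes \<gamma> :: real
  assumes "0 \<le> \<gamma>" and "\<gamma> < 3.75"
  shows "((\<lambda>x::real.
            (\<Sum>k | k \<ge> 1 \<and> x / 2 < real (sqf_seq (k + 1)) \<and> real (sqf_seq (k + 1)) \<le> x.
                sqf_gap k powr \<gamma>)
            / (1 / 2 * gap_moment \<gamma> * x)) \<longlongrightarrow> 1) at_top"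
proof -
  obtain K \<rho> :: real where K: "K > 0" and \<rho>: "0 < \<rho>" "\<rho> < 1" and tail:
    "\<And>m x. x \<ge> 1 \<Longrightarrow> (\<Sum>k\<in>large_gaps m x. sqf_gap k powr \<gamma>) \<le> K * \<rho> ^ m * x"
    by (rule large_gaps_moment[OF assms]) blast
  define F where "F x = (\<Sum>k\<in>half_gaps x. sqf_gap k powr \<gamma>)" for x
  \<comment> \<open>The cutoff \<open>2 ^ m\<close> is that of \<open>large_gaps\<close>, so
    \<open>F - G m\<close> is bounded by the tail estimate.\<close>
  define G where "G m x = (\<Sum>k\<in>{k \<in> half_gaps x. sqf_gap k \<le> real (2 ^ m)}. sqf_gap k powr \<gamma>)" for m x
  define a where "a T = (\<Sum>h=1..T. real h powr \<gamma> * (gap_density h / 2))" for T :: nat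
  have Glim: "((\<lambda>x. G m x / x) \<longlongrightarrow> a (2 ^ m)) at_top" for m
    unfolding G_def a_def by (rule small_gaps_tendsto)
  have FG: "G m x \<le> F x" "F x \<le> G m x + K * \<rho> ^ m * x" if x: "x \<ge> 1" for m x
  proof -
    show "G m x \<le> F x" unfolding G_def F_def using finite_half_gaps by (intro sum_mono2) auto
    have "F x = G m x + (\<Sum>k\<in>{k \<in> half_gaps x. \<not> sqf_gap k \<le> real (2 ^ m)}. sqf_gap k powr \<gamma>)"
    proof -
      have "half_gaps x = {k \<in> half_gaps x. sqf_gap k \<le> real (2 ^ m)} \<union> {k \<in> half_gaps x. \<not> sqf_gap k \<le> real (2 ^ m)}"
        by blast
      then show ?thesis unfolding F_def G_def
        using finite_half_gaps[of x] sum.union_disjoint[of "{k \<in> half_gaps x. sqf_gap k \<le> real (2 ^ m)}"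
          "{k \<in> half_gaps x. \<not> sqf_gap k \<le> real (2 ^ m)}" "\<lambda>k. sqf_gap k powr \<gamma>"] by auto
    qed
    also have "(\<Sum>k\<in>{k \<in> half_gaps x. \<not> sqf_gap k \<le> real (2 ^ m)}. sqf_gap k powr \<gamma>)
        \<le> (\<Sum>k\<in>large_gaps m x. sqf_gap k powr \<gamma>)"
      by (intro sum_mono2 finite_large_gaps) (auto simp: half_gaps_def large_gaps_def)
    also have "\<dots> \<le> K * \<rho> ^ m * x" by (rule tail[OF x])
    finally show "F x \<le> G m x + K * \<rho> ^ m * x" by simp
  qed
  have FGx: "G m x / x \<le> F x / x" "F x / x \<le> G m x / x + K * \<rho> ^ m" if "x \<ge> 1" for m x
    using FG[OF that, of m] that by (simp_all add: field_simps)
  have a0: "real h powr \<gamma> * (gap_density h / 2) \<ge> 0" if "h \<ge> 1" for h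
    using gap_density_nonneg[OF that] by simp
  \<comment> \<open>Convergence of the moment series: \<open>a (2 ^ T)\<close> is the limit of
    \<open>G T x / x\<close>, which is at most \<open>F x / x\<close> and hence at most
    \<open>G 0 x / x + K\<close>. The last bound is independent of \<open>T\<close>.\<close>
  have a_bound: "a T \<le> a 1 + 1 + K" for T
  proof -
    have "a T \<le> a (2 ^ T)" unfolding a_def
    proof (rule sum_mono2)
      show "{1..T} \<subseteq> {1..2 ^ T}" using less_exp[of T] by auto
      fix h assume "h \<in> {1..2 ^ T} - {1..T}"
      then show "0 \<le> real h powr \<gamma> * (gap_density h / 2)" by (intro a0) auto
    qed simp
    also have "a (2 ^ T) \<le> a 1 + 1 + K"
    proof (rule tendsto_upperbound[OF Glim])
      have "\<forall>\<^sub>F x in at_top. G 0 x / x < a 1 + 1"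
        using Glim[of 0] by (intro order_tendstoD) auto
      then show "\<forall>\<^sub>F x in at_top. G T x / x \<le> a 1 + 1 + K"
        using eventually_ge_at_top[of 1]
      proof eventually_elim
        case (elim x)
        then show ?case using FGx(1)[of x T] FGx(2)[of x 0] by simp
      qed
    qed simp
    finally show ?thesis .
  qed
  have a_sum: "(\<Sum>h<n. real (Suc h) powr \<gamma> * gap_density (Suc h)) = 2 * a n" for n
    by (induction n) (auto simp: a_def algebra_simps)
  have "summable (\<lambda>h. real (Suc h) powr \<gamma> * gap_density (Suc h))"
  proof (rule summableI_nonneg_bounded)
    show "0 \<le> real (Suc n) powr \<gamma> * gap_density (Suc n)" for n
      using gap_density_nonneg[of "Suc n"] by simp
    show "(\<Sum>h<n. real (Suc h) powr \<gamma> * gap_density (Suc h)) \<le> 2 * (a 1 + 1 + K)" for n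
      unfolding a_sum using a_bound[of n] by simp
  qed
  then have "(\<lambda>n. \<Sum>h<n. real (Suc h) powr \<gamma> * gap_density (Suc h)) \<longlonglongrightarrow> gap_moment \<gamma>"
    unfolding gap_moment_def by (rule summable_LIMSEQ)
  then have "(\<lambda>n. 2 * a n / 2) \<longlonglongrightarrow> gap_moment \<gamma> / 2" unfolding a_sum by (rule tendsto_divide) auto
  then have "a \<longlonglongrightarrow> gap_moment \<gamma> / 2" by simp
  moreover have "filterlim (\<lambda>m::nat. 2 ^ m :: nat) sequentially sequentially"
    by (rule filterlim_subseq) (simp add: strict_mono_def)
  ultimately have a_lim: "(\<lambda>m. a (2 ^ m)) \<longlonglongrightarrow> gap_moment \<gamma> / 2" by (rule filterlim_compose)
  have \<rho>_lim: "(\<lambda>m. K * \<rho> ^ m) \<longlonglongrightarrow> K * 0"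
    using \<rho> by (intro tendsto_mult tendsto_const LIMSEQ_power_zero) auto
  \<comment> \<open>The tail bound is uniform in \<open>x\<close>, which permits the exchange of
    limits: \<open>m\<close> is fixed first, and \<open>x\<close> tends to infinity
    afterwards.\<close>
  have Flim: "((\<lambda>x. F x / x) \<longlongrightarrow> gap_moment \<gamma> / 2) at_top"
  proof (rule tendstoI)
    fix e :: real assume e: "e > 0"
    have "\<forall>\<^sub>F m in sequentially. dist (a (2 ^ m)) (gap_moment \<gamma> / 2) < e / 3" using tendstoD[OF a_lim, of "e / 3"] e by simp
    moreover have "\<forall>\<^sub>F m in sequentially. dist (K * \<rho> ^ m) (K * 0) < e / 3" using tendstoD[OF \<rho>_lim, of "e / 3"] e by simp
    ultimately have "\<forall>\<^sub>F m in sequentially. dist (a (2 ^ m)) (gap_moment \<gamma> / 2) < e / 3 \<and> dist (K * \<rho> ^ m) (K * 0) < e / 3"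
      by (rule eventually_conj)
    then obtain m where m: "dist (a (2 ^ m)) (gap_moment \<gamma> / 2) < e / 3" "dist (K * \<rho> ^ m) (K * 0) < e / 3"
      using eventually_happens'[OF sequentially_bot] by blast
    have "\<forall>\<^sub>F x in at_top. dist (G m x / x) (a (2 ^ m)) < e / 3" using tendstoD[OF Glim, of "e / 3"] e by simp
    then show "\<forall>\<^sub>F x in at_top. dist (F x / x) (gap_moment \<gamma> / 2) < e"
      using eventually_ge_at_top[of 1]
    proof eventually_elim
      case (elim x)
      then show ?case using m FGx[OF elim(2), of m] unfolding dist_real_def by linarith
    qed
  qed
  \<comment> \<open>Since \<open>\<gamma>\<close> is nonnegative and gaps are at least 1, each term
    of \<open>F\<close> is at least 1, and counting the terms bounds the limit from below.\<close>
  have "gap_moment \<gamma> / 2 \<ge> 1 / 20"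
  proof (rule tendsto_lowerbound[OF Flim])
    show "\<forall>\<^sub>F x in at_top. 1 / 20 \<le> F x / x"
      using card_half_gaps_lower eventually_gt_at_top[of 0]
    proof eventually_elim
      case (elim x)
      have "real (card (half_gaps x)) = (\<Sum>k\<in>half_gaps x. 1)" by simp
      also have "\<dots> \<le> F x" unfolding F_def
      proof (rule sum_mono)
        fix k assume "k \<in> half_gaps x"
        then have "k \<ge> 1" by (simp add: half_gaps_def)
        then obtain h where "h \<ge> 1" "sqf_gap k = real h" by (rule sqf_gap_nat)
        then show "1 \<le> sqf_gap k powr \<gamma>" using assms(1) by (simp add: ge_one_powr_ge_zero)
      qed
      finally show ?case using elim by (simp add: field_simps)
    qed
  qed simp
  then have pos: "gap_moment \<gamma> / 2 \<noteq> 0" by auto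
  have "((\<lambda>x. F x / x / (gap_moment \<gamma> / 2)) \<longlongrightarrow> gap_moment \<gamma> / 2 / (gap_moment \<gamma> / 2)) at_top"
    by (intro tendsto_divide Flim tendsto_const pos)
  then have "((\<lambda>x. F x / x / (gap_moment \<gamma> / 2)) \<longlongrightarrow> 1) at_top" using pos by simp
  moreover have "(\<lambda>x. F x / x / (gap_moment \<gamma> / 2)) = (\<lambda>x. F x / (1 / 2 * gap_moment \<gamma> * x))"
    by (intro ext) (simp add: mult.commute)
  ultimately show ?thesis unfolding F_def half_gaps_def by (simp only:)
qed

end
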